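(* Let $(X,\pi)$ be a holomorphic Poisson manifold and let $U,V\subseteq X$ be open subsets. Then there is a long exact sequence $$\cdots\to H_k(U\cup V,\pi)\xrightarrow{(i_1^*,\,i_2^* )^T} H_k(U,\pi)\oplus H_k(V,\pi)\xrightarrow{(j_1^*,\,-j_2^* )} H_k(U\cap V,\pi)\xrightarrow{\;g\;} H_{k+1}(U\cup V,\pi)\to\cdots$$ where $i_1:U\to U\cup V$, $i_2:V\to U\cup V$, $j_1:U\cap V\to U$ and $j_2:U\cap V\to V$ are the inclusions, and $g$ denotes a connecting homomorphism.
   Context: Holomorphic Poisson manifold: a complex manifold $X$ with a holomorphic bivector field $\pi\in H^0(X,\bigwedge^2T_X)$ such that $\{f,g\}:=\pi(df\wedge dg)$ makes $\mathcal{O}_X(W)$ a Poisson algebra for each open $W\subseteq X$. For an open $U\subseteq X$, $(U,\pi|_U)$ is a holomorphic Poisson manifold. Let $l_\pi$ be contraction by $\pi$ on differential forms (lowering degree by $2$, with $l_\pi(df\wedge dg)=\{f,g\}$) and $\partial_\pi:=l_\pi\circ\partial-\partial\circ l_\pi$. Then $\partial_\pi$ maps $\Omega_X^p$ to $\Omega_X^{p-1}$ and smooth $(p,q)$-forms $\mathcal{A}_X^{p,q}$ to $\mathcal{A}_X^{p-1,q}$, with $\partial_\pi^2=0$ and $\bar\partial\partial_\pi+\partial_\pi\bar\partial=0$. Koszul-Brylinski homology: if $\dim_{\mathbb{C}}X=n$, let $\mathcal{M}_X^\bullet(\pi)$ be the complex of sheaves with $\mathcal{M}_X^k(\pi)=\Omega_X^{n-k}$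 and differential $\partial_\pi$; then $H_k(X,\pi):=\mathbb{H}^k(X,\mathcal{M}_X^\bullet(\pi))$ (hypercohomology). Equivalently $H_k(X,\pi)\cong H^{k-n}(K^\bullet(X,\pi))$, where $K^j(X,\pi)=\bigoplus_{p+q=j}\mathcal{A}^{-p,q}(X)$ with total differential $\partial_\pi+\bar\partial$. Write $H_k(U,\pi)$ for $H_k(U,\pi|_U)$. An inclusion $j:U\hookrightarrow W$ of open subsets induces $j^*:H_k(W,\pi)\to H_k(U,\pi)$ by pullback (restriction) of forms. Matrix notation: $(f,g)^T:W\to A\oplus B$ is $w\mapsto(f(w),g(w))^T$ and $(f,g):A\oplus B\to W$ is $(a,b)^T\mapsto f(a)+g(b)$. *)

theory Defs
  imports
    "HOL-Analysis.Analysis"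
    "HOL-Algebra.Exact_Sequence"
    "HOL-Library.Function_Algebras"
begin

section \<open>Smooth and holomorphic functions on the model space\<close>

text \<open>The model space \<open>\<complex>\<^sup>I\<close>, for an index set \<open>I\<close> inside a finite type \<open>'n\<close>, is realised as a
  coordinate subspace of \<^typ>\<open>complex^'n\<close>. Its dimension is \<open>card I\<close>; the choice \<open>I = UNIV\<close> gives
  \<^typ>\<open>complex^'n\<close> itself, and \<open>I = {}\<close> gives dimension \<open>0\<close>, which no type \<^typ>\<open>complex^'n\<close> has.\<close>

definition model_space :: "'n::finite set \<Rightarrow> (complex^'n) set" where
  "model_space I = {z. \<forall>i. i \<notin> I \<longrightarrow> z $ i = 0}"

definition dir_deriv :: "complex^'n::finite \<Rightarrow> (complex^'n \<Rightarrow> complex) \<Rightarrow> complex^'n \<Rightarrow> complex" where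
  "dir_deriv v F z = vector_derivative (\<lambda>t::real. F (z + t *\<^sub>R v)) (at 0)"

text \<open>\<open>Ck S k W F\<close>: \<open>F\<close> is \<open>k\<close> times continuously differentiable (over the reals) on \<open>W\<close>, where
  \<open>W\<close> is a relatively open subset of the subspace \<open>S\<close>.\<close>

primrec Ck :: "(complex^'n::finite) set \<Rightarrow> nat \<Rightarrow> (complex^'n) set \<Rightarrow> (complex^'n \<Rightarrow> complex) \<Rightarrow> bool"
where
  "Ck S 0 W F \<longleftrightarrow> continuous_on W F"
| "Ck S (Suc k) W F \<longleftrightarrow> F differentiable_on W \<and> (\<forall>v\<in>S. Ck S k W (dir_deriv v F))"

definition wirtinger :: "'n::finite \<Rightarrow> (complex^'n \<Rightarrow> complex) \<Rightarrow> complex^'n \<Rightarrow> complex" where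
  "wirtinger i F z = (dir_deriv (axis i 1) F z - \<i> * dir_deriv (axis i \<i>) F z) / 2"

definition wirtinger_bar :: "'n::finite \<Rightarrow> (complex^'n \<Rightarrow> complex) \<Rightarrow> complex^'n \<Rightarrow> complex" where
  "wirtinger_bar i F z = (dir_deriv (axis i 1) F z + \<i> * dir_deriv (axis i \<i>) F z) / 2"


section \<open>Complex manifolds\<close>

type_synonym ('a, 'n) chart = "'a set \<times> ('a \<Rightarrow> complex^'n)"

record ('a, 'n) cmanifold =
  top_of :: "'a topology"
  ind :: "'n set"
  atlas :: "('a, 'n) chart set"

definition cdim :: "('a, 'n::finite) cmanifold \<Rightarrow> nat" where
  "cdim M = card (ind M)"

abbreviation dom_of :: "('a, 'n) chart \<Rightarrow> 'a set" where
  "dom_of c \<equiv> fst c"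

abbreviation coord :: "('a, 'n::finite) chart \<Rightarrow> 'n \<Rightarrow> 'a \<Rightarrow> complex" where
  "coord c i x \<equiv> snd c x $ i"

definition local_rep :: "('a, 'n::finite) chart \<Rightarrow> ('a \<Rightarrow> complex) \<Rightarrow> complex^'n \<Rightarrow> complex" where
  "local_rep c f = f \<circ> inv_into (dom_of c) (snd c)"

text \<open>\<open>\<partial>f/\<partial>z\<^sub>i\<close> and \<open>\<partial>f/\<partial>\<bar>z\<^sub>i\<close> at \<open>x\<close>, where \<open>z\<^sub>i = coord c i\<close>.\<close>

definition dz :: "('a, 'n::finite) chart \<Rightarrow> 'n \<Rightarrow> ('a \<Rightarrow> complex) \<Rightarrow> 'a \<Rightarrow> complex" where
  "dz c i f x = wirtinger i (local_rep c f) (snd c x)"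

definition dzbar :: "('a, 'n::finite) chart \<Rightarrow> 'n \<Rightarrow> ('a \<Rightarrow> complex) \<Rightarrow> 'a \<Rightarrow> complex" where
  "dzbar c i f x = wirtinger_bar i (local_rep c f) (snd c x)"

text \<open>Smoothness and holomorphy of \<open>f\<close> in the chart \<open>c\<close>, on an open subset \<open>W\<close> of its domain.\<close>

definition smooth_in :: "'n::finite set \<Rightarrow> ('a, 'n) chart \<Rightarrow> 'a set \<Rightarrow> ('a \<Rightarrow> complex) \<Rightarrow> bool" where
  "smooth_in I c W f \<longleftrightarrow> (\<forall>k. Ck (model_space I) k (snd c ` W) (local_rep c f))"

definition holomorphic_in :: "'n::finite set \<Rightarrow> ('a, 'n) chart \<Rightarrow> 'a set \<Rightarrow> ('a \<Rightarrow> complex) \<Rightarrow> bool" where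
  "holomorphic_in I c W f \<longleftrightarrow> smooth_in I c W f \<and> (\<forall>i\<in>I. \<forall>x\<in>W. dzbar c i f x = 0)"

definition complex_manifold :: "('a, 'n::finite) cmanifold \<Rightarrow> bool" where
  "complex_manifold M \<longleftrightarrow>
     Hausdorff_space (top_of M) \<and> second_countable (top_of M) \<and>
     topspace (top_of M) = (\<Union>c\<in>atlas M. dom_of c) \<and>
     (\<forall>c\<in>atlas M.
        openin (top_of M) (dom_of c) \<and>
        openin (top_of_set (model_space (ind M))) (snd c ` dom_of c) \<and>
        homeomorphic_map (subtopology (top_of M) (dom_of c))
          (top_of_set (snd c ` dom_of c)) (snd c)) \<and>
     (\<forall>c\<in>atlas M. \<forall>c'\<in>atlas M. \<forall>a\<in>ind M.
        holomorphic_in (ind M) c (dom_of c \<inter> dom_of c') (coord c' a))"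

text \<open>\<open>\<O>(W)\<close>; functions on \<open>W\<close> are extended by zero outside \<open>W\<close>.\<close>

definition hol_functions :: "('a, 'n::finite) cmanifold \<Rightarrow> 'a set \<Rightarrow> ('a \<Rightarrow> complex) set" where
  "hol_functions M W = {f. (\<forall>x. x \<notin> W \<longrightarrow> f x = 0) \<and>
     (\<forall>c\<in>atlas M. holomorphic_in (ind M) c (W \<inter> dom_of c) f)}"


section \<open>Holomorphic Poisson structures\<close>

text \<open>A bivector field is given by its components \<open>\<pi>\<^sup>i\<^sup>j\<close> in every chart of the atlas, so that
  \<open>\<pi> = (\<Sum>i<j. \<pi>\<^sup>i\<^sup>j \<partial>\<^sub>i \<and> \<partial>\<^sub>j) = 1/2 (\<Sum>i,j. \<pi>\<^sup>i\<^sup>j \<partial>\<^sub>i \<and> \<partial>\<^sub>j)\<close>.\<close>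

type_synonym ('a, 'n) bivector = "('a, 'n) chart \<Rightarrow> 'a \<Rightarrow> 'n \<Rightarrow> 'n \<Rightarrow> complex"

definition holomorphic_bivector :: "('a, 'n::finite) cmanifold \<Rightarrow> ('a, 'n) bivector \<Rightarrow> bool" where
  "holomorphic_bivector M \<pi> \<longleftrightarrow>
     (\<forall>c\<in>atlas M. \<forall>i\<in>ind M. \<forall>j\<in>ind M.
        holomorphic_in (ind M) c (dom_of c) (\<lambda>x. \<pi> c x i j) \<and>
        (\<forall>x\<in>dom_of c. \<pi> c x j i = - \<pi> c x i j)) \<and>
     (\<forall>c\<in>atlas M. \<forall>c'\<in>atlas M. \<forall>x\<in>dom_of c \<inter> dom_of c'. \<forall>a\<in>ind M. \<forall>b\<in>ind M.
        \<pi> c' x a b =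
          (\<Sum>i\<in>ind M. \<Sum>j\<in>ind M. \<pi> c x i j * dz c i (coord c' a) x * dz c j (coord c' b) x))"

text \<open>\<open>{f,g} = \<pi>(df \<and> dg)\<close> on \<open>W\<close>. The value at \<open>x\<close> is computed in some chart around \<open>x\<close>; by the
  transformation rule for \<open>\<pi>\<close> it does not depend on which one.\<close>

definition poisson_bracket ::
  "('a, 'n::finite) cmanifold \<Rightarrow> ('a, 'n) bivector \<Rightarrow> 'a set \<Rightarrow>
   ('a \<Rightarrow> complex) \<Rightarrow> ('a \<Rightarrow> complex) \<Rightarrow> 'a \<Rightarrow> complex" where
  "poisson_bracket M \<pi> W f g x =
     (if x \<in> W
      then let c = (SOME c. c \<in> atlas M \<and> x \<in> dom_of c)
           in \<Sum>i\<in>ind M. \<Sum>j\<in>ind M. \<pi> c x i j * dz c i f x * dz c j g x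
      else 0)"

text \<open>For an algebra \<open>\<A>\<close> of complex-valued functions under the pointwise operations (as \<open>\<O>(W)\<close> is):
  \<open>br\<close> is a complex Lie bracket on \<open>\<A>\<close> and a derivation in its first, hence in each, argument.\<close>

definition poisson_algebra ::
  "('a \<Rightarrow> complex) set \<Rightarrow> (('a \<Rightarrow> complex) \<Rightarrow> ('a \<Rightarrow> complex) \<Rightarrow> 'a \<Rightarrow> complex) \<Rightarrow> bool" where
  "poisson_algebra \<A> br \<longleftrightarrow>
     (\<forall>f\<in>\<A>. \<forall>g\<in>\<A>. br f g \<in> \<A>) \<and>
     (\<forall>f\<in>\<A>. \<forall>g\<in>\<A>. br f g = - br g f) \<and>
     (\<forall>f\<in>\<A>. \<forall>g\<in>\<A>. \<forall>h\<in>\<A>. br (f + g) h = br f h + br g h) \<and>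
     (\<forall>a. \<forall>f\<in>\<A>. \<forall>g\<in>\<A>. br (\<lambda>x. a * f x) g = (\<lambda>x. a * br f g x)) \<and>
     (\<forall>f\<in>\<A>. \<forall>g\<in>\<A>. \<forall>h\<in>\<A>. br f (br g h) + br g (br h f) + br h (br f g) = 0) \<and>
     (\<forall>f\<in>\<A>. \<forall>g\<in>\<A>. \<forall>h\<in>\<A>. br (f * g) h = f * br g h + br f h * g)"

definition holomorphic_poisson_manifold ::
  "('a, 'n::finite) cmanifold \<Rightarrow> ('a, 'n) bivector \<Rightarrow> bool" where
  "holomorphic_poisson_manifold M \<pi> \<longleftrightarrow>
     complex_manifold M \<and> holomorphic_bivector M \<pi> \<and>
     (\<forall>W. openin (top_of M) W \<longrightarrow>
        poisson_algebra (hol_functions M W) (poisson_bracket M \<pi> W))"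


section \<open>Smooth forms of type (p,q)\<close>

text \<open>A smooth section of \<open>\<Lambda>\<^sup>p T\<^sup>*\<^sup>1\<^sup>,\<^sup>0 \<otimes> \<Lambda>\<^sup>q T\<^sup>*\<^sup>0\<^sup>,\<^sup>1\<close> over an open set is given by its components in all
  charts \<open>c\<close> of the atlas at all points \<open>x\<close>: the form is
    \<open>1/(p! q!) \<Sum> \<omega> c x [i\<^sub>1,\<dots>,i\<^sub>p] [j\<^sub>1,\<dots>,j\<^sub>q] dz\<^sub>i\<^sub>1 \<and> \<dots> \<and> dz\<^sub>i\<^sub>p \<and> d\<bar>z\<^sub>j\<^sub>1 \<and> \<dots> \<and> d\<bar>z\<^sub>j\<^sub>q\<close>
  with coefficients alternating in the \<open>i\<close>'s and in the \<open>j\<close>'s. Components outside the range of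
  these indices, and at points where they are not defined, are set to zero, so that the family
  \<open>\<omega>\<close> is determined by the form.\<close>

type_synonym ('a, 'n) form = "('a, 'n) chart \<Rightarrow> 'a \<Rightarrow> 'n list \<Rightarrow> 'n list \<Rightarrow> complex"

definition multi_ind :: "('a, 'n::finite) cmanifold \<Rightarrow> nat \<Rightarrow> 'n list set" where
  "multi_ind M p = {is. length is = p \<and> set is \<subseteq> ind M}"

definition swap :: "nat \<Rightarrow> nat \<Rightarrow> 'b list \<Rightarrow> 'b list" where
  "swap r s xs = xs[r := xs ! s, s := xs ! r]"

definition omit :: "nat \<Rightarrow> 'b list \<Rightarrow> 'b list" where
  "omit r xs = take r xs @ drop (Suc r) xs"

definition forms :: "('a, 'n::finite) cmanifold \<Rightarrow> 'a set \<Rightarrow> nat \<Rightarrow> nat \<Rightarrow> ('a, 'n) form set" where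
  "forms M U p q = {\<omega>.
     (\<forall>c x is js. \<not> (c \<in> atlas M \<and> x \<in> U \<inter> dom_of c \<and> is \<in> multi_ind M p \<and> js \<in> multi_ind M q)
        \<longrightarrow> \<omega> c x is js = 0) \<and>
     (\<forall>c x is js r s. r < s \<and> s < p \<and> length is = p \<longrightarrow> \<omega> c x (swap r s is) js = - \<omega> c x is js) \<and>
     (\<forall>c x is js r s. r < s \<and> s < q \<and> length js = q \<longrightarrow> \<omega> c x is (swap r s js) = - \<omega> c x is js) \<and>
     (\<forall>c\<in>atlas M. \<forall>is js. smooth_in (ind M) c (U \<inter> dom_of c) (\<lambda>x. \<omega> c x is js)) \<and>
     (\<forall>c\<in>atlas M. \<forall>c'\<in>atlas M. \<forall>x\<in>U \<inter> dom_of c \<inter> dom_of c'.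
        \<forall>is\<in>multi_ind M p. \<forall>js\<in>multi_ind M q.
          \<omega> c x is js =
            (\<Sum>as\<in>multi_ind M p. \<Sum>bs\<in>multi_ind M q.
               (\<Prod>r<p. dz c (is ! r) (coord c' (as ! r)) x) *
               (\<Prod>s<q. cnj (dz c (js ! s) (coord c' (bs ! s)) x)) *
               \<omega> c' x as bs))}"

text \<open>The sign \<open>(-1)\<^sup>p\<close> in \<open>delbar\<close> comes from moving the new \<open>d\<bar>z\<close> past the \<open>dz\<close>'s.\<close>

definition del :: "('a, 'n::finite) cmanifold \<Rightarrow> 'a set \<Rightarrow> ('a, 'n) form \<Rightarrow> ('a, 'n) form" where
  "del M U \<omega> c x is js =
     (if c \<in> atlas M \<and> x \<in> U \<inter> dom_of c \<and> set is \<subseteq> ind M \<and> set js \<subseteq> ind M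
      then \<Sum>r<length is. (-1) ^ r * dz c (is ! r) (\<lambda>y. \<omega> c y (omit r is) js) x
      else 0)"

definition delbar :: "('a, 'n::finite) cmanifold \<Rightarrow> 'a set \<Rightarrow> ('a, 'n) form \<Rightarrow> ('a, 'n) form" where
  "delbar M U \<omega> c x is js =
     (if c \<in> atlas M \<and> x \<in> U \<inter> dom_of c \<and> set is \<subseteq> ind M \<and> set js \<subseteq> ind M
      then (-1) ^ length is *
        (\<Sum>s<length js. (-1) ^ s * dzbar c (js ! s) (\<lambda>y. \<omega> c y is (omit s js)) x)
      else 0)"

text \<open>Contraction with \<open>\<pi>\<close>, normalised by \<open>l\<^sub>\<pi>(df \<and> dg) = {f,g}\<close>: the components of \<open>df \<and> dg\<close> are
  \<open>\<partial>\<^sub>a f \<partial>\<^sub>b g - \<partial>\<^sub>b f \<partial>\<^sub>a g\<close>.\<close>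

definition contraction ::
  "('a, 'n::finite) cmanifold \<Rightarrow> ('a, 'n) bivector \<Rightarrow> ('a, 'n) form \<Rightarrow> ('a, 'n) form" where
  "contraction M \<pi> \<omega> c x is js =
     (\<Sum>a\<in>ind M. \<Sum>b\<in>ind M. \<pi> c x a b * \<omega> c x (a # b # is) js) / 2"

definition del_pi ::
  "('a, 'n::finite) cmanifold \<Rightarrow> ('a, 'n) bivector \<Rightarrow> 'a set \<Rightarrow> ('a, 'n) form \<Rightarrow> ('a, 'n) form" where
  "del_pi M \<pi> U \<omega> = contraction M \<pi> (del M U \<omega>) - del M U (contraction M \<pi> \<omega>)"


section \<open>Koszul--Brylinski homology\<close>

text \<open>\<open>K\<^sup>j(U,\<pi>)\<close> is the direct sum of the spaces of \<open>(p,q)\<close>-forms with \<open>q - p = j\<close> (the summand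
  \<open>\<A>\<^sup>-\<^sup>p\<^sup>,\<^sup>q\<close> has first degree \<open>-p\<close>); \<open>\<omega> p q\<close> is the component of type \<open>(p,q)\<close>. The sum is finite
  since alternating components of type \<open>(p,q)\<close> vanish when \<open>p\<close> or \<open>q\<close> exceeds the dimension.\<close>

type_synonym ('a, 'n) mixed_form = "nat \<Rightarrow> nat \<Rightarrow> ('a, 'n) form"

definition KB_cochains :: "('a, 'n::finite) cmanifold \<Rightarrow> int \<Rightarrow> 'a set \<Rightarrow> ('a, 'n) mixed_form set" where
  "KB_cochains M j U =
     {\<omega>. \<forall>p q. if int q - int p = j then \<omega> p q \<in> forms M U p q else \<omega> p q = 0}"

definition KB_diff ::
  "('a, 'n::finite) cmanifold \<Rightarrow> ('a, 'n) bivector \<Rightarrow> 'a set \<Rightarrow>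
   ('a, 'n) mixed_form \<Rightarrow> ('a, 'n) mixed_form" where
  "KB_diff M \<pi> U \<omega> p q =
     del_pi M \<pi> U (\<omega> (Suc p) q) + (case q of 0 \<Rightarrow> 0 | Suc q' \<Rightarrow> delbar M U (\<omega> p q'))"

definition KB_cycle_group ::
  "('a, 'n::finite) cmanifold \<Rightarrow> ('a, 'n) bivector \<Rightarrow> int \<Rightarrow> 'a set \<Rightarrow> ('a, 'n) mixed_form monoid" where
  "KB_cycle_group M \<pi> k U =
     \<lparr>carrier = {\<omega> \<in> KB_cochains M (k - int (cdim M)) U. KB_diff M \<pi> U \<omega> = 0},
      mult = (+), one = 0\<rparr>"

definition KB_boundaries ::
  "('a, 'n::finite) cmanifold \<Rightarrow> ('a, 'n) bivector \<Rightarrow> int \<Rightarrow> 'a set \<Rightarrow> ('a, 'n) mixed_form set" where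
  "KB_boundaries M \<pi> k U = KB_diff M \<pi> U ` KB_cochains M (k - int (cdim M) - 1) U"

text \<open>\<open>H\<^sub>k(U,\<pi>) = H\<^sup>k\<^sup>-\<^sup>n(K(U,\<pi>))\<close> with \<open>n\<close> the complex dimension.\<close>

definition KB_homology ::
  "('a, 'n::finite) cmanifold \<Rightarrow> ('a, 'n) bivector \<Rightarrow> int \<Rightarrow> 'a set \<Rightarrow>
   ('a, 'n) mixed_form set monoid" where
  "KB_homology M \<pi> k U = KB_cycle_group M \<pi> k U Mod KB_boundaries M \<pi> k U"

definition KB_class ::
  "('a, 'n::finite) cmanifold \<Rightarrow> ('a, 'n) bivector \<Rightarrow> int \<Rightarrow> 'a set \<Rightarrow>
   ('a, 'n) mixed_form \<Rightarrow> ('a, 'n) mixed_form set" where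
  "KB_class M \<pi> k U \<omega> = KB_boundaries M \<pi> k U #>\<^bsub>KB_cycle_group M \<pi> k U\<^esub> \<omega>"

definition restrict_form :: "'a set \<Rightarrow> ('a, 'n) mixed_form \<Rightarrow> ('a, 'n) mixed_form" where
  "restrict_form U \<omega> = (\<lambda>p q c x is js. if x \<in> U then \<omega> p q c x is js else 0)"

text \<open>The map \<open>j\<^sup>* : H\<^sub>k(W,\<pi>) \<rightarrow> H\<^sub>k(U,\<pi>)\<close> for \<open>U \<subseteq> W\<close>; cosets of boundaries over \<open>W\<close> are sent to
  the common class of the restrictions of their elements.\<close>

definition KB_restrict ::
  "('a, 'n::finite) cmanifold \<Rightarrow> ('a, 'n) bivector \<Rightarrow> int \<Rightarrow> 'a set \<Rightarrow>
   ('a, 'n) mixed_form set \<Rightarrow> ('a, 'n) mixed_form set" where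
  "KB_restrict M \<pi> k U \<xi> = the_elem ((\<lambda>\<omega>. KB_class M \<pi> k U (restrict_form U \<omega>)) ` \<xi>)"


section \<open>Mayer--Vietoris maps\<close>

text \<open>\<^const>\<open>exact_seq\<close> needs all groups to have the same element type, hence this variant.\<close>

definition exact_at ::
  "('a, 'u) monoid_scheme \<Rightarrow> ('a \<Rightarrow> 'b) \<Rightarrow> ('b, 'v) monoid_scheme \<Rightarrow> ('b \<Rightarrow> 'c) \<Rightarrow>
   ('c, 'w) monoid_scheme \<Rightarrow> bool" where
  "exact_at F f G g H \<longleftrightarrow> group_hom F G f \<and> group_hom G H g \<and> kernel G H g = f ` carrier F"

definition MV_pair ::
  "('a, 'n::finite) cmanifold \<Rightarrow> ('a, 'n) bivector \<Rightarrow> int \<Rightarrow> 'a set \<Rightarrow> 'a set \<Rightarrow>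
   ('a, 'n) mixed_form set \<Rightarrow> ('a, 'n) mixed_form set \<times> ('a, 'n) mixed_form set" where
  "MV_pair M \<pi> k U V \<xi> = (KB_restrict M \<pi> k U \<xi>, KB_restrict M \<pi> k V \<xi>)"

definition MV_diff ::
  "('a, 'n::finite) cmanifold \<Rightarrow> ('a, 'n) bivector \<Rightarrow> int \<Rightarrow> 'a set \<Rightarrow> 'a set \<Rightarrow>
   ('a, 'n) mixed_form set \<times> ('a, 'n) mixed_form set \<Rightarrow> ('a, 'n) mixed_form set" where
  "MV_diff M \<pi> k U V = (\<lambda>(\<xi>, \<zeta>).
     KB_restrict M \<pi> k (U \<inter> V) \<xi> \<otimes>\<^bsub>KB_homology M \<pi> k (U \<inter> V)\<^esub>
     inv\<^bsub>KB_homology M \<pi> k (U \<inter> V)\<^esub> KB_restrict M \<pi> k (U \<inter> V) \<zeta>)"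

text \<open>\<open>g\<close> is the connecting homomorphism of the short exact sequence
  \<open>0 \<rightarrow> K(U \<union> V) \<rightarrow> K(U) \<oplus> K(V) \<rightarrow> K(U \<inter> V) \<rightarrow> 0\<close>: lift a cycle \<open>\<eta>\<close> over \<open>U \<inter> V\<close> to \<open>(\<alpha>, \<beta>)\<close>,
  differentiate, and glue the result to a cycle \<open>\<gamma>\<close> over \<open>U \<union> V\<close>.\<close>

definition is_connecting_hom ::
  "('a, 'n::finite) cmanifold \<Rightarrow> ('a, 'n) bivector \<Rightarrow> int \<Rightarrow> 'a set \<Rightarrow> 'a set \<Rightarrow>
   (('a, 'n) mixed_form set \<Rightarrow> ('a, 'n) mixed_form set) \<Rightarrow> bool" where
  "is_connecting_hom M \<pi> k U V g \<longleftrightarrow>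
     g \<in> hom (KB_homology M \<pi> k (U \<inter> V)) (KB_homology M \<pi> (k + 1) (U \<union> V)) \<and>
     (\<forall>\<eta> \<in> carrier (KB_cycle_group M \<pi> k (U \<inter> V)).
      \<forall>\<alpha> \<in> KB_cochains M (k - int (cdim M)) U.
      \<forall>\<beta> \<in> KB_cochains M (k - int (cdim M)) V.
      \<forall>\<gamma> \<in> carrier (KB_cycle_group M \<pi> (k + 1) (U \<union> V)).
        restrict_form (U \<inter> V) \<alpha> - restrict_form (U \<inter> V) \<beta> = \<eta> \<and>
        restrict_form U \<gamma> = KB_diff M \<pi> U \<alpha> \<and>
        restrict_form V \<gamma> = KB_diff M \<pi> V \<beta> \<longrightarrow>
          g (KB_class M \<pi> k (U \<inter> V) \<eta>) = KB_class M \<pi> (k + 1) (U \<union> V) \<gamma>)"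

end

theory Submission
  imports Defs
begin

text \<open>The restriction maps give a sequence \<open>0 \<rightarrow> K(U \<union> V) \<rightarrow> K(U) \<oplus> K(V) \<rightarrow> K(U \<inter> V) \<rightarrow> 0\<close> of cochain
  complexes. It is exact because forms glue, and because a smooth function \<open>\<rho>\<close> on \<open>U \<union> V\<close> that is
  \<open>1\<close> near \<open>U - V\<close> and \<open>0\<close> near \<open>V - U\<close> splits a form \<open>\<eta>\<close> on \<open>U \<inter> V\<close> as \<open>(1 - \<rho>) \<eta> + \<rho> \<eta>\<close>, whose
  summands extend by zero to \<open>U\<close> and \<open>V\<close>. The long exact sequence is that of this short exact
  sequence. That these are complexes at all rests on two computations with components: \<open>\<partial>\<close>,
  \<open>\<partial>\<bar>\<close> and the contraction commute with changes of charts, and \<open>\<partial>\<^sub>\<pi>\<^sup>2 = 0\<close> follows from the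
  Jacobi identity for the brackets of the coordinate functions.\<close>

section \<open>Alternating sums over lists of indices\<close>

text \<open>The obstacle is the size of the component computations, so they are separated from
  analysis. Components are regarded as elements of the ring of all complex functions, set to zero
  off the domain of a chart and for indices outside \<open>ind M\<close>. Identities between forms
  then become identities in a commutative ring with commuting derivations, and sums may range over
  the whole index type. The factor 1/2 in the contraction is a constant function, not extended by
  zero, whence the separate scalar \<open>h\<close>. The recursion \<open>asum\<close> is the
  alternating sum over the removal of one entry, in a form that suits induction on the list. In
  coordinates the Koszul-Brylinski differential is \<open>E - R\<close>, where \<open>E\<close>
  differentiates the form and \<open>R\<close> the bivector. Its square has terms of second, first
  and zeroth order in the form: the first kind cancels by symmetry, and the others are contractions
  with the Jacobi identity and with its derivative. That identity is given only for holomorphic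
  functions on open sets, so it is applied to coordinates on the part of a chart that is under
  consideration.\<close>

primrec asum :: "('i \<Rightarrow> 'i list \<Rightarrow> 'r::ab_group_add) \<Rightarrow> 'i list \<Rightarrow> 'r" where
  "asum f [] = 0"
| "asum f (i # I) = f i I - asum (\<lambda>j K. f j (i # K)) I"

text \<open>Only adjacent transpositions are mentioned, since these commute with prefixing an entry;
  arbitrary ones follow in \<open>alternating_swap\<close>. No length is fixed: components of the
  wrong degree are zero and alternate trivially.\<close>

definition alternating :: "('i list \<Rightarrow> 'r::ab_group_add) \<Rightarrow> bool" where
  "alternating w \<longleftrightarrow> (\<forall>xs a b ys. w (xs @ b # a # ys) = - w (xs @ a # b # ys))"

lemma alternatingD: "alternating w \<Longrightarrow> w (xs @ b # a # ys) = - w (xs @ a # b # ys)"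
  unfolding alternating_def by blast

lemma alternating_head: "alternating w \<Longrightarrow> w (b # a # ys) = - w (a # b # ys)"
  using alternatingD[of w "[]" b a ys] by simp

lemma alternating_Cons: "alternating w \<Longrightarrow> alternating (\<lambda>K. w (x # K))"
  unfolding alternating_def by (metis append_Cons)

lemma asum_cong:
  assumes "\<And>i K. length I = Suc (length K) \<Longrightarrow> f i K = g i K"
  shows "asum f I = asum g I"
  using assms
proof (induction I arbitrary: f g)
  case (Cons i I)
  have "asum (\<lambda>j K. f j (i # K)) I = asum (\<lambda>j K. g j (i # K)) I"
    by (rule Cons.IH) (simp add: Cons.prems)
  then show ?case
    using Cons.prems by simp
qed simp

lemma asum_zero [simp]: "asum (\<lambda>i K. 0) I = 0"
  by (induction I) auto

lemma asum_add: "asum (\<lambda>i K. f i K + g i K) I = asum f I + asum g I"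
  by (induction I arbitrary: f g) auto

lemma asum_minus: "asum (\<lambda>i K. - f i K) I = - asum f I"
  by (induction I arbitrary: f) auto

lemma asum_diff: "asum (\<lambda>i K. f i K - g i K) I = asum f I - asum g I"
  using asum_add[of f "\<lambda>i K. - g i K" I] by (simp add: asum_minus)

lemma asum_sum: "asum (\<lambda>i K. \<Sum>a\<in>B. f a i K) I = (\<Sum>a\<in>B. asum (f a) I)"
proof (induction B rule: infinite_finite_induct)
  case (insert x F)
  then show ?case by (simp add: asum_add)
qed auto

lemma asum_mult: "asum (\<lambda>i K. c * f i K) I = (c :: 'r::ring) * asum f I"
  by (induction I arbitrary: f) (auto simp: algebra_simps)

lemma asum_swap:
  "asum (\<lambda>i K. asum (\<lambda>j L. g i K j L) J) I = asum (\<lambda>j L. asum (\<lambda>i K. g i K j L) I) J"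
proof (induction I arbitrary: g)
  case (Cons i I)
  then show ?case by (simp add: asum_diff)
qed simp

text \<open>Every summand sees a list shorter by one entry than \<open>I\<close>, which costs one
  sign. It is the origin of the sign in the anticommutation of the holomorphic and the conjugate
  differential.\<close>

lemma asum_sign:
  "asum (\<lambda>i K. (-1) ^ length K * f i K) I = - ((-1) ^ length I * asum f I :: 'r::ring_1)"
proof -
  have "asum (\<lambda>i K. (-1) ^ length K * f i K) I
      = asum (\<lambda>i K. (- ((-1) ^ length I)) * f i K) I"
    by (rule asum_cong) simp
  then show ?thesis
    by (simp add: asum_minus asum_mult)
qed

text \<open>Two entries can be removed in two orders, with the same list left over and opposite
  signs; symmetry makes the two terms cancel. Both the square of the exterior derivative and the
  double sum in \<open>R_R\<close> vanish by it.\<close>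

lemma asum_asum_symmetric:
  assumes "\<And>i j L. g i j L = g j i L"
  shows "asum (\<lambda>i K. asum (\<lambda>j L. g i j L) K) I = 0"
  using assms
proof (induction I arbitrary: g)
  case (Cons i I)
  have "asum (\<lambda>j K. asum (\<lambda>l L. g j l (i # L)) K) I = 0"
    by (rule Cons.IH) (rule Cons.prems)
  moreover have "asum (\<lambda>j K. g j i K) I = asum (g i) I"
    by (rule asum_cong) (rule Cons.prems)
  ultimately show ?case
    by (simp add: asum_diff)
qed simp

text \<open>When \<open>a\<close> or \<open>b\<close> is the entry removed, the two lists leave the
  same remainder but its position differs by one, so the terms trade places with opposite signs. For
  any other entry the hypothesis on \<open>f\<close> applies.\<close>

lemma alternating_asum:
  assumes "\<And>i. alternating (f i)"
  shows "alternating (asum f)"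
proof -
  have "asum f (xs @ b # a # ys) = - asum f (xs @ a # b # ys)" for xs a b ys
    using assms
  proof (induction xs arbitrary: f)
    case Nil
    have "asum (\<lambda>j K. f j (b # a # K)) ys = - asum (\<lambda>j K. f j (a # b # K)) ys"
      unfolding asum_minus[symmetric]
      by (rule asum_cong) (rule alternating_head[OF Nil])
    then show ?case by simp
  next
    case (Cons x xs)
    have "asum (\<lambda>j K. f j (x # K)) (xs @ b # a # ys)
        = - asum (\<lambda>j K. f j (x # K)) (xs @ a # b # ys)"
      by (rule Cons.IH) (intro alternating_Cons Cons.prems)
    moreover have "f x (xs @ b # a # ys) = - f x (xs @ a # b # ys)"
      by (rule alternatingD[OF Cons.prems])
    ultimately show ?case by simp
  qed
  then show ?thesis
    unfolding alternating_def by blast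
qed

text \<open>The bridge to \<open>del\<close> and \<open>delbar\<close>, which are written with
  omitted positions.\<close>

lemma asum_eq_omit:
  "asum f I = (\<Sum>r<length I. (-1) ^ r * f (I ! r) (omit r I) :: 'r::ring_1)"
proof (induction I arbitrary: f)
  case (Cons i I)
  show ?case
    by (simp add: Cons.IH sum.lessThan_Suc_shift omit_def sum_negf del: sum.lessThan_Suc)
qed simp

text \<open>Exchanging the ends of a segment is reduced to adjacent exchanges by induction on the
  entries \<open>ys\<close> in between: each entry passed costs two signs, the last exchange
  one.\<close>

lemma alternating_swap:
  assumes w: "alternating w" and rs: "r < s" "s < length K"
  shows "w (swap r s K) = - w K"
proof -
  have *: "w (xs @ b # ys @ a # zs) = - w (xs @ a # ys @ b # zs)" for xs a b ys zs
  proof (induction ys arbitrary: xs)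
    case Nil
    show ?case using alternatingD[OF w, of xs b a zs] by simp
  next
    case (Cons y ys)
    have "w (xs @ b # (y # ys) @ a # zs) = - w (xs @ y # b # ys @ a # zs)"
      using alternatingD[OF w, of xs b y "ys @ a # zs"] by simp
    also have "\<dots> = w (xs @ y # a # ys @ b # zs)"
      using Cons.IH[of "xs @ [y]"] by simp
    also have "\<dots> = - w (xs @ a # (y # ys) @ b # zs)"
      using alternatingD[OF w, of xs y a "ys @ b # zs"] by simp
    finally show ?case .
  qed
  define xs a ys b zs where "xs = take r K" and "a = K ! r" and "ys = take (s - Suc r) (drop (Suc r) K)"
    and "b = K ! s" and "zs = drop (Suc s) K"
  have "drop (Suc r) K = ys @ b # zs"
  proof -
    have "drop (Suc r) K = ys @ drop (s - Suc r) (drop (Suc r) K)"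
      unfolding ys_def by (simp only: append_take_drop_id)
    also have "drop (s - Suc r) (drop (Suc r) K) = drop s K"
      using rs by simp
    also have "drop s K = b # zs"
      unfolding b_def zs_def using rs by (simp add: Cons_nth_drop_Suc)
    finally show ?thesis .
  qed
  then have K: "K = xs @ a # ys @ b # zs"
    unfolding xs_def a_def using rs id_take_nth_drop[of r K] by simp
  have len: "length xs = r" "length ys = s - Suc r"
    using rs by (auto simp: xs_def ys_def)
  then have s: "s = length xs + Suc (length ys)"
    using rs by simp
  have r: "r = length xs"
    using len by simp
  have s': "s = length (xs @ c # ys)" for c
    using s by simp
  have "K ! s = b"
    using nth_append_length[of "xs @ a # ys" b zs] unfolding K s'[of a] by simp
  moreover have "K ! r = a"
    unfolding K r by simp
  ultimately have "swap r s K = (xs @ b # ys @ b # zs)[s := a]"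
    unfolding swap_def using list_update_length[of xs a "ys @ b # zs" b] K r by metis
  also have "\<dots> = xs @ b # ys @ a # zs"
    using list_update_length[of "xs @ b # ys" b zs a] unfolding s'[of b] by simp
  finally have "swap r s K = xs @ b # ys @ a # zs" .
  then show ?thesis
    using *[of xs b ys a zs] K by metis
qed

section \<open>Pullback of components\<close>

text \<open>The pullback of covariant tensor components along a map with Jacobian \<open>J\<close>:
  every index slot is contracted with one factor of \<open>J\<close>. The recursion allows induction
  on the index list; \<open>pull_eq_sum\<close> gives the sum of products that occurs in
  \<open>forms\<close>.\<close>

primrec pull :: "('a::finite \<Rightarrow> 'i \<Rightarrow> 'r::comm_ring_1) \<Rightarrow> ('a list \<Rightarrow> 'r) \<Rightarrow> 'i list \<Rightarrow> 'r" where
  "pull J w [] = w []"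
| "pull J w (i # I) = (\<Sum>a\<in>UNIV. J a i * pull J (\<lambda>A. w (a # A)) I)"

lemma pull_zero [simp]: "pull J (\<lambda>A. 0) I = 0"
  by (induction I) auto

lemma pull_add: "pull J (\<lambda>A. v A + w A) I = pull J v I + pull J w I"
  by (induction I arbitrary: v w) (auto simp: algebra_simps sum.distrib)

lemma pull_mult: "pull J (\<lambda>A. c * w A) I = c * pull J w I"
  by (induction I arbitrary: w) (auto simp: sum_distrib_left mult.left_commute)

lemma pull_minus: "pull J (\<lambda>A. - w A) I = - pull J w I"
  using pull_mult[of J "- 1" w I] by simp

lemma pull_diff: "pull J (\<lambda>A. v A - w A) I = pull J v I - pull J w I"
  using pull_add[of J v "\<lambda>A. - w A" I] by (simp add: pull_minus)

lemma pull_sum: "pull J (\<lambda>A. \<Sum>b\<in>B. w b A) I = (\<Sum>b\<in>B. pull J (w b) I)"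
proof (induction B rule: infinite_finite_induct)
  case (insert x F)
  then show ?case by (simp add: pull_add)
qed auto

lemma pull_cong:
  assumes "\<And>A. length A = length I \<Longrightarrow> v A = w A"
  shows "pull J v I = pull J w I"
  using assms
proof (induction I arbitrary: v w)
  case (Cons i I)
  have "pull J (\<lambda>A. v (a # A)) I = pull J (\<lambda>A. w (a # A)) I" for a
    by (rule Cons.IH) (simp add: Cons.prems)
  then show ?case by simp
qed simp

lemma pull_asum:
  "pull J (\<lambda>A. asum (f A) K) I = asum (\<lambda>i L. pull J (\<lambda>A. f A i L) I) K"
proof (induction K arbitrary: f)
  case (Cons k K)
  then show ?case by (simp add: pull_diff)
qed simp

lemma pull_eq_sum:
  fixes J :: "'a::finite \<Rightarrow> 'i \<Rightarrow> 'r::comm_ring_1"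
  shows "pull J w I = (\<Sum>A | length A = length I. (\<Prod>r<length I. J (A ! r) (I ! r)) * w A)"
proof (induction I arbitrary: w)
  case (Cons i I)
  have eq: "{A :: 'a list. length A = Suc (length I)}
      = (\<lambda>(a, A). a # A) ` (UNIV \<times> {A. length A = length I})"
    by (auto simp: length_Suc_conv image_iff)
  have inj: "inj_on (\<lambda>(a, A). a # A) (UNIV \<times> {A :: 'a list. length A = length I})"
    by (auto simp: inj_on_def)
  have "pull J w (i # I) = (\<Sum>a\<in>UNIV. \<Sum>A | length A = length I.
      J a i * ((\<Prod>r<length I. J (A ! r) (I ! r)) * w (a # A)))"
    by (simp add: Cons.IH sum_distrib_left)
  also have "\<dots> = (\<Sum>A\<in>(\<lambda>(a, A). a # A) ` (UNIV \<times> {A. length A = length I}).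
      (\<Prod>r<length (i # I). J (A ! r) ((i # I) ! r)) * w A)"
    unfolding sum.reindex[OF inj] sum.cartesian_product
    by (intro sum.cong) (auto simp: prod.lessThan_Suc_shift mult.assoc simp del: prod.lessThan_Suc)
  also have "\<dots> = (\<Sum>A | length A = length (i # I).
      (\<Prod>r<length (i # I). J (A ! r) ((i # I) ! r)) * w A)"
    by (simp only: eq list.size add_Suc_right add_0_right)
  finally show ?case .
qed simp

section \<open>Exterior calculus over an algebra with commuting derivations\<close>

text \<open>The laws are demanded only on \<open>A\<close>, the smooth functions: for an arbitrary
  function a directional derivative is a default value that obeys none of them.\<close>

locale derivation_algebra =
  fixes A :: "'r::comm_ring_1 set" and d :: "'i \<Rightarrow> 'r \<Rightarrow> 'r"
  assumes zero_closed [simp]: "0 \<in> A"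
    and add_closed: "f \<in> A \<Longrightarrow> g \<in> A \<Longrightarrow> f + g \<in> A"
    and minus_closed: "f \<in> A \<Longrightarrow> - f \<in> A"
    and mult_closed: "f \<in> A \<Longrightarrow> g \<in> A \<Longrightarrow> f * g \<in> A"
    and d_closed: "f \<in> A \<Longrightarrow> d i f \<in> A"
    and d_add: "f \<in> A \<Longrightarrow> g \<in> A \<Longrightarrow> d i (f + g) = d i f + d i g"
    and d_mult: "f \<in> A \<Longrightarrow> g \<in> A \<Longrightarrow> d i (f * g) = d i f * g + f * d i g"
    and d_commute: "f \<in> A \<Longrightarrow> d i (d j f) = d j (d i f)"
begin

lemma diff_closed: "f \<in> A \<Longrightarrow> g \<in> A \<Longrightarrow> f - g \<in> A"
  using add_closed minus_closed by fastforce

lemma sum_closed: "(\<And>x. x \<in> B \<Longrightarrow> f x \<in> A) \<Longrightarrow> sum f B \<in> A"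
  by (induction B rule: infinite_finite_induct) (auto intro: add_closed)

lemma asum_closed: "(\<And>i K. f i K \<in> A) \<Longrightarrow> asum f I \<in> A"
  by (induction I arbitrary: f) (auto intro: diff_closed)

lemma d_zero [simp]: "d i 0 = 0"
  using d_add[of 0 0 i] by simp

lemma d_minus: "f \<in> A \<Longrightarrow> d i (- f) = - d i f"
  using d_add[of f "- f" i] minus_closed[of f] by (simp add: eq_neg_iff_add_eq_0 add.commute)

lemma d_diff: "f \<in> A \<Longrightarrow> g \<in> A \<Longrightarrow> d i (f - g) = d i f - d i g"
  using d_add[of f "- g" i] minus_closed[of g] by (simp add: d_minus)

lemma d_sum: "(\<And>x. x \<in> B \<Longrightarrow> f x \<in> A) \<Longrightarrow> d i (sum f B) = (\<Sum>x\<in>B. d i (f x))"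
  by (induction B rule: infinite_finite_induct) (auto simp: d_add sum_closed)

lemma d_asum: "(\<And>j K. f j K \<in> A) \<Longrightarrow> d i (asum f I) = asum (\<lambda>j K. d i (f j K)) I"
  by (induction I arbitrary: f) (auto simp: d_diff asum_closed)

text \<open>The ring need not contain constants inside \<open>A\<close>; \<open>h\<close> plays the role of the scalar \<open>1/2\<close>.\<close>

lemma d_half:
  assumes h: "h + h = 1" and hA: "\<And>f. f \<in> A \<Longrightarrow> h * f \<in> A" and f: "f \<in> A"
  shows "d i (h * f) = h * d i f"
proof -
  have "f = h * f + h * f"
    using h by (metis distrib_right mult_1)
  then have "d i f = d i (h * f) + d i (h * f)"
    using d_add[OF hA[OF f] hA[OF f], of i] by simp
  then have "h * d i f = (h + h) * d i (h * f)"
    by (simp add: algebra_simps)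
  then show ?thesis
    using h by simp
qed

lemma pull_closed:
  assumes "\<And>a i. J a i \<in> A" and "\<And>K. w K \<in> A"
  shows "pull J w I \<in> A"
  using assms(2) by (induction I arbitrary: w) (auto intro!: sum_closed mult_closed assms(1))

text \<open>Meant for the Jacobian of the conjugate coordinates under a holomorphic derivation, and
  for the holomorphic Jacobian under a conjugate one.\<close>

lemma d_pull_constant:
  assumes "\<And>a j. J a j \<in> A" and "\<And>a j. d i (J a j) = 0" and "\<And>K. w K \<in> A"
  shows "d i (pull J w I) = pull J (\<lambda>K. d i (w K)) I"
  using assms(3)
proof (induction I arbitrary: w)
  case (Cons j I)
  then show ?case
    by (simp add: d_sum mult_closed pull_closed assms d_mult)
qed simp

definition del_op :: "('i list \<Rightarrow> 'r) \<Rightarrow> 'i list \<Rightarrow> 'r" where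
  "del_op w = asum (\<lambda>i K. d i (w K))"

lemma del_op_closed: "(\<And>K. w K \<in> A) \<Longrightarrow> del_op w I \<in> A"
  unfolding del_op_def by (intro asum_closed d_closed)

lemma del_op_Cons: "del_op w (i # I) = d i (w I) - del_op (\<lambda>K. w (i # K)) I"
  by (simp add: del_op_def)

lemma alternating_del_op:
  assumes "alternating w" and "\<And>K. w K \<in> A"
  shows "alternating (del_op w)"
proof -
  have "alternating (\<lambda>K. d i (w K))" for i
    unfolding alternating_def
  proof (intro allI)
    fix xs a b ys
    show "d i (w (xs @ b # a # ys)) = - d i (w (xs @ a # b # ys))"
      by (simp only: alternatingD[OF assms(1), of xs b a ys] d_minus[OF assms(2)])
  qed
  then show ?thesis
    unfolding del_op_def by (rule alternating_asum)
qed

lemma del_op_del_op: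
  assumes "\<And>K. w K \<in> A"
  shows "del_op (del_op w) I = 0"
proof -
  have "del_op (del_op w) I = asum (\<lambda>i K. asum (\<lambda>j L. d i (d j (w L))) K) I"
    unfolding del_op_def by (rule asum_cong, rule d_asum) (simp add: assms d_closed)
  also have "\<dots> = 0"
    by (rule asum_asum_symmetric) (rule d_commute[OF assms])
  finally show ?thesis .
qed

end

text \<open>The exterior derivative commutes with a change of coordinates whose Jacobian is \<open>J\<close>: the terms
  in which a derivative hits \<open>J\<close> cancel, because its derivative is symmetric in the lower indices.\<close>

locale coordinate_change = derivation_algebra A d + new: derivation_algebra A d'
  for A :: "'r::comm_ring_1 set" and d d' :: "'i::finite \<Rightarrow> 'r \<Rightarrow> 'r" +
  fixes J :: "'i \<Rightarrow> 'i \<Rightarrow> 'r"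
  assumes J_closed: "J a i \<in> A"
    and chain: "f \<in> A \<Longrightarrow> d i f = (\<Sum>a\<in>UNIV. J a i * d' a f)"
    and J_sym: "d i (J a j) = d j (J a i)"
begin

text \<open>The product rule applied to all factors. The first sum differentiates \<open>w\<close>
  by the chain rule. The second differentiates one factor of \<open>J\<close>; alternation brings
  the upper index of that factor to the front of \<open>w\<close>, which produces exactly the signs
  of \<open>asum\<close>.\<close>

lemma d_pull:
  assumes "alternating w" and "\<And>K. w K \<in> A"
  shows "d i (pull J w I) = (\<Sum>a\<in>UNIV. J a i * pull J (\<lambda>K. d' a (w K)) I)
    + (\<Sum>a\<in>UNIV. asum (\<lambda>k K. d k (J a i) * pull J (\<lambda>B. w (a # B)) K) I)"
  using assms
proof (induction I arbitrary: w)
  case Nil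
  then show ?case by (simp add: chain)
next
  case (Cons j I)
  have cl: "pull J (\<lambda>A. w (a # A)) I \<in> A" for a I
    by (intro pull_closed J_closed Cons.prems)
  have IH: "d i (pull J (\<lambda>A. w (b # A)) I)
      = (\<Sum>a\<in>UNIV. J a i * pull J (\<lambda>K. d' a (w (b # K))) I)
      + (\<Sum>a\<in>UNIV. asum (\<lambda>k K. d k (J a i) * pull J (\<lambda>B. w (b # a # B)) K) I)" for b
    by (rule Cons.IH) (use Cons.prems alternating_Cons in auto)
  have "d i (pull J w (j # I)) = (\<Sum>b\<in>UNIV. d i (J b j) * pull J (\<lambda>A. w (b # A)) I)
      + (\<Sum>b\<in>UNIV. J b j * d i (pull J (\<lambda>A. w (b # A)) I))"
    by (simp add: d_sum mult_closed J_closed cl d_mult sum.distrib)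
  also have "(\<Sum>b\<in>UNIV. J b j * d i (pull J (\<lambda>A. w (b # A)) I))
     = (\<Sum>b\<in>UNIV. \<Sum>a\<in>UNIV. J b j * (J a i * pull J (\<lambda>K. d' a (w (b # K))) I))
     + (\<Sum>b\<in>UNIV. \<Sum>a\<in>UNIV. J b j * asum (\<lambda>k K. d k (J a i) * pull J (\<lambda>B. w (b # a # B)) K) I)"
    unfolding IH by (simp add: distrib_left sum.distrib sum_distrib_left)
  also have "(\<Sum>b\<in>UNIV. \<Sum>a\<in>UNIV. J b j * (J a i * pull J (\<lambda>K. d' a (w (b # K))) I))
     = (\<Sum>a\<in>UNIV. J a i * pull J (\<lambda>K. d' a (w K)) (j # I))"
    by (subst sum.swap) (simp add: sum_distrib_left mult.left_commute)
  also have "(\<Sum>b\<in>UNIV. \<Sum>a\<in>UNIV. J b j * asum (\<lambda>k K. d k (J a i) * pull J (\<lambda>B. w (b # a # B)) K) I)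
     = - (\<Sum>a\<in>UNIV. asum (\<lambda>k K. d k (J a i) * pull J (\<lambda>B. w (a # B)) (j # K)) I)"
  proof -
    have "w (b # a # B) = - w (a # b # B)" for a b B
      by (rule alternating_head[OF Cons.prems(1)])
    then have *: "(\<lambda>B. w (b # a # B)) = (\<lambda>B. - w (a # b # B))" for a b
      by blast
    have "J b j * asum (\<lambda>k K. d k (J a i) * pull J (\<lambda>B. w (b # a # B)) K) I
      = - asum (\<lambda>k K. d k (J a i) * (J b j * pull J (\<lambda>B. w (a # b # B)) K)) I" for a b
      by (subst *, simp add: pull_minus asum_minus asum_mult[symmetric] mult.left_commute)
    then show ?thesis
      by (subst sum.swap) (simp add: sum_negf asum_sum[symmetric] sum_distrib_left)
  qed
  \<comment> \<open>The factor with lower index \<open>j\<close> belongs to the head of the list. By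
    \<open>J_sym\<close> its derivative in direction \<open>i\<close> is the derivative of
    \<open>J b i\<close> in direction \<open>j\<close>, hence the head term of \<open>asum\<close>
    over \<open>j # I\<close>.\<close>
  also have "(\<Sum>b\<in>UNIV. d i (J b j) * pull J (\<lambda>A. w (b # A)) I)
      + ((\<Sum>a\<in>UNIV. J a i * pull J (\<lambda>K. d' a (w K)) (j # I))
      + - (\<Sum>a\<in>UNIV. asum (\<lambda>k K. d k (J a i) * pull J (\<lambda>B. w (a # B)) (j # K)) I))
    = (\<Sum>a\<in>UNIV. J a i * pull J (\<lambda>K. d' a (w K)) (j # I))
      + (\<Sum>a\<in>UNIV. asum (\<lambda>k K. d k (J a i) * pull J (\<lambda>B. w (a # B)) K) (j # I))"
    by (simp add: sum_subtractf J_sym[of i _ j] del: pull.simps)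
  finally show ?case .
qed

text \<open>Splitting off the head \<open>i\<close>, derivatives of \<open>J\<close> arise twice:
  from \<open>d_pull\<close> when \<open>i\<close> is the entry removed, and from the product rule
  on the factor \<open>J a i\<close> otherwise. The two collections are equal and enter with
  opposite signs.\<close>

lemma del_op_pull:
  assumes "alternating w" and "\<And>K. w K \<in> A"
  shows "del_op (pull J w) I = pull J (new.del_op w) I"
  using assms
proof (induction I arbitrary: w)
  case Nil
  then show ?case by (simp add: del_op_def new.del_op_def)
next
  case (Cons i I)
  have cl: "pull J (\<lambda>A. w (a # A)) I \<in> A" for a I
    by (intro pull_closed J_closed Cons.prems)
  have IH: "del_op (pull J (\<lambda>K. w (a # K))) I = pull J (new.del_op (\<lambda>K. w (a # K))) I" for a
    by (rule Cons.IH) (use Cons.prems alternating_Cons in auto)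
  have "asum (\<lambda>j K. d j (pull J w (i # K))) I
      = asum (\<lambda>j K. (\<Sum>a\<in>UNIV. d j (J a i) * pull J (\<lambda>A. w (a # A)) K)
          + (\<Sum>a\<in>UNIV. J a i * d j (pull J (\<lambda>A. w (a # A)) K))) I"
    by (rule asum_cong) (simp add: d_sum mult_closed J_closed cl d_mult sum.distrib)
  also have "\<dots> = (\<Sum>a\<in>UNIV. asum (\<lambda>j K. d j (J a i) * pull J (\<lambda>A. w (a # A)) K) I)
      + (\<Sum>a\<in>UNIV. J a i * pull J (new.del_op (\<lambda>K. w (a # K))) I)"
    by (simp add: asum_add asum_sum asum_mult IH[unfolded del_op_def])
  finally have 1: "asum (\<lambda>j K. d j (pull J w (i # K))) I = \<dots>" .
  have "del_op (pull J w) (i # I) = (\<Sum>a\<in>UNIV. J a i * pull J (\<lambda>K. d' a (w K)) I)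
      - (\<Sum>a\<in>UNIV. J a i * pull J (new.del_op (\<lambda>K. w (a # K))) I)"
    using d_pull[OF Cons.prems, of i I] by (simp only: del_op_def asum.simps 1) simp
  also have "\<dots> = (\<Sum>a\<in>UNIV. J a i * pull J (\<lambda>K. d' a (w K) - new.del_op (\<lambda>L. w (a # L)) K) I)"
    by (simp add: pull_diff algebra_simps sum_subtractf)
  also have "\<dots> = pull J (new.del_op w) (i # I)"
    by (simp add: new.del_op_Cons)
  finally show ?case .
qed

end

section \<open>Contraction with a bivector\<close>

definition con :: "'r::comm_ring_1 \<Rightarrow> ('i::finite \<Rightarrow> 'i \<Rightarrow> 'r) \<Rightarrow> ('i list \<Rightarrow> 'r) \<Rightarrow> 'i list \<Rightarrow> 'r" where
  "con h P w I = h * (\<Sum>a\<in>UNIV. \<Sum>b\<in>UNIV. P a b * w (a # b # I))"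

lemma alternating_con:
  assumes "alternating w"
  shows "alternating (con h P w)"
  unfolding alternating_def
proof (intro allI)
  fix xs a b ys
  have "w (c # d # xs @ b # a # ys) = - w (c # d # xs @ a # b # ys)" for c d
    using alternatingD[OF assms, of "c # d # xs" b a ys] by simp
  then show "con h P w (xs @ b # a # ys) = - con h P w (xs @ a # b # ys)"
    unfolding con_def by (simp add: sum_negf)
qed

text \<open>\<open>P'\<close> is the bivector pushed forward by \<open>J\<close>: the Jacobian
  factors of the two contracted slots are absorbed into it, and the remaining slots are pulled back
  as before.\<close>

lemma con_pull:
  fixes J :: "'a::finite \<Rightarrow> 'i::finite \<Rightarrow> 'r::comm_ring_1"
  assumes "\<And>a b. P' a b = (\<Sum>i\<in>UNIV. \<Sum>j\<in>UNIV. P i j * J a i * J b j)"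
  shows "con h P (pull J w) I = pull J (con h P' w) I"
proof -
  have "(\<Sum>i\<in>UNIV. \<Sum>j\<in>UNIV. P i j * pull J w (i # j # I))
      = (\<Sum>i\<in>UNIV. \<Sum>j\<in>UNIV. \<Sum>a\<in>UNIV. \<Sum>b\<in>UNIV. P i j * J a i * J b j * pull J (\<lambda>A. w (a # b # A)) I)"
    by (simp add: sum_distrib_left mult.assoc)
  also have "\<dots> = (\<Sum>i\<in>UNIV. \<Sum>a\<in>UNIV. \<Sum>j\<in>UNIV. \<Sum>b\<in>UNIV. P i j * J a i * J b j * pull J (\<lambda>A. w (a # b # A)) I)"
    by (rule sum.cong[OF refl], rule sum.swap)
  also have "\<dots> = (\<Sum>a\<in>UNIV. \<Sum>i\<in>UNIV. \<Sum>j\<in>UNIV. \<Sum>b\<in>UNIV. P i j * J a i * J b j * pull J (\<lambda>A. w (a # b # A)) I)"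
    by (rule sum.swap)
  also have "\<dots> = (\<Sum>a\<in>UNIV. \<Sum>i\<in>UNIV. \<Sum>b\<in>UNIV. \<Sum>j\<in>UNIV. P i j * J a i * J b j * pull J (\<lambda>A. w (a # b # A)) I)"
    by (rule sum.cong[OF refl], rule sum.cong[OF refl], rule sum.swap)
  also have "\<dots> = (\<Sum>a\<in>UNIV. \<Sum>b\<in>UNIV. \<Sum>i\<in>UNIV. \<Sum>j\<in>UNIV. P i j * J a i * J b j * pull J (\<lambda>A. w (a # b # A)) I)"
    by (rule sum.cong[OF refl], rule sum.swap)
  also have "\<dots> = (\<Sum>a\<in>UNIV. \<Sum>b\<in>UNIV. P' a b * pull J (\<lambda>A. w (a # b # A)) I)"
    by (simp add: assms sum_distrib_right)
  finally show ?thesis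
    unfolding con_def by (simp only: pull_mult pull_sum)
qed

lemma sum4_swap:
  "(\<Sum>a\<in>A. \<Sum>b\<in>B. \<Sum>c\<in>C. \<Sum>d\<in>D. f a b c d) = (\<Sum>c\<in>C. \<Sum>d\<in>D. \<Sum>a\<in>A. \<Sum>b\<in>B. f a b c d)"
proof -
  have "(\<Sum>a\<in>A. \<Sum>b\<in>B. \<Sum>c\<in>C. \<Sum>d\<in>D. f a b c d) = (\<Sum>a\<in>A. \<Sum>c\<in>C. \<Sum>b\<in>B. \<Sum>d\<in>D. f a b c d)"
    by (rule sum.cong[OF refl], rule sum.swap)
  also have "\<dots> = (\<Sum>c\<in>C. \<Sum>a\<in>A. \<Sum>b\<in>B. \<Sum>d\<in>D. f a b c d)"
    by (rule sum.swap)
  also have "\<dots> = (\<Sum>c\<in>C. \<Sum>a\<in>A. \<Sum>d\<in>D. \<Sum>b\<in>B. f a b c d)"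
    by (rule sum.cong[OF refl], rule sum.cong[OF refl], rule sum.swap)
  also have "\<dots> = (\<Sum>c\<in>C. \<Sum>d\<in>D. \<Sum>a\<in>A. \<Sum>b\<in>B. f a b c d)"
    by (rule sum.cong[OF refl], rule sum.swap)
  finally show ?thesis .
qed

lemma sum4_first_last:
  "(\<Sum>a\<in>A. \<Sum>b\<in>B. \<Sum>c\<in>C. \<Sum>d\<in>D. f a b c d) = (\<Sum>b\<in>B. \<Sum>c\<in>C. \<Sum>d\<in>D. \<Sum>a\<in>A. f a b c d)"
proof -
  have "(\<Sum>a\<in>A. \<Sum>b\<in>B. \<Sum>c\<in>C. \<Sum>d\<in>D. f a b c d) = (\<Sum>b\<in>B. \<Sum>a\<in>A. \<Sum>c\<in>C. \<Sum>d\<in>D. f a b c d)"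
    by (rule sum.swap)
  also have "\<dots> = (\<Sum>b\<in>B. \<Sum>c\<in>C. \<Sum>a\<in>A. \<Sum>d\<in>D. f a b c d)"
    by (rule sum.cong[OF refl], rule sum.swap)
  also have "\<dots> = (\<Sum>b\<in>B. \<Sum>c\<in>C. \<Sum>d\<in>D. \<Sum>a\<in>A. f a b c d)"
    by (rule sum.cong[OF refl], rule sum.cong[OF refl], rule sum.swap)
  finally show ?thesis .
qed

lemma sum3_cycle:
  "(\<Sum>b\<in>A. \<Sum>c\<in>A. \<Sum>d\<in>A. f b c d) = (\<Sum>b\<in>A. \<Sum>c\<in>A. \<Sum>d\<in>A. f c d b)"
proof -
  have "(\<Sum>b\<in>A. \<Sum>c\<in>A. \<Sum>d\<in>A. f b c d) = (\<Sum>b\<in>A. \<Sum>d\<in>A. \<Sum>c\<in>A. f b c d)"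
    by (rule sum.cong[OF refl], rule sum.swap)
  also have "\<dots> = (\<Sum>d\<in>A. \<Sum>b\<in>A. \<Sum>c\<in>A. f b c d)"
    by (rule sum.swap)
  finally show ?thesis .
qed

text \<open>\<open>jacobi\<close> is the Jacobi identity for the coordinate functions in components.
  Contracting its derivative with a form shows first that three times a term vanishes, whence the
  condition \<open>three\<close>.\<close>

locale poisson_calculus = derivation_algebra A d
  for A :: "'r::comm_ring_1 set" and d :: "'i::finite \<Rightarrow> 'r \<Rightarrow> 'r" +
  fixes h :: 'r and P :: "'i \<Rightarrow> 'i \<Rightarrow> 'r"
  assumes half: "h + h = 1"
    and half_closed: "f \<in> A \<Longrightarrow> h * f \<in> A"
    and three: "f + f + f = 0 \<Longrightarrow> (f :: 'r) = 0"
    and P_closed: "P a b \<in> A"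
    and P_antisym: "P b a = - P a b"
    and jacobi: "(\<Sum>a\<in>UNIV. P a i * d a (P j k)) + (\<Sum>a\<in>UNIV. P a j * d a (P k i))
       + (\<Sum>a\<in>UNIV. P a k * d a (P i j)) = 0"
begin

lemma eq_half: "f + f = g \<Longrightarrow> f = h * g"
proof -
  assume "f + f = g"
  moreover have "f = (h + h) * f" using half by simp
  ultimately show "f = h * g" by (metis distrib_left distrib_right)
qed

lemma half_twice: "h * f + h * f = f"
  by (metis distrib_right half mult_1)

lemma d_half: "f \<in> A \<Longrightarrow> d i (h * f) = h * d i f"
  using derivation_algebra.d_half[OF derivation_algebra_axioms half] half_closed by blast

section \<open>The Poisson differential and its square in components\<close>

definition delp :: "('i list \<Rightarrow> 'r) \<Rightarrow> 'i list \<Rightarrow> 'r" where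
  "delp w I = con h P (del_op w) I - del_op (con h P w) I"

lemma con_closed: "(\<And>K. w K \<in> A) \<Longrightarrow> con h P w I \<in> A"
  unfolding con_def by (intro half_closed sum_closed mult_closed P_closed)

lemma delp_closed: "(\<And>K. w K \<in> A) \<Longrightarrow> delp w I \<in> A"
  unfolding delp_def by (intro diff_closed con_closed del_op_closed)

text \<open>In components \<open>\<partial>\<^sub>\<pi> = E - R\<close>. What does not cancel in the square by antisymmetry is a contraction
  of the form with the cyclic sum of \<open>Jc\<close>, or with a derivative of that sum.\<close>

definition E :: "('i list \<Rightarrow> 'r) \<Rightarrow> 'i list \<Rightarrow> 'r" where
  "E w I = (\<Sum>a\<in>UNIV. \<Sum>b\<in>UNIV. P a b * d a (w (b # I)))"

definition Rt :: "('i list \<Rightarrow> 'r) \<Rightarrow> 'i \<Rightarrow> 'i list \<Rightarrow> 'r" where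
  "Rt w i K = h * (\<Sum>a\<in>UNIV. \<Sum>b\<in>UNIV. d i (P a b) * w (a # b # K))"

definition R :: "('i list \<Rightarrow> 'r) \<Rightarrow> 'i list \<Rightarrow> 'r" where
  "R w = asum (Rt w)"

lemma E_closed: "(\<And>K. w K \<in> A) \<Longrightarrow> E w I \<in> A"
  unfolding E_def by (intro sum_closed mult_closed P_closed d_closed)

lemma R_closed: "(\<And>K. w K \<in> A) \<Longrightarrow> R w I \<in> A"
  unfolding R_def Rt_def by (intro asum_closed half_closed sum_closed mult_closed P_closed d_closed)

lemma E_diff: "(\<And>K. v K \<in> A) \<Longrightarrow> (\<And>K. w K \<in> A) \<Longrightarrow> E (\<lambda>K. v K - w K) I = E v I - E w I"
  by (simp add: E_def d_diff right_diff_distrib sum_subtractf)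

lemma R_diff: "R (\<lambda>K. v K - w K) I = R v I - R w I"
proof -
  have "Rt (\<lambda>K. v K - w K) = (\<lambda>i K. Rt v i K - Rt w i K)"
    by (simp add: Rt_def right_diff_distrib sum_subtractf fun_eq_iff)
  then show ?thesis
    by (simp add: R_def asum_diff)
qed

lemma antisym_sum:
  assumes "\<And>a b. f b a = - f a b"
  shows "(\<Sum>a\<in>UNIV. \<Sum>b\<in>UNIV. f a b) = (0 :: 'r)"
proof -
  have "(\<Sum>a\<in>UNIV. \<Sum>b\<in>UNIV. f a b) = (\<Sum>b\<in>UNIV. \<Sum>a\<in>UNIV. - f b a)"
    by (subst sum.swap) (simp only: assms[symmetric])
  then have "(\<Sum>a\<in>UNIV. \<Sum>b\<in>UNIV. f a b) + (\<Sum>a\<in>UNIV. \<Sum>b\<in>UNIV. f a b) = 0"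
    by (simp add: sum_negf)
  from eq_half[OF this] show ?thesis by simp
qed

lemma dP_antisym: "d i (P b a) = - d i (P a b)"
  unfolding P_antisym[of b a] by (rule d_minus[OF P_closed])

text \<open>In the contraction of \<open>del_op w\<close> the derivative falls on one of the two
  contracted slots or on an entry of \<open>I\<close>. The first two cases agree by antisymmetry of
  \<open>P\<close>, so the factor \<open>h\<close> turns them into \<open>E\<close>. The third case
  also occurs in \<open>del_op\<close> of the contraction and cancels, leaving there only the
  derivatives of \<open>P\<close>.\<close>

lemma delp_eq:
  assumes w: "\<And>K. w K \<in> A"
  shows "delp w I = E w I - R w I"
proof -
  let ?S = "\<Sum>a\<in>UNIV. \<Sum>b\<in>UNIV. P a b * del_op (\<lambda>K. w (a # b # K)) I"
  have "(\<Sum>a\<in>UNIV. \<Sum>b\<in>UNIV. P a b * d b (w (a # I))) = (\<Sum>a\<in>UNIV. \<Sum>b\<in>UNIV. - (P a b * d a (w (b # I))))"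
    by (subst sum.swap, intro sum.cong refl, subst P_antisym) simp
  then have 1: "(\<Sum>a\<in>UNIV. \<Sum>b\<in>UNIV. P a b * d b (w (a # I))) = - E w I"
    by (simp add: sum_negf E_def)
  have "con h P (del_op w) I = h * (E w I - (\<Sum>a\<in>UNIV. \<Sum>b\<in>UNIV. P a b * d b (w (a # I))) + ?S)"
    unfolding con_def E_def
    by (simp add: del_op_Cons algebra_simps sum.distrib sum_subtractf)
  also have "\<dots> = E w I + h * ?S"
    unfolding 1 by (simp only: diff_minus_eq_add distrib_left half_twice)
  finally have 2: "con h P (del_op w) I = E w I + h * ?S" .
  have "del_op (con h P w) I = asum (\<lambda>i K. Rt w i K + h * (\<Sum>a\<in>UNIV. \<Sum>b\<in>UNIV. P a b * d i (w (a # b # K)))) I"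
    unfolding del_op_def con_def Rt_def
    by (rule asum_cong)
      (simp add: d_half sum_closed mult_closed P_closed w d_sum d_mult sum.distrib distrib_left)
  also have "\<dots> = R w I + h * ?S"
    by (simp add: asum_add asum_mult asum_sum R_def del_op_def)
  finally show ?thesis
    unfolding delp_def 2 by simp
qed

text \<open>The bracket of the component \<open>P j k\<close> with the coordinate of index
  \<open>i\<close>; the Jacobi identity is the vanishing of its cyclic sum.\<close>

definition Jc :: "'i \<Rightarrow> 'i \<Rightarrow> 'i \<Rightarrow> 'r" where
  "Jc i j k = (\<Sum>a\<in>UNIV. P a i * d a (P j k))"

lemma Jc_closed: "Jc i j k \<in> A"
  unfolding Jc_def by (intro sum_closed mult_closed P_closed d_closed)

lemma Jc_cyclic: "Jc i j k + Jc j k i + Jc k i j = 0"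
  unfolding Jc_def by (rule jacobi)

lemma Jc_antisym: "Jc i k j = - Jc i j k"
  by (simp only: Jc_def dP_antisym[of _ k j] mult_minus_right sum_negf)

context
  fixes w :: "'i list \<Rightarrow> 'r"
  assumes w: "\<And>K. w K \<in> A" and alt: "alternating w"
begin

lemma swap12: "w (b # a # K) = - w (a # b # K)"
  by (rule alternating_head[OF alt])

lemma swap23: "w (c # b # a # K) = - w (c # a # b # K)"
  using alternatingD[OF alt, of "[c]" b a K] by simp

lemma swap34: "w (e # c # b # a # K) = - w (e # c # a # b # K)"
  using alternatingD[OF alt, of "[e, c]" b a K] by simp

lemma rotate3: "w (a # b # c # K) = w (c # a # b # K)"
  using swap23[of a c b K] swap12[of c a "b # K"] by simp

lemma rotate4: "w (a # b # c # e # K) = w (c # e # a # b # K)"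
  using swap23[of a c b "e # K"] swap12[of c a "b # e # K"] swap34[of c a e b K] swap23[of c e a "b # K"]
  by simp

text \<open>The part with two derivatives of \<open>w\<close> changes sign when the pairs
  \<open>(a, b)\<close> and \<open>(c, k)\<close> are exchanged, because derivatives commute and
  \<open>w\<close> alternates; so it vanishes. What is left has one derivative on
  \<open>P c k\<close>, and summation over \<open>a\<close> gives \<open>Jc\<close>.\<close>

lemma E_E: "E (E w) I = (\<Sum>b\<in>UNIV. \<Sum>c\<in>UNIV. \<Sum>k\<in>UNIV. Jc b c k * d c (w (k # b # I)))"
proof -
  let ?f = "\<lambda>a b c k. P a b * (P c k * d a (d c (w (k # b # I))))"
  have "(\<Sum>a\<in>UNIV. \<Sum>b\<in>UNIV. \<Sum>c\<in>UNIV. \<Sum>k\<in>UNIV. ?f a b c k)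
      = (\<Sum>a\<in>UNIV. \<Sum>b\<in>UNIV. \<Sum>c\<in>UNIV. \<Sum>k\<in>UNIV. ?f c k a b)"
    by (rule sum4_swap)
  also have "\<dots> = (\<Sum>a\<in>UNIV. \<Sum>b\<in>UNIV. \<Sum>c\<in>UNIV. \<Sum>k\<in>UNIV. - ?f a b c k)"
  proof (intro sum.cong refl)
    fix a b c k
    have "d c (d a (w (b # k # I))) = - d a (d c (w (k # b # I)))"
      by (simp only: swap12[of b k I] d_minus[OF w] d_minus[OF d_closed[OF w]] d_commute[OF w, of c a])
    then show "?f c k a b = - ?f a b c k"
      by (simp add: mult.left_commute)
  qed
  finally have "(\<Sum>a\<in>UNIV. \<Sum>b\<in>UNIV. \<Sum>c\<in>UNIV. \<Sum>k\<in>UNIV. ?f a b c k)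
      + (\<Sum>a\<in>UNIV. \<Sum>b\<in>UNIV. \<Sum>c\<in>UNIV. \<Sum>k\<in>UNIV. ?f a b c k) = 0"
    by (simp add: sum_negf)
  from eq_half[OF this] have 0: "(\<Sum>a\<in>UNIV. \<Sum>b\<in>UNIV. \<Sum>c\<in>UNIV. \<Sum>k\<in>UNIV. ?f a b c k) = 0"
    by simp
  have "E (E w) I = (\<Sum>a\<in>UNIV. \<Sum>b\<in>UNIV. \<Sum>c\<in>UNIV. \<Sum>k\<in>UNIV. P a b * (d a (P c k) * d c (w (k # b # I))))
      + (\<Sum>a\<in>UNIV. \<Sum>b\<in>UNIV. \<Sum>c\<in>UNIV. \<Sum>k\<in>UNIV. ?f a b c k)"
    unfolding E_def
    by (simp add: d_sum sum_closed mult_closed P_closed d_closed w d_mult sum.distrib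
        distrib_left sum_distrib_left)
  also have "\<dots> = (\<Sum>b\<in>UNIV. \<Sum>c\<in>UNIV. \<Sum>k\<in>UNIV. \<Sum>a\<in>UNIV. P a b * (d a (P c k) * d c (w (k # b # I))))"
    unfolding 0 by (simp only: add_0_right) (rule sum4_first_last)
  also have "\<dots> = (\<Sum>b\<in>UNIV. \<Sum>c\<in>UNIV. \<Sum>k\<in>UNIV. Jc b c k * d c (w (k # b # I)))"
    by (simp add: Jc_def sum_distrib_right mult.assoc)
  finally show ?thesis .
qed

text \<open>On \<open>b # I\<close> the operator \<open>R\<close> removes either \<open>b\<close> or
  an entry of \<open>I\<close>. If \<open>b\<close> is removed, the second derivatives of
  \<open>P\<close> are contracted symmetric against antisymmetric and vanish, and the first
  derivatives give \<open>Jc\<close>. Of the two sums left over, the one with second derivatives of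
  \<open>P\<close> will combine with \<open>R_R\<close>, the other will cancel against
  \<open>R_E\<close>.\<close>

lemma E_R:
  "E (R w) I = - (h * (\<Sum>a\<in>UNIV. \<Sum>b\<in>UNIV. \<Sum>c\<in>UNIV. Jc a b c * d a (w (b # c # I))))
    - asum (\<lambda>i K. h * (\<Sum>a\<in>UNIV. \<Sum>b\<in>UNIV. \<Sum>c\<in>UNIV. \<Sum>k\<in>UNIV.
        P a b * (d a (d i (P c k)) * w (c # k # b # K)))) I
    - asum (\<lambda>i K. h * (\<Sum>a\<in>UNIV. \<Sum>b\<in>UNIV. \<Sum>c\<in>UNIV. \<Sum>k\<in>UNIV.
        P a b * (d i (P c k) * d a (w (c # k # b # K))))) I"
proof -
  have 1: "d a (R w (b # I)) = h * (\<Sum>c\<in>UNIV. \<Sum>k\<in>UNIV. d a (d b (P c k)) * w (c # k # I))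
      + h * (\<Sum>c\<in>UNIV. \<Sum>k\<in>UNIV. d b (P c k) * d a (w (c # k # I)))
      - asum (\<lambda>i K. h * (\<Sum>c\<in>UNIV. \<Sum>k\<in>UNIV. d a (d i (P c k)) * w (c # k # b # K))
        + h * (\<Sum>c\<in>UNIV. \<Sum>k\<in>UNIV. d i (P c k) * d a (w (c # k # b # K)))) I" for a b
    unfolding R_def Rt_def
    by (simp add: d_diff d_asum asum_closed half_closed sum_closed mult_closed P_closed d_closed w
        d_half d_sum d_mult sum.distrib distrib_left)
  have 2: "(\<Sum>a\<in>UNIV. \<Sum>b\<in>UNIV. P a b * (h * (\<Sum>c\<in>UNIV. \<Sum>k\<in>UNIV. d a (d b (P c k)) * w (c # k # I)))) = 0"
  proof (rule antisym_sum)
    fix a b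
    show "P b a * (h * (\<Sum>c\<in>UNIV. \<Sum>k\<in>UNIV. d b (d a (P c k)) * w (c # k # I)))
      = - (P a b * (h * (\<Sum>c\<in>UNIV. \<Sum>k\<in>UNIV. d a (d b (P c k)) * w (c # k # I))))"
      by (simp only: P_antisym[where b = b and a = a] d_commute[OF P_closed, where i = b and j = a] mult_minus_left)
  qed
  have 3: "(\<Sum>b\<in>UNIV. P a b * (\<Sum>c\<in>UNIV. \<Sum>k\<in>UNIV. d b (P c k) * d a (w (c # k # I))))
      = - (\<Sum>c\<in>UNIV. \<Sum>k\<in>UNIV. Jc a c k * d a (w (c # k # I)))" for a
  proof -
    have "(\<Sum>b\<in>UNIV. P a b * (\<Sum>c\<in>UNIV. \<Sum>k\<in>UNIV. d b (P c k) * d a (w (c # k # I))))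
       = (\<Sum>b\<in>UNIV. \<Sum>c\<in>UNIV. \<Sum>k\<in>UNIV. - (P b a * d b (P c k) * d a (w (c # k # I))))"
      unfolding P_antisym[of a] by (simp add: sum_distrib_left mult.assoc sum_negf)
    also have "\<dots> = (\<Sum>c\<in>UNIV. \<Sum>b\<in>UNIV. \<Sum>k\<in>UNIV. - (P b a * d b (P c k) * d a (w (c # k # I))))"
      by (rule sum.swap)
    also have "\<dots> = (\<Sum>c\<in>UNIV. \<Sum>k\<in>UNIV. \<Sum>b\<in>UNIV. - (P b a * d b (P c k) * d a (w (c # k # I))))"
      by (rule sum.cong[OF refl], rule sum.swap)
    finally show ?thesis
      by (simp add: Jc_def sum_distrib_right sum_negf)
  qed
  have "E (R w) I = (\<Sum>a\<in>UNIV. \<Sum>b\<in>UNIV. P a b * (h * (\<Sum>c\<in>UNIV. \<Sum>k\<in>UNIV. d a (d b (P c k)) * w (c # k # I))))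
     + h * (\<Sum>a\<in>UNIV. \<Sum>b\<in>UNIV. P a b * (\<Sum>c\<in>UNIV. \<Sum>k\<in>UNIV. d b (P c k) * d a (w (c # k # I))))
     - asum (\<lambda>i K. h * (\<Sum>a\<in>UNIV. \<Sum>b\<in>UNIV. P a b * (\<Sum>c\<in>UNIV. \<Sum>k\<in>UNIV. d a (d i (P c k)) * w (c # k # b # K)))) I
     - asum (\<lambda>i K. h * (\<Sum>a\<in>UNIV. \<Sum>b\<in>UNIV. P a b * (\<Sum>c\<in>UNIV. \<Sum>k\<in>UNIV. d i (P c k) * d a (w (c # k # b # K))))) I"
    unfolding E_def 1
    by (simp only: right_diff_distrib distrib_left sum_subtractf sum.distrib asum_add asum_mult asum_sum
        sum_distrib_left mult.left_commute[of h] diff_diff_eq add.assoc)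
  then show ?thesis
    unfolding 2 3 by (simp add: sum_negf sum_distrib_left)
qed

lemma R_E:
  "R (E w) I = asum (\<lambda>i K. h * (\<Sum>a\<in>UNIV. \<Sum>b\<in>UNIV. \<Sum>c\<in>UNIV. \<Sum>k\<in>UNIV.
        P a b * (d i (P c k) * d a (w (c # k # b # K))))) I"
  unfolding R_def
proof (rule asum_cong)
  fix i K
  have "Rt (E w) i K = h * (\<Sum>a\<in>UNIV. \<Sum>b\<in>UNIV. \<Sum>c\<in>UNIV. \<Sum>k\<in>UNIV.
      P c k * (d i (P a b) * d c (w (a # b # k # K))))"
    by (simp add: Rt_def E_def sum_distrib_left mult.left_commute rotate3[symmetric])
  also have "\<dots> = h * (\<Sum>a\<in>UNIV. \<Sum>b\<in>UNIV. \<Sum>c\<in>UNIV. \<Sum>k\<in>UNIV.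
      P a b * (d i (P c k) * d a (w (c # k # b # K))))"
    by (subst sum4_swap) (rule refl)
  finally show "Rt (E w) i K = \<dots>" .
qed

text \<open>In \<open>Rt (R w) i K\<close> the inner \<open>R\<close> removes one of the two
  contracted indices or an entry of \<open>K\<close>. The contracted indices contribute equally,
  which uses up one factor \<open>h\<close>. The entries of \<open>K\<close> give an expression
  symmetric in the two removed indices, because exchanging two pairs of arguments of
  \<open>w\<close> is an even permutation.\<close>

lemma R_R:
  "R (R w) I = asum (\<lambda>i K. h * (\<Sum>a\<in>UNIV. \<Sum>b\<in>UNIV. \<Sum>c\<in>UNIV. \<Sum>k\<in>UNIV.
        d i (P a b) * (d a (P c k) * w (c # k # b # K)))) I"
proof -
  let ?g = "\<lambda>i j L. h * (\<Sum>a\<in>UNIV. \<Sum>b\<in>UNIV. d i (P a b) * (h * (\<Sum>c\<in>UNIV. \<Sum>k\<in>UNIV. d j (P c k) * w (c # k # a # b # L))))"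
  let ?u = "\<lambda>a i K. \<Sum>b\<in>UNIV. d i (P a b) * (\<Sum>c\<in>UNIV. \<Sum>k\<in>UNIV. d a (P c k) * w (c # k # b # K))"
  have "Rt (R w) i K = h * (\<Sum>a\<in>UNIV. ?u a i K) + asum (\<lambda>j L. ?g i j L) K" for i K
  proof -
    let ?S = "\<Sum>a\<in>UNIV. \<Sum>b\<in>UNIV. d i (P a b) * Rt w a (b # K)"
    have 1: "(\<Sum>a\<in>UNIV. \<Sum>b\<in>UNIV. d i (P a b) * Rt w b (a # K)) = - ?S"
      unfolding sum_negf[symmetric]
      by (subst sum.swap, intro sum.cong refl, subst dP_antisym, rule mult_minus_left)
    have 2: "?S = h * (\<Sum>a\<in>UNIV. ?u a i K)"
      unfolding Rt_def by (simp only: mult.left_commute[of _ h] sum_distrib_left[symmetric])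
    have 3: "h * (\<Sum>a\<in>UNIV. \<Sum>b\<in>UNIV. d i (P a b) * asum (\<lambda>j L. Rt w j (a # b # L)) K)
        = asum (\<lambda>j L. ?g i j L) K"
      by (simp only: asum_mult asum_sum Rt_def)
    have "Rt (R w) i K = h * ?S - h * (\<Sum>a\<in>UNIV. \<Sum>b\<in>UNIV. d i (P a b) * Rt w b (a # K))
      + h * (\<Sum>a\<in>UNIV. \<Sum>b\<in>UNIV. d i (P a b) * asum (\<lambda>j L. Rt w j (a # b # L)) K)"
      by (subst Rt_def) (simp add: R_def right_diff_distrib distrib_left sum_subtractf sum.distrib)
    also have "\<dots> = ?S + asum (\<lambda>j L. ?g i j L) K"
      unfolding 1 3 using half_twice[of ?S] by simp
    finally show ?thesis
      unfolding 2 .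
  qed
  then have "Rt (R w) = (\<lambda>i K. h * (\<Sum>a\<in>UNIV. ?u a i K) + asum (\<lambda>j L. ?g i j L) K)"
    by blast
  then have "R (R w) I = asum (\<lambda>i K. h * (\<Sum>a\<in>UNIV. ?u a i K)) I
      + asum (\<lambda>i K. asum (\<lambda>j L. ?g i j L) K) I"
    unfolding R_def[of "R w"] by (simp only: asum_add)
  also have "asum (\<lambda>i K. asum (\<lambda>j L. ?g i j L) K) I = 0"
  proof (rule asum_asum_symmetric)
    fix i j L
    have "?g i j L = h * (h * (\<Sum>a\<in>UNIV. \<Sum>b\<in>UNIV. \<Sum>c\<in>UNIV. \<Sum>k\<in>UNIV. d i (P a b) * (d j (P c k) * w (c # k # a # b # L))))"
      by (simp add: sum_distrib_left mult.left_commute)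
    also have "\<dots> = h * (h * (\<Sum>a\<in>UNIV. \<Sum>b\<in>UNIV. \<Sum>c\<in>UNIV. \<Sum>k\<in>UNIV. d i (P c k) * (d j (P a b) * w (a # b # c # k # L))))"
      by (subst sum4_swap) (rule refl)
    also have "\<dots> = h * (h * (\<Sum>a\<in>UNIV. \<Sum>b\<in>UNIV. \<Sum>c\<in>UNIV. \<Sum>k\<in>UNIV. d j (P a b) * (d i (P c k) * w (c # k # a # b # L))))"
      by (subst rotate4) (simp add: mult.left_commute)
    also have "\<dots> = ?g j i L"
      by (simp add: sum_distrib_left mult.left_commute)
    finally show "?g i j L = ?g j i L" .
  qed
  finally show ?thesis
    by (simp add: sum_distrib_left)
qed

text \<open>The square splits by the order of the derivative on \<open>w\<close>: order two is
  already gone in \<open>E_E\<close>, order one is treated in \<open>X\<close> and order zero in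
  \<open>Y\<close>.\<close>

lemma delp_delp: "delp (delp w) I = 0"
proof -
  let ?u = "\<Sum>b\<in>UNIV. \<Sum>c\<in>UNIV. \<Sum>k\<in>UNIV. Jc b c k * d c (w (k # b # I))"
  let ?v = "\<Sum>a\<in>UNIV. \<Sum>b\<in>UNIV. \<Sum>c\<in>UNIV. Jc a b c * d a (w (b # c # I))"
  let ?Y1 = "\<lambda>i K. h * (\<Sum>a\<in>UNIV. \<Sum>b\<in>UNIV. \<Sum>c\<in>UNIV. \<Sum>k\<in>UNIV. P a b * (d a (d i (P c k)) * w (c # k # b # K)))"
  let ?Y2 = "\<lambda>i K. h * (\<Sum>a\<in>UNIV. \<Sum>b\<in>UNIV. \<Sum>c\<in>UNIV. \<Sum>k\<in>UNIV. d i (P a b) * (d a (P c k) * w (c # k # b # K)))"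
  \<comment> \<open>Together the terms are the derivative of \<open>Jc\<close> contracted with
    \<open>w\<close>. As \<open>w\<close> is invariant under cyclic rotation of three indices, the
    contraction equals its own rotations, and three times it is a contraction with the derivative of
    the cyclic sum.\<close>
  have Y: "?Y1 i K + ?Y2 i K = 0" for i K
  proof -
    let ?t = "\<lambda>b c k. d i (Jc b c k) * w (c # k # b # K)"
    have dJ: "d i (Jc b c k) = (\<Sum>a\<in>UNIV. P a b * d a (d i (P c k)) + d i (P a b) * d a (P c k))" for b c k
      unfolding Jc_def
      by (simp add: d_sum mult_closed P_closed d_closed d_mult d_commute[OF P_closed, of i] add.commute)
    have "?Y1 i K + ?Y2 i K = h * (\<Sum>a\<in>UNIV. \<Sum>b\<in>UNIV. \<Sum>c\<in>UNIV. \<Sum>k\<in>UNIV.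
        (P a b * d a (d i (P c k)) + d i (P a b) * d a (P c k)) * w (c # k # b # K))"
      by (simp add: distrib_left distrib_right sum.distrib mult.assoc)
    also have "\<dots> = h * (\<Sum>b\<in>UNIV. \<Sum>c\<in>UNIV. \<Sum>k\<in>UNIV. ?t b c k)"
      by (subst sum4_first_last) (simp only: dJ sum_distrib_right)
    also have "(\<Sum>b\<in>UNIV. \<Sum>c\<in>UNIV. \<Sum>k\<in>UNIV. ?t b c k) = 0"
    proof (rule three)
      have 1: "(\<Sum>b\<in>UNIV. \<Sum>c\<in>UNIV. \<Sum>k\<in>UNIV. ?t b c k) = (\<Sum>b\<in>UNIV. \<Sum>c\<in>UNIV. \<Sum>k\<in>UNIV. d i (Jc c k b) * w (c # k # b # K))"
        by (subst sum3_cycle) (intro sum.cong refl arg_cong2[where f = times] rotate3)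
      have "(\<Sum>b\<in>UNIV. \<Sum>c\<in>UNIV. \<Sum>k\<in>UNIV. d i (Jc c k b) * w (c # k # b # K))
         = (\<Sum>b\<in>UNIV. \<Sum>c\<in>UNIV. \<Sum>k\<in>UNIV. d i (Jc k b c) * w (k # b # c # K))"
        by (rule sum3_cycle)
      also have "\<dots> = (\<Sum>b\<in>UNIV. \<Sum>c\<in>UNIV. \<Sum>k\<in>UNIV. d i (Jc k b c) * w (c # k # b # K))"
        by (intro sum.cong refl arg_cong2[where f = times] rotate3)
      finally have 2: "(\<Sum>b\<in>UNIV. \<Sum>c\<in>UNIV. \<Sum>k\<in>UNIV. ?t b c k) = \<dots>"
        using 1 by simp
      have "(\<Sum>b\<in>UNIV. \<Sum>c\<in>UNIV. \<Sum>k\<in>UNIV. ?t b c k) + (\<Sum>b\<in>UNIV. \<Sum>c\<in>UNIV. \<Sum>k\<in>UNIV. d i (Jc c k b) * w (c # k # b # K))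
         + (\<Sum>b\<in>UNIV. \<Sum>c\<in>UNIV. \<Sum>k\<in>UNIV. d i (Jc k b c) * w (c # k # b # K))
         = (\<Sum>b\<in>UNIV. \<Sum>c\<in>UNIV. \<Sum>k\<in>UNIV. d i (Jc b c k + Jc c k b + Jc k b c) * w (c # k # b # K))"
        by (simp add: d_add add_closed Jc_closed distrib_right sum.distrib)
      also have "\<dots> = 0"
        by (simp add: Jc_cyclic)
      finally show "(\<Sum>b\<in>UNIV. \<Sum>c\<in>UNIV. \<Sum>k\<in>UNIV. ?t b c k) + (\<Sum>b\<in>UNIV. \<Sum>c\<in>UNIV. \<Sum>k\<in>UNIV. ?t b c k)
         + (\<Sum>b\<in>UNIV. \<Sum>c\<in>UNIV. \<Sum>k\<in>UNIV. ?t b c k) = 0"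
        using 1 2 by simp
    qed
    finally show ?thesis by simp
  qed
  \<comment> \<open>Two renamings of the indices in \<open>?u\<close>, the second one using
    antisymmetry of \<open>Jc\<close> and of \<open>w\<close>, supply the two terms of the cyclic
    sum that \<open>?v\<close> lacks. Hence \<open>?u + ?u + ?v\<close> vanishes, and
    \<open>h\<close> halves this.\<close>
  have X: "?u + h * ?v = 0"
  proof -
    have 1: "?u = (\<Sum>a\<in>UNIV. \<Sum>b\<in>UNIV. \<Sum>c\<in>UNIV. Jc c a b * d a (w (b # c # I)))"
      by (subst sum3_cycle, subst sum3_cycle) (rule refl)
    also have "\<dots> = (\<Sum>a\<in>UNIV. \<Sum>c\<in>UNIV. \<Sum>b\<in>UNIV. Jc c a b * d a (w (b # c # I)))"
      by (rule sum.cong[OF refl], rule sum.swap)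
    also have "\<dots> = (\<Sum>a\<in>UNIV. \<Sum>b\<in>UNIV. \<Sum>c\<in>UNIV. Jc b c a * d a (w (b # c # I)))"
    proof (intro sum.cong refl)
      fix a b c
      have "d a (w (c # b # I)) = - d a (w (b # c # I))"
        by (simp only: swap12[of c b] d_minus[OF w])
      then show "Jc b a c * d a (w (c # b # I)) = Jc b c a * d a (w (b # c # I))"
        using Jc_antisym[of b a c] by simp
    qed
    finally have 2: "?u = \<dots>" .
    have "?u + ?u + ?v = (\<Sum>a\<in>UNIV. \<Sum>b\<in>UNIV. \<Sum>c\<in>UNIV. (Jc a b c + Jc b c a + Jc c a b) * d a (w (b # c # I)))"
      by (subst 1, subst 2, simp add: distrib_right sum.distrib)
    also have "\<dots> = 0"
      by (simp add: Jc_cyclic)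
    finally have "?u + ?u = - ?v"
      by (simp add: eq_neg_iff_add_eq_0)
    from eq_half[OF this] show ?thesis by simp
  qed
  have "delp (delp w) I = E (delp w) I - R (delp w) I"
    by (rule delp_eq) (rule delp_closed[OF w])
  also have "\<dots> = E (\<lambda>K. E w K - R w K) I - R (\<lambda>K. E w K - R w K) I"
    using delp_eq[OF w] by presburger
  also have "\<dots> = E (E w) I - E (R w) I - (R (E w) I - R (R w) I)"
    by (simp add: E_diff E_closed R_closed w R_diff)
  also have "\<dots> = ?u + h * ?v + (asum ?Y1 I + asum ?Y2 I)"
    unfolding E_E E_R R_E R_R by simp
  also have "\<dots> = 0"
    unfolding X asum_add[symmetric] Y by simp
  finally show ?thesis .
qed

end

end

text \<open>\<open>e\<close> plays the role of \<open>\<partial>/\<partial>\<bar>z\<close>.\<close>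

locale dolbeault_calculus = poisson_calculus A d h P + bar: derivation_algebra A e
  for A :: "'r::comm_ring_1 set" and d :: "'i::finite \<Rightarrow> 'r \<Rightarrow> 'r" and h P and e :: "'i \<Rightarrow> 'r \<Rightarrow> 'r" +
  assumes d_e: "f \<in> A \<Longrightarrow> d i (e j f) = e j (d i f)"
    and e_P: "e j (P a b) = 0"
begin

section \<open>Anticommutation with the Dolbeault operator\<close>

definition delB :: "('i list \<Rightarrow> 'i list \<Rightarrow> 'r) \<Rightarrow> 'i list \<Rightarrow> 'i list \<Rightarrow> 'r" where
  "delB w I J = (-1) ^ length I * bar.del_op (w I) J"

definition delP :: "('i list \<Rightarrow> 'i list \<Rightarrow> 'r) \<Rightarrow> 'i list \<Rightarrow> 'i list \<Rightarrow> 'r" where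
  "delP w I J = delp (\<lambda>K. w K J) I"

lemma d_sign: "f \<in> A \<Longrightarrow> d i ((-1) ^ n * f) = (-1) ^ n * d i f"
  by (cases "even n") (auto simp: d_minus)

lemma e_sign: "f \<in> A \<Longrightarrow> e i ((-1) ^ n * f) = (-1) ^ n * e i f"
  by (cases "even n") (auto simp: bar.d_minus)

lemma delP_closed: "(\<And>I J. w I J \<in> A) \<Longrightarrow> delP w I J \<in> A"
  unfolding delP_def by (intro delp_closed)

lemma delB_diff:
  "(\<And>I J. v I J \<in> A) \<Longrightarrow> (\<And>I J. w I J \<in> A) \<Longrightarrow> delB (\<lambda>I J. v I J - w I J) I J = delB v I J - delB w I J"
  unfolding delB_def bar.del_op_def by (simp add: bar.d_diff asum_diff right_diff_distrib)

lemma delB_delB: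
  assumes w: "\<And>I J. w I J \<in> A"
  shows "delB (delB w) I J = 0"
proof -
  have "bar.del_op (delB w I) J = (-1) ^ length I * bar.del_op (bar.del_op (w I)) J"
    unfolding bar.del_op_def[of "delB w I"] delB_def asum_mult[symmetric]
    by (simp add: e_sign bar.del_op_closed w asum_mult bar.del_op_def[of "bar.del_op (w I)"])
  then show ?thesis
    unfolding delB_def using bar.del_op_del_op[of "w I"] w by simp
qed

text \<open>Contraction lowers the number of holomorphic indices by two, which leaves the sign of
  \<open>delB\<close> alone, and the coefficients \<open>P\<close> are constants for
  \<open>e\<close>.\<close>

lemma con_delB:
  assumes w: "\<And>I J. w I J \<in> A"
  shows "con h P (\<lambda>K. delB w K J) I = delB (\<lambda>K L. con h P (\<lambda>K'. w K' L) K) I J"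
proof -
  have "bar.del_op (\<lambda>L. con h P (\<lambda>K'. w K' L) I) J
     = asum (\<lambda>j L. h * (\<Sum>a\<in>UNIV. \<Sum>b\<in>UNIV. P a b * e j (w (a # b # I) L))) J"
    unfolding bar.del_op_def con_def
    by (rule asum_cong)
      (simp add: derivation_algebra.d_half[OF bar.derivation_algebra_axioms half half_closed]
        sum_closed mult_closed P_closed w bar.d_sum bar.d_mult e_P)
  also have "\<dots> = h * (\<Sum>a\<in>UNIV. \<Sum>b\<in>UNIV. P a b * bar.del_op (w (a # b # I)) J)"
    by (simp only: bar.del_op_def asum_mult asum_sum)
  finally show ?thesis
    unfolding delB_def con_def[of h P "\<lambda>K. _ K * _ K"]
    by (simp add: sum_distrib_left mult.left_commute[of "(-1) ^ length I"])
qed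

text \<open>\<open>d\<close> and \<open>e\<close> commute; the minus sign is that of
  \<open>asum_sign\<close>, since \<open>del_op\<close> adds one holomorphic index.\<close>

lemma del_op_delB:
  assumes w: "\<And>I J. w I J \<in> A"
  shows "del_op (\<lambda>K. delB w K J) I = - delB (\<lambda>K L. del_op (\<lambda>K'. w K' L) K) I J"
proof -
  have "del_op (\<lambda>K. delB w K J) I = asum (\<lambda>i K. (-1) ^ length K * asum (\<lambda>j L. d i (e j (w K L))) J) I"
    unfolding del_op_def delB_def
    by (rule asum_cong) (subst d_sign, rule bar.del_op_closed, rule w, simp add: bar.del_op_def d_asum bar.d_closed w)
  also have "\<dots> = - ((-1) ^ length I * asum (\<lambda>i K. asum (\<lambda>j L. d i (e j (w K L))) J) I)"
    by (rule asum_sign)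
  also have "asum (\<lambda>i K. asum (\<lambda>j L. d i (e j (w K L))) J) I
      = asum (\<lambda>j L. asum (\<lambda>i K. d i (e j (w K L))) I) J"
    by (rule asum_swap)
  also have "\<dots> = bar.del_op (\<lambda>L. del_op (\<lambda>K'. w K' L) I) J"
    unfolding bar.del_op_def del_op_def
    by (rule asum_cong) (simp add: bar.d_asum d_closed w d_e)
  finally show ?thesis
    unfolding delB_def .
qed

text \<open>\<open>delP\<close> is the commutator of contraction and \<open>del_op\<close>;
  contraction commutes with \<open>delB\<close>, and \<open>del_op\<close> anticommutes with
  it.\<close>

lemma delP_delB:
  assumes w: "\<And>I J. w I J \<in> A"
  shows "delP (delB w) I J + delB (delP w) I J = 0"
proof -
  let ?dw = "\<lambda>K L. del_op (\<lambda>K'. w K' L) K" and ?cw = "\<lambda>K L. con h P (\<lambda>K'. w K' L) K"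
  have cl: "?dw K L \<in> A" "?cw K L \<in> A" for K L
    by (intro del_op_closed con_closed w)+
  have cl2: "con h P (\<lambda>K'. ?dw K' L) K \<in> A" "del_op (\<lambda>K'. ?cw K' L) K \<in> A" for K L
    by (intro del_op_closed con_closed w)+
  have "del_op (\<lambda>K. delB w K J) = (\<lambda>I. - delB ?dw I J)"
    using del_op_delB[of w, OF w] by blast
  moreover have "con h P (\<lambda>I. - delB ?dw I J) I = - con h P (\<lambda>I. delB ?dw I J) I"
    by (simp add: con_def sum_negf)
  moreover have "con h P (\<lambda>K. delB w K J) = (\<lambda>I. delB ?cw I J)"
    using con_delB[of w, OF w] by blast
  ultimately have "delP (delB w) I J = - con h P (\<lambda>I. delB ?dw I J) I - del_op (\<lambda>I. delB ?cw I J) I"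
    unfolding delP_def delp_def by simp
  also have "\<dots> = - delB (\<lambda>K L. con h P (\<lambda>K'. ?dw K' L) K) I J + delB (\<lambda>K L. del_op (\<lambda>K'. ?cw K' L) K) I J"
    using con_delB[of ?dw, OF cl(1)] del_op_delB[of ?cw, OF cl(2)] by simp
  also have "\<dots> = - delB (delP w) I J"
    unfolding delP_def delp_def using delB_diff[OF cl2] by simp
  finally show ?thesis by simp
qed

end

section \<open>Smooth functions on the model space\<close>

abbreviation model_open :: "'n::finite set \<Rightarrow> (complex^'n) set \<Rightarrow> bool" where
  "model_open I W \<equiv> openin (top_of_set (model_space I)) W"

lemma model_space_add: "z \<in> model_space I \<Longrightarrow> v \<in> model_space I \<Longrightarrow> z + v \<in> model_space I"
  by (simp add: model_space_def)

lemma model_space_scaleR: "v \<in> model_space I \<Longrightarrow> t *\<^sub>R v \<in> model_space I"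
  by (simp add: model_space_def)

lemma axis_model_space: "i \<in> I \<Longrightarrow> axis i c \<in> model_space I"
  by (auto simp: model_space_def axis_def)

lemma model_open_subset: "model_open I W \<Longrightarrow> W \<subseteq> model_space I"
  by (rule openin_imp_subset) simp

text \<open>\<open>W\<close> is open only inside a coordinate subspace, so a line stays in
  \<open>W\<close> for a short time only if its direction lies in that subspace. This is why
  directions are restricted throughout.\<close>

lemma model_open_line:
  assumes W: "model_open I W" and z: "z + t *\<^sub>R v \<in> W" and v: "v \<in> model_space I"
  obtains \<epsilon> where "\<epsilon> > 0" and "\<And>s. \<bar>s - t\<bar> < \<epsilon> \<Longrightarrow> z + s *\<^sub>R v \<in> W"
proof -
  obtain e where e: "e > 0" "ball (z + t *\<^sub>R v) e \<inter> model_space I \<subseteq> W"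
    using W z by (auto simp: openin_contains_ball)
  have zt: "z + t *\<^sub>R v \<in> model_space I"
    using model_open_subset[OF W] z by blast
  show ?thesis
  proof
    \<comment> \<open>The summand 1 covers the direction \<open>v = 0\<close>.\<close>
    show "e / (norm v + 1) > 0"
      using e by (simp add: add_nonneg_pos)
    fix s
    assume s: "\<bar>s - t\<bar> < e / (norm v + 1)"
    have eq: "z + s *\<^sub>R v = (z + t *\<^sub>R v) + (s - t) *\<^sub>R v"
      by (simp add: algebra_simps)
    have "\<bar>s - t\<bar> * norm v \<le> \<bar>s - t\<bar> * (norm v + 1)"
      by (simp add: mult_left_mono)
    also have "\<dots> < e"
      using s by (simp add: pos_less_divide_eq add_nonneg_pos)
    finally have "z + s *\<^sub>R v \<in> ball (z + t *\<^sub>R v) e"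
      unfolding eq by (simp add: dist_norm)
    moreover have "z + s *\<^sub>R v \<in> model_space I"
      unfolding eq by (intro model_space_add model_space_scaleR zt v)
    ultimately show "z + s *\<^sub>R v \<in> W"
      using e by blast
  qed
qed

text \<open>Near a common point both sets coincide with the model space.\<close>

lemma model_open_at_within:
  assumes W: "model_open I W" and V: "model_open I V" and z: "z \<in> V" "z \<in> W"
  shows "at z within W = at z within V"
proof -
  obtain T T' where T: "open T" "V = model_space I \<inter> T" "open T'" "W = model_space I \<inter> T'"
    using V W by (auto simp: openin_open)
  show ?thesis
    by (rule at_within_nhd[of z "T \<inter> T'"]) (use T z in auto)
qed

locale model_set =
  fixes I :: "'n::finite set" and W :: "(complex^'n) set"
  assumes opn: "model_open I W"
begin

text \<open>Passes from the derivative within \<open>W\<close>, which has no interior when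
  \<open>I\<close> is a proper subset, to an ordinary derivative along a line: the parameters whose
  points lie in \<open>W\<close> contain an interval around \<open>t\<close>.\<close>

lemma line_has_vector_derivative:
  assumes F: "(F has_derivative F') (at (z + t *\<^sub>R v) within W)"
    and z: "z + t *\<^sub>R v \<in> W" and v: "v \<in> model_space I"
  shows "((\<lambda>s. F (z + s *\<^sub>R v)) has_vector_derivative F' v) (at t)"
proof -
  obtain \<epsilon> where \<epsilon>: "\<epsilon> > 0" "\<And>s. \<bar>s - t\<bar> < \<epsilon> \<Longrightarrow> z + s *\<^sub>R v \<in> W"
    using model_open_line[OF opn z v] by blast
  let ?T = "ball t \<epsilon>"
  have sub: "(\<lambda>s. z + s *\<^sub>R v) ` ?T \<subseteq> W"
    using \<epsilon> by (auto simp: dist_real_def abs_minus_commute)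
  have "((\<lambda>s. z + s *\<^sub>R v) has_derivative (\<lambda>s. s *\<^sub>R v)) (at t within ?T)"
    by (auto intro!: derivative_eq_intros)
  from has_derivative_in_compose[OF this has_derivative_subset[OF F sub]]
  have "((\<lambda>s. F (z + s *\<^sub>R v)) has_derivative (\<lambda>s. F' (s *\<^sub>R v))) (at t within ?T)" .
  moreover have "at t within ?T = at t"
    by (rule at_within_open) (use \<epsilon> in auto)
  moreover have "(\<lambda>s. F' (s *\<^sub>R v)) = (\<lambda>s. s *\<^sub>R F' v)"
    using has_derivative_bounded_linear[OF F] by (simp add: bounded_linear.linear linear_cmul)
  ultimately show ?thesis
    by (simp add: has_vector_derivative_def)
qed

lemma dir_deriv_eq:
  assumes "(F has_derivative F') (at z within W)" "z \<in> W" "v \<in> model_space I"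
  shows "dir_deriv v F z = F' v"
  unfolding dir_deriv_def
  by (rule vector_derivative_at, rule line_has_vector_derivative) (use assms in auto)

lemma dir_deriv_cong:
  assumes "\<And>z. z \<in> W \<Longrightarrow> F z = G z" "z \<in> W" "v \<in> model_space I"
  shows "dir_deriv v F z = dir_deriv v G z"
proof -
  obtain \<epsilon> where \<epsilon>: "\<epsilon> > 0" "\<And>s. \<bar>s - 0\<bar> < \<epsilon> \<Longrightarrow> z + s *\<^sub>R v \<in> W"
    using model_open_line[OF opn, of z 0 v] assms by auto
  have "eventually (\<lambda>s. s \<in> ball 0 \<epsilon>) (nhds (0::real))"
    by (rule eventually_nhds_in_open) (use \<epsilon> in auto)
  then have "eventually (\<lambda>s. F (z + s *\<^sub>R v) = G (z + s *\<^sub>R v)) (nhds (0::real))"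
    by eventually_elim (use \<epsilon> assms in auto)
  then show ?thesis
    unfolding dir_deriv_def by (intro vector_derivative_cong_eq) auto
qed

lemma dir_deriv_add:
  assumes "F differentiable (at z within W)" "G differentiable (at z within W)" "z \<in> W" "v \<in> model_space I"
  shows "dir_deriv v (\<lambda>z. F z + G z) z = dir_deriv v F z + dir_deriv v G z"
proof -
  obtain F' G' where FG: "(F has_derivative F') (at z within W)" "(G has_derivative G') (at z within W)"
    using assms unfolding differentiable_def by blast
  show ?thesis
    using dir_deriv_eq[OF has_derivative_add[OF FG]] dir_deriv_eq[OF FG(1)] dir_deriv_eq[OF FG(2)] assms
    by simp
qed

lemma dir_deriv_mult:
  assumes "F differentiable (at z within W)" "G differentiable (at z within W)" "z \<in> W" "v \<in> model_space I"
  shows "dir_deriv v (\<lambda>z. F z * G z) z = dir_deriv v F z * G z + F z * dir_deriv v G z"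
proof -
  obtain F' G' where FG: "(F has_derivative F') (at z within W)" "(G has_derivative G') (at z within W)"
    using assms unfolding differentiable_def by blast
  show ?thesis
    using dir_deriv_eq[OF has_derivative_mult[OF FG]] dir_deriv_eq[OF FG(1)] dir_deriv_eq[OF FG(2)] assms
    by simp
qed

lemma dir_deriv_linear:
  assumes "bounded_linear L" "F differentiable (at z within W)" "z \<in> W" "v \<in> model_space I"
  shows "dir_deriv v (\<lambda>z. L (F z)) z = L (dir_deriv v F z)"
proof -
  obtain F' where F: "(F has_derivative F') (at z within W)"
    using assms unfolding differentiable_def by blast
  show ?thesis
    using dir_deriv_eq[OF bounded_linear.has_derivative[OF assms(1) F]] dir_deriv_eq[OF F] assms
    by simp
qed

lemma dir_deriv_inverse:
  assumes "F differentiable (at z within W)" "F z \<noteq> 0" "z \<in> W" "v \<in> model_space I"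
  shows "dir_deriv v (\<lambda>z. inverse (F z)) z = - (inverse (F z) * dir_deriv v F z * inverse (F z))"
proof -
  obtain F' where F: "(F has_derivative F') (at z within W)"
    using assms unfolding differentiable_def by blast
  show ?thesis
    using dir_deriv_eq[OF Deriv.has_derivative_inverse[OF assms(2) F]] dir_deriv_eq[OF F] assms
    by simp
qed

lemma dir_deriv_const: "z \<in> W \<Longrightarrow> v \<in> model_space I \<Longrightarrow> dir_deriv v (\<lambda>z. c) z = 0"
  by (rule dir_deriv_eq) auto

lemma dir_deriv_nth: "z \<in> W \<Longrightarrow> v \<in> model_space I \<Longrightarrow> dir_deriv v (\<lambda>z. z $ a) z = v $ a"
  by (rule dir_deriv_eq) (auto intro: bounded_linear_imp_has_derivative)

lemma differentiable_vec:
  fixes \<phi> :: "complex^'n \<Rightarrow> complex^'n"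
  assumes "\<And>a. (\<lambda>z. \<phi> z $ a) differentiable (at z within W)"
  shows "\<phi> differentiable (at z within W)"
  unfolding differentiable_componentwise_within[of \<phi>]
proof
  fix b :: "complex^'n"
  assume "b \<in> Basis"
  then obtain a c where b: "b = axis a c"
    by (auto simp: Basis_vec_def)
  have "(\<lambda>z. \<phi> z $ a \<bullet> c) differentiable (at z within W)"
    using assms[of a] bounded_linear.has_derivative[OF bounded_linear_inner_left]
    unfolding differentiable_def by blast
  then show "(\<lambda>z. \<phi> z \<bullet> b) differentiable (at z within W)"
    by (simp add: b inner_axis)
qed

text \<open>\<open>F'\<close> is only real linear, so its argument is expanded in the real and
  imaginary unit vectors of every axis. Axes outside \<open>I\<close> drop out because \<phi> maps
  into the model space and its components there are identically zero on \<open>W\<close>.\<close>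

lemma dir_deriv_compose:
  assumes W': "model_open I W'" and \<phi>: "\<phi> ` W \<subseteq> W'"
    and d\<phi>: "\<And>a. (\<lambda>z. \<phi> z $ a) differentiable (at z within W)"
    and F: "F differentiable (at (\<phi> z) within W')" and z: "z \<in> W" and v: "v \<in> model_space I"
  shows "dir_deriv v (\<lambda>z. F (\<phi> z)) z = (\<Sum>a\<in>I.
      of_real (Re (dir_deriv v (\<lambda>z. \<phi> z $ a) z)) * dir_deriv (axis a 1) F (\<phi> z)
    + of_real (Im (dir_deriv v (\<lambda>z. \<phi> z $ a) z)) * dir_deriv (axis a \<i>) F (\<phi> z))"
proof -
  interpret V: model_set I W' by unfold_locales (rule W')
  obtain \<phi>' where \<phi>': "(\<phi> has_derivative \<phi>') (at z within W)"
    using differentiable_vec[OF d\<phi>] unfolding differentiable_def by blast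
  obtain F' where F': "(F has_derivative F') (at (\<phi> z) within W')"
    using F unfolding differentiable_def by blast
  have lin: "linear F'"
    using has_derivative_linear[OF F'] .
  have "((\<lambda>z. F (\<phi> z)) has_derivative (\<lambda>v. F' (\<phi>' v))) (at z within W)"
    by (rule has_derivative_in_compose[OF \<phi>' has_derivative_subset[OF F' \<phi>]])
  then have 1: "dir_deriv v (\<lambda>z. F (\<phi> z)) z = F' (\<phi>' v)"
    using z v by (rule dir_deriv_eq)
  have comp: "dir_deriv v (\<lambda>z. \<phi> z $ a) z = \<phi>' v $ a" for a
    by (rule dir_deriv_eq[OF _ z v])
      (rule bounded_linear.has_derivative[OF bounded_linear_vec_nth \<phi>'])
  have zero: "\<phi>' v $ a = 0" if "a \<notin> I" for a
  proof -
    have "dir_deriv v (\<lambda>z. \<phi> z $ a) z = dir_deriv v (\<lambda>z. 0) z"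
      by (rule dir_deriv_cong[OF _ z v])
        (use \<phi> model_open_subset[OF W'] that in \<open>auto simp: model_space_def\<close>)
    then show ?thesis
      using dir_deriv_const[OF z v] comp by simp
  qed
  have "\<phi>' v = (\<Sum>a\<in>UNIV. Re (\<phi>' v $ a) *\<^sub>R axis a 1 + Im (\<phi>' v $ a) *\<^sub>R axis a \<i>)"
  proof -
    have *: "(Re (\<phi>' v $ a) *\<^sub>R axis a 1 + Im (\<phi>' v $ a) *\<^sub>R axis a \<i>) $ i = (if i = a then \<phi>' v $ i else 0)" for a i
      by (simp add: axis_def complex_eq_iff)
    show ?thesis
      unfolding vec_eq_iff
    proof
      fix i
      show "\<phi>' v $ i = (\<Sum>a\<in>UNIV. Re (\<phi>' v $ a) *\<^sub>R axis a 1 + Im (\<phi>' v $ a) *\<^sub>R axis a \<i>) $ i"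
        by (simp only: sum_component *) simp
    qed
  qed
  also have "\<dots> = (\<Sum>a\<in>I. Re (\<phi>' v $ a) *\<^sub>R axis a 1 + Im (\<phi>' v $ a) *\<^sub>R axis a \<i>)"
    by (rule sum.mono_neutral_right) (auto simp: zero)
  finally have "F' (\<phi>' v) = F' \<dots>" by simp
  also have "\<dots> = (\<Sum>a\<in>I. Re (\<phi>' v $ a) *\<^sub>R F' (axis a 1) + Im (\<phi>' v $ a) *\<^sub>R F' (axis a \<i>))"
    by (simp add: linear_sum[OF lin] linear_add[OF lin] linear_cmul[OF lin])
  also have "\<dots> = (\<Sum>a\<in>I.
      of_real (Re (\<phi>' v $ a)) * dir_deriv (axis a 1) F (\<phi> z)
    + of_real (Im (\<phi>' v $ a)) * dir_deriv (axis a \<i>) F (\<phi> z))"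
  proof (rule sum.cong[OF refl])
    fix a assume "a \<in> I"
    then have "dir_deriv (axis a c) F (\<phi> z) = F' (axis a c)" for c
      using \<phi> z by (intro V.dir_deriv_eq[OF F'] axis_model_space) auto
    then show "Re (\<phi>' v $ a) *\<^sub>R F' (axis a 1) + Im (\<phi>' v $ a) *\<^sub>R F' (axis a \<i>) =
      of_real (Re (\<phi>' v $ a)) * dir_deriv (axis a 1) F (\<phi> z)
      + of_real (Im (\<phi>' v $ a)) * dir_deriv (axis a \<i>) F (\<phi> z)"
      by (simp add: scaleR_conv_of_real)
  qed
  finally show ?thesis
    unfolding 1 comp .
qed

section \<open>Functions of class C^k on relatively open sets\<close>

abbreviation C :: "nat \<Rightarrow> (complex^'n \<Rightarrow> complex) \<Rightarrow> bool" where
  "C k F \<equiv> Ck (model_space I) k W F"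

lemma C_cong: "C k F \<Longrightarrow> (\<And>z. z \<in> W \<Longrightarrow> G z = F z) \<Longrightarrow> C k G"
proof (induction k arbitrary: F G)
  case 0
  then show ?case by (simp cong: continuous_on_cong)
next
  case (Suc k)
  have "G differentiable_on W"
    unfolding differentiable_on_def differentiable_def
  proof
    fix z assume z: "z \<in> W"
    then obtain F' where "(F has_derivative F') (at z within W)"
      using Suc.prems by (auto simp: differentiable_on_def differentiable_def)
    from has_derivative_transform[OF z _ this] show "\<exists>D. (G has_derivative D) (at z within W)"
      using Suc.prems(2) by blast
  qed
  moreover have "C k (dir_deriv v G)" if "v \<in> model_space I" for v
  proof (rule Suc.IH[of "dir_deriv v F"])
    show "C k (dir_deriv v F)"
      using Suc.prems(1) that by simp
    show "dir_deriv v G z = dir_deriv v F z" if "z \<in> W" for z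
      by (rule dir_deriv_cong[OF Suc.prems(2) that \<open>v \<in> model_space I\<close>])
  qed
  ultimately show ?case by simp
qed

lemma C_Suc_D: "C (Suc k) F \<Longrightarrow> C k F"
  by (induction k arbitrary: F) (auto intro: differentiable_imp_continuous_on)

lemma C_differentiable: "C (Suc k) F \<Longrightarrow> z \<in> W \<Longrightarrow> F differentiable (at z within W)"
  by (simp add: differentiable_on_def)

lemma C_dir_deriv: "C (Suc k) F \<Longrightarrow> v \<in> model_space I \<Longrightarrow> C k (dir_deriv v F)"
  by simp

lemma C_SucI:
  assumes "\<And>z. z \<in> W \<Longrightarrow> F differentiable (at z within W)"
    and "\<And>v. v \<in> model_space I \<Longrightarrow> C k (D v)"
    and "\<And>v z. v \<in> model_space I \<Longrightarrow> z \<in> W \<Longrightarrow> dir_deriv v F z = D v z"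
  shows "C (Suc k) F"
proof -
  have "C k (dir_deriv v F)" if "v \<in> model_space I" for v
    by (rule C_cong[OF assms(2)[OF that] assms(3)[OF that]])
  then show ?thesis
    using assms(1) by (simp add: differentiable_on_def)
qed

lemma C_const: "C k (\<lambda>z. c)"
proof (induction k arbitrary: c)
  case (Suc k)
  show ?case
    by (rule C_SucI[OF _ Suc[of 0]]) (auto simp: dir_deriv_const)
qed simp

lemma C_nth: "C k (\<lambda>z. z $ a)"
proof (cases k)
  case 0
  then show ?thesis by (auto intro: continuous_intros)
next
  case (Suc m)
  have "C (Suc m) (\<lambda>z. z $ a)"
    by (rule C_SucI[OF _ C_const])
      (auto simp: dir_deriv_nth intro: bounded_linear_imp_differentiable)
  with Suc show ?thesis by simp
qed

lemma C_add: "C k F \<Longrightarrow> C k G \<Longrightarrow> C k (\<lambda>z. F z + G z)"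
proof (induction k arbitrary: F G)
  case 0
  then show ?case by (auto intro: continuous_intros)
next
  case (Suc k)
  show ?case
    by (rule C_SucI[where D = "\<lambda>v z. dir_deriv v F z + dir_deriv v G z"])
      (use Suc in \<open>auto intro!: differentiable_add dir_deriv_add Suc.IH simp: differentiable_on_def\<close>)
qed

lemma C_mult: "C k F \<Longrightarrow> C k G \<Longrightarrow> C k (\<lambda>z. F z * G z)"
proof (induction k arbitrary: F G)
  case 0
  then show ?case by (auto intro: continuous_intros)
next
  case (Suc k)
  show ?case
  proof (rule C_SucI[where D = "\<lambda>v z. dir_deriv v F z * G z + F z * dir_deriv v G z"])
    show "C k (\<lambda>z. dir_deriv v F z * G z + F z * dir_deriv v G z)" if "v \<in> model_space I" for v
      using Suc.prems[THEN C_Suc_D] Suc.prems[THEN C_dir_deriv, OF that] by (intro C_add Suc.IH)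
  qed (use Suc.prems in \<open>auto intro!: differentiable_mult dir_deriv_mult simp: differentiable_on_def\<close>)
qed

lemma C_linear:
  assumes "bounded_linear L"
  shows "C k F \<Longrightarrow> C k (\<lambda>z. L (F z))"
proof (induction k arbitrary: F)
  case 0
  then show ?case
    using linear_continuous_on[OF assms, of UNIV] by (auto intro: continuous_on_compose2)
next
  case (Suc k)
  show ?case
  proof (rule C_SucI[where D = "\<lambda>v z. L (dir_deriv v F z)"])
    show "(\<lambda>z. L (F z)) differentiable (at z within W)" if "z \<in> W" for z
      using C_differentiable[OF Suc.prems that] bounded_linear.has_derivative[OF assms]
      unfolding differentiable_def by blast
  qed (use Suc in \<open>auto intro!: dir_deriv_linear assms simp: differentiable_on_def\<close>)
qed

lemma C_sum: "(\<And>x. x \<in> B \<Longrightarrow> C k (F x)) \<Longrightarrow> C k (\<lambda>z. \<Sum>x\<in>B. F x z)"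
  by (induction B rule: infinite_finite_induct) (auto intro: C_add C_const)

lemma C_inverse:
  assumes "\<And>z. z \<in> W \<Longrightarrow> F z \<noteq> 0"
  shows "C k F \<Longrightarrow> C k (\<lambda>z. inverse (F z))"
proof (induction k)
  case 0
  then show ?case using assms by (auto intro!: continuous_intros)
next
  case (Suc k)
  show ?case
  proof (rule C_SucI[where D = "\<lambda>v z. - 1 * (inverse (F z) * dir_deriv v F z * inverse (F z))"])
    show "C k (\<lambda>z. - 1 * (inverse (F z) * dir_deriv v F z * inverse (F z)))" if "v \<in> model_space I" for v
      by (intro C_mult C_const Suc.IH C_Suc_D[OF Suc.prems] C_dir_deriv[OF Suc.prems that])
  qed (use Suc.prems assms in \<open>auto intro!: differentiable_inverse simp: differentiable_on_def dir_deriv_inverse\<close>)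
qed

text \<open>By the chain rule each directional derivative of the composite is a sum of products of
  first derivatives of \<phi> with first derivatives of \<open>F\<close> composed with \<phi>; so
  the induction runs over all \<open>F\<close> at once.\<close>

lemma C_compose:
  assumes W': "model_open I W'" and \<phi>: "\<phi> ` W \<subseteq> W'"
  shows "(\<And>a. C k (\<lambda>z. \<phi> z $ a)) \<Longrightarrow> Ck (model_space I) k W' F \<Longrightarrow> C k (\<lambda>z. F (\<phi> z))"
proof (induction k arbitrary: F)
  case 0
  have "continuous_on W \<phi>"
    using continuous_on_vec_lambda[of W "\<lambda>a z. \<phi> z $ a"] 0 by (simp add: vec_lambda_eta)
  then show ?case
    using 0 \<phi> by (auto intro: continuous_on_compose2)
next
  case (Suc k)
  interpret V: model_set I W' by unfold_locales (rule W')
  have d: "(\<lambda>z. \<phi> z $ a) differentiable (at z within W)" if "z \<in> W" for a z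
    using C_differentiable[OF Suc.prems(1) that] .
  have dF: "F differentiable (at (\<phi> z) within W')" if "z \<in> W" for z
    using V.C_differentiable[OF Suc.prems(2)] that \<phi> by blast
  let ?D = "\<lambda>v z. \<Sum>a\<in>I.
      of_real (Re (dir_deriv v (\<lambda>z. \<phi> z $ a) z)) * dir_deriv (axis a 1) F (\<phi> z)
    + of_real (Im (dir_deriv v (\<lambda>z. \<phi> z $ a) z)) * dir_deriv (axis a \<i>) F (\<phi> z)"
  have re: "bounded_linear (\<lambda>w. complex_of_real (Re w))" "bounded_linear (\<lambda>w. complex_of_real (Im w))"
    by (rule bounded_linear_compose[OF bounded_linear_of_real bounded_linear_Re]
        bounded_linear_compose[OF bounded_linear_of_real bounded_linear_Im])+
  show ?case
  proof (rule C_SucI[where D = ?D])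
    fix z assume z: "z \<in> W"
    show "(\<lambda>z. F (\<phi> z)) differentiable (at z within W)"
      using differentiable_chain_within[of \<phi> z W F] differentiable_vec[OF d[OF z]] dF[OF z]
        differentiable_within_subset[OF dF[OF z] \<phi>]
      by (simp add: o_def)
    show "dir_deriv v (\<lambda>z. F (\<phi> z)) z = ?D v z" if "v \<in> model_space I" for v
      by (rule dir_deriv_compose[OF W' \<phi> d[OF z] dF[OF z] z that])
  next
    fix v :: "complex^'n" assume v: "v \<in> model_space I"
    have 1: "C k (dir_deriv v (\<lambda>z. \<phi> z $ a))" for a
      by (rule C_dir_deriv[OF Suc.prems(1) v])
    have 2: "C k (\<lambda>z. dir_deriv (axis a c) F (\<phi> z))" if "a \<in> I" for a c
      by (rule Suc.IH[OF C_Suc_D[OF Suc.prems(1)] V.C_dir_deriv[OF Suc.prems(2) axis_model_space[OF that]]])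
    show "C k (?D v)"
      by (rule C_sum)
        (rule C_add[OF C_mult[OF C_linear[OF re(1) 1] 2] C_mult[OF C_linear[OF re(2) 1] 2]]; assumption)
  qed
qed

lemma C_subset:
  assumes V: "model_open I V" "V \<subseteq> W"
  shows "C k F \<Longrightarrow> Ck (model_space I) k V F"
proof (induction k arbitrary: F)
  case 0
  then show ?case using V by (auto intro: continuous_on_subset)
next
  case (Suc k)
  then show ?case using V by (auto intro: differentiable_on_subset)
qed

lemma C_local:
  assumes "\<And>z. z \<in> W \<Longrightarrow> \<exists>V. model_open I V \<and> z \<in> V \<and> V \<subseteq> W \<and> Ck (model_space I) k V F"
  shows "C k F"
  using assms
proof (induction k arbitrary: F)
  case 0
  show ?case
    unfolding Ck.simps continuous_on_eq_continuous_within
  proof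
    fix z assume z: "z \<in> W"
    then obtain V where V: "model_open I V" "z \<in> V" "continuous_on V F"
      using 0[OF z] by auto
    then have "continuous (at z within V) F"
      by (simp add: continuous_on_eq_continuous_within)
    then show "continuous (at z within W) F"
      using model_open_at_within[OF opn V(1,2) z] by simp
  qed
next
  case (Suc k)
  have "F differentiable (at z within W)" if z: "z \<in> W" for z
  proof -
    obtain V where V: "model_open I V" "z \<in> V" "F differentiable_on V"
      using Suc.prems[OF z] by auto
    then have "F differentiable (at z within V)"
      by (simp add: differentiable_on_def)
    then show ?thesis
      using model_open_at_within[OF opn V(1,2) z] by simp
  qed
  moreover have "C k (dir_deriv v F)" if "v \<in> model_space I" for v
  proof (rule Suc.IH)
    fix z assume "z \<in> W"
    from Suc.prems[OF this] that
    show "\<exists>V. model_open I V \<and> z \<in> V \<and> V \<subseteq> W \<and> Ck (model_space I) k V (dir_deriv v F)"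
      by fastforce
  qed
  ultimately show ?case
    by (simp add: differentiable_on_def)
qed

definition smooth :: "(complex^'n \<Rightarrow> complex) \<Rightarrow> bool" where
  "smooth F \<longleftrightarrow> (\<forall>k. C k F)"

lemma smooth_differentiable: "smooth F \<Longrightarrow> z \<in> W \<Longrightarrow> F differentiable (at z within W)"
  unfolding smooth_def using C_differentiable by blast

lemma smooth_dir_deriv: "smooth F \<Longrightarrow> v \<in> model_space I \<Longrightarrow> smooth (dir_deriv v F)"
  unfolding smooth_def using C_dir_deriv by blast

lemma smooth_line:
  assumes "smooth F" "z + t *\<^sub>R v \<in> W" "v \<in> model_space I"
  shows "((\<lambda>s. F (z + s *\<^sub>R v)) has_vector_derivative dir_deriv v F (z + t *\<^sub>R v)) (at t)"
proof -
  obtain F' where F': "(F has_derivative F') (at (z + t *\<^sub>R v) within W)"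
    using smooth_differentiable[OF assms(1,2)] unfolding differentiable_def by blast
  show ?thesis
    using line_has_vector_derivative[OF F' assms(2,3)] dir_deriv_eq[OF F' assms(2,3)] by simp
qed

end

section \<open>Symmetry of second derivatives\<close>

text \<open>The mean value theorem is applied twice, first in \<open>s\<close> to
  \<open>g s h - g s 0\<close>, then in \<open>t\<close> to \<open>gs\<close>.\<close>

lemma mixed_difference:
  fixes g gs gst :: "real \<Rightarrow> real \<Rightarrow> real"
  assumes h: "0 < h" "h < e"
    and gs: "\<And>s t. \<bar>s\<bar> < e \<Longrightarrow> \<bar>t\<bar> < e \<Longrightarrow> ((\<lambda>s. g s t) has_real_derivative gs s t) (at s)"
    and gst: "\<And>s t. \<bar>s\<bar> < e \<Longrightarrow> \<bar>t\<bar> < e \<Longrightarrow> ((\<lambda>t. gs s t) has_real_derivative gst s t) (at t)"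
  obtains s t where "0 < s" "s < h" "0 < t" "t < h" "g h h - g h 0 - (g 0 h - g 0 0) = h * h * gst s t"
proof -
  have "\<exists>s. 0 < s \<and> s < h \<and> (g h h - g h 0) - (g 0 h - g 0 0) = (h - 0) * (gs s h - gs s 0)"
    using h by (intro MVT2 DERIV_diff gs) auto
  then obtain s where s: "0 < s" "s < h" "g h h - g h 0 - (g 0 h - g 0 0) = h * (gs s h - gs s 0)"
    by auto
  have "\<exists>t. 0 < t \<and> t < h \<and> gs s h - gs s 0 = (h - 0) * gst s t"
    using h s by (intro MVT2 gst) auto
  then obtain t where "0 < t" "t < h" "gs s h - gs s 0 = h * gst s t"
    by auto
  with s that show ?thesis by auto
qed

text \<open>The second difference over a square is symmetric in the two variables. By
  \<open>mixed_difference\<close> it is \<open>h * h\<close> times a value of either mixed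
  derivative near the origin, so continuity forces the values at the origin to agree.\<close>

lemma mixed_derivatives_eq:
  fixes g gs gt gst gts :: "real \<Rightarrow> real \<Rightarrow> real"
  assumes e: "0 < e"
    and gs: "\<And>s t. \<bar>s\<bar> < e \<Longrightarrow> \<bar>t\<bar> < e \<Longrightarrow> ((\<lambda>s. g s t) has_real_derivative gs s t) (at s)"
    and gt: "\<And>s t. \<bar>s\<bar> < e \<Longrightarrow> \<bar>t\<bar> < e \<Longrightarrow> ((\<lambda>t. g s t) has_real_derivative gt s t) (at t)"
    and gst: "\<And>s t. \<bar>s\<bar> < e \<Longrightarrow> \<bar>t\<bar> < e \<Longrightarrow> ((\<lambda>t. gs s t) has_real_derivative gst s t) (at t)"
    and gts: "\<And>s t. \<bar>s\<bar> < e \<Longrightarrow> \<bar>t\<bar> < e \<Longrightarrow> ((\<lambda>s. gt s t) has_real_derivative gts s t) (at s)"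
    and cst: "\<And>\<epsilon>. \<epsilon> > 0 \<Longrightarrow> \<exists>\<delta>>0. \<forall>s t. \<bar>s\<bar> < \<delta> \<longrightarrow> \<bar>t\<bar> < \<delta> \<longrightarrow> \<bar>gst s t - gst 0 0\<bar> < \<epsilon>"
    and cts: "\<And>\<epsilon>. \<epsilon> > 0 \<Longrightarrow> \<exists>\<delta>>0. \<forall>s t. \<bar>s\<bar> < \<delta> \<longrightarrow> \<bar>t\<bar> < \<delta> \<longrightarrow> \<bar>gts s t - gts 0 0\<bar> < \<epsilon>"
  shows "gst 0 0 = gts 0 0"
proof (rule ccontr)
  assume "gst 0 0 \<noteq> gts 0 0"
  then have \<epsilon>: "\<bar>gst 0 0 - gts 0 0\<bar> / 2 > 0" (is "?\<epsilon> > 0") by simp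
  obtain \<delta>1 where \<delta>1: "\<delta>1 > 0" "\<And>s t. \<bar>s\<bar> < \<delta>1 \<Longrightarrow> \<bar>t\<bar> < \<delta>1 \<Longrightarrow> \<bar>gst s t - gst 0 0\<bar> < ?\<epsilon>"
    using cst[OF \<epsilon>] by blast
  obtain \<delta>2 where \<delta>2: "\<delta>2 > 0" "\<And>s t. \<bar>s\<bar> < \<delta>2 \<Longrightarrow> \<bar>t\<bar> < \<delta>2 \<Longrightarrow> \<bar>gts s t - gts 0 0\<bar> < ?\<epsilon>"
    using cts[OF \<epsilon>] by blast
  define h where "h = min e (min \<delta>1 \<delta>2) / 2"
  have h: "0 < h" "h < e" "h < \<delta>1" "h < \<delta>2"
    using e \<delta>1(1) \<delta>2(1) by (auto simp: h_def)
  obtain s t where st: "0 < s" "s < h" "0 < t" "t < h"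
    "g h h - g h 0 - (g 0 h - g 0 0) = h * h * gst s t"
    using mixed_difference[OF h(1,2) gs gst] by metis
  obtain s' t' where st': "0 < s'" "s' < h" "0 < t'" "t' < h"
    "g h h - g 0 h - (g h 0 - g 0 0) = h * h * gts t' s'"
    using mixed_difference[of h e "\<lambda>s t. g t s" "\<lambda>s t. gt t s" "\<lambda>s t. gts t s", OF h(1,2) gt gts]
    by metis
  have "h * h * gst s t = h * h * gts t' s'"
    using st(5) st'(5) by linarith
  then have "gst s t = gts t' s'"
    using h by simp
  moreover have "\<bar>gst s t - gst 0 0\<bar> < ?\<epsilon>" "\<bar>gts t' s' - gts 0 0\<bar> < ?\<epsilon>"
    using \<delta>1(2)[of s t] \<delta>2(2)[of t' s'] st st' h by auto
  ultimately show False by (auto simp: abs_if split: if_splits)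
qed

context model_set
begin

text \<open>The mean value theorem is real, so the two-variable argument is applied to the real and
  imaginary parts of \<open>F\<close> on the points
  \<open>z + s *\<^sub>R v + t *\<^sub>R w\<close>.\<close>

lemma dir_deriv_commute:
  assumes F: "smooth F" and z: "z \<in> W" and v: "v \<in> model_space I" and w: "w \<in> model_space I"
  shows "dir_deriv v (dir_deriv w F) z = dir_deriv w (dir_deriv v F) z"
proof -
  obtain e where e: "e > 0" "ball z e \<inter> model_space I \<subseteq> W"
    using opn z by (auto simp: openin_contains_ball)
  have zI: "z \<in> model_space I"
    using model_open_subset[OF opn] z by blast
  \<comment> \<open>Bounds the norm of \<open>s *\<^sub>R v + t *\<^sub>R w\<close> by
    \<open>max \<bar>s\<bar> \<bar>t\<bar> * m\<close>; the summand 1 keeps the divisor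
    positive.\<close>
  define m where "m = norm v + norm w + 1"
  have m: "m > 0" by (simp add: m_def add_nonneg_pos)
  have small: "dist (z + s *\<^sub>R v + t *\<^sub>R w) z < \<delta>"
    if "\<bar>s\<bar> < \<delta> / m" "\<bar>t\<bar> < \<delta> / m" for s t \<delta>
  proof -
    have "\<bar>s\<bar> * m < \<delta>" "\<bar>t\<bar> * m < \<delta>"
      using that m by (simp_all add: pos_less_divide_eq)
    have "dist (z + s *\<^sub>R v + t *\<^sub>R w) z = norm (s *\<^sub>R v + t *\<^sub>R w)"
      by (simp add: dist_norm algebra_simps)
    also have "\<dots> \<le> \<bar>s\<bar> * norm v + \<bar>t\<bar> * norm w"
      using norm_triangle_ineq[of "s *\<^sub>R v" "t *\<^sub>R w"] by simp
    also have "\<dots> \<le> max \<bar>s\<bar> \<bar>t\<bar> * norm v + max \<bar>s\<bar> \<bar>t\<bar> * norm w"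
      by (intro add_mono mult_right_mono) auto
    also have "\<dots> \<le> max \<bar>s\<bar> \<bar>t\<bar> * m"
      unfolding m_def by (simp add: algebra_simps)
    also have "\<dots> < \<delta>"
      using \<open>\<bar>s\<bar> * m < \<delta>\<close> \<open>\<bar>t\<bar> * m < \<delta>\<close> by (simp add: max_def)
    finally show ?thesis .
  qed
  have inW: "z + s *\<^sub>R v + t *\<^sub>R w \<in> W" if "\<bar>s\<bar> < e / m" "\<bar>t\<bar> < e / m" for s t
    using small[OF that] e by (auto simp: dist_commute intro!: model_space_add model_space_scaleR zI v w)
  have lin: "L (dir_deriv w (dir_deriv v F) z) = L (dir_deriv v (dir_deriv w F) z)"
    if L: "bounded_linear L" for L :: "complex \<Rightarrow> real"
  proof -
    have s1: "((\<lambda>s. L (G (z + s *\<^sub>R v + t *\<^sub>R w))) has_real_derivative L (dir_deriv v G (z + s *\<^sub>R v + t *\<^sub>R w))) (at s)"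
      if "smooth G" "\<bar>s\<bar> < e / m" "\<bar>t\<bar> < e / m" for G s t
    proof -
      have "((\<lambda>s. G ((z + t *\<^sub>R w) + s *\<^sub>R v)) has_vector_derivative dir_deriv v G ((z + t *\<^sub>R w) + s *\<^sub>R v)) (at s)"
        by (rule smooth_line[OF that(1) _ v]) (use inW[OF that(2,3)] in \<open>simp add: algebra_simps\<close>)
      from bounded_linear.has_vector_derivative[OF L this] show ?thesis
        by (simp add: has_real_derivative_iff_has_vector_derivative algebra_simps)
    qed
    have s2: "((\<lambda>t. L (G (z + s *\<^sub>R v + t *\<^sub>R w))) has_real_derivative L (dir_deriv w G (z + s *\<^sub>R v + t *\<^sub>R w))) (at t)"
      if "smooth G" "\<bar>s\<bar> < e / m" "\<bar>t\<bar> < e / m" for G s t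
    proof -
      have "((\<lambda>t. G ((z + s *\<^sub>R v) + t *\<^sub>R w)) has_vector_derivative dir_deriv w G ((z + s *\<^sub>R v) + t *\<^sub>R w)) (at t)"
        by (rule smooth_line[OF that(1) _ w]) (use inW[OF that(2,3)] in simp)
      from bounded_linear.has_vector_derivative[OF L this] show ?thesis
        by (simp add: has_real_derivative_iff_has_vector_derivative)
    qed
    have cont: "\<exists>\<delta>>0. \<forall>s t. \<bar>s\<bar> < \<delta> \<longrightarrow> \<bar>t\<bar> < \<delta> \<longrightarrow>
        \<bar>L (G (z + s *\<^sub>R v + t *\<^sub>R w)) - L (G (z + 0 *\<^sub>R v + 0 *\<^sub>R w))\<bar> < \<epsilon>"
      if G: "smooth G" and "\<epsilon> > 0" for G \<epsilon>
    proof -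
      have "continuous_on W G"
        using G unfolding smooth_def by (metis Ck.simps(1))
      then have "continuous_on W (\<lambda>x. L (G x))"
        using linear_continuous_on[OF L, of UNIV] by (auto intro: continuous_on_compose2)
      then obtain d where d: "d > 0" "\<And>x. x \<in> W \<Longrightarrow> dist x z < d \<Longrightarrow> dist (L (G x)) (L (G z)) < \<epsilon>"
        using z \<open>\<epsilon> > 0\<close> unfolding continuous_on_iff by metis
      show ?thesis
      proof (intro exI[of _ "min e d / m"] conjI allI impI)
        show "min e d / m > 0" using e d m by simp
        fix s t assume st: "\<bar>s\<bar> < min e d / m" "\<bar>t\<bar> < min e d / m"
        have "min e d / m \<le> e / m" "min e d / m \<le> d / m"
          using m by (auto intro!: divide_right_mono)
        then show "\<bar>L (G (z + s *\<^sub>R v + t *\<^sub>R w)) - L (G (z + 0 *\<^sub>R v + 0 *\<^sub>R w))\<bar> < \<epsilon>"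
          using d(2)[OF inW[of s t] small[of s d t]] st by (simp add: dist_real_def)
      qed
    qed
    have "e / m > 0" using e m by simp
    from mixed_derivatives_eq[OF this s1[OF F] s2[OF F] s2[OF smooth_dir_deriv[OF F v]]
        s1[OF smooth_dir_deriv[OF F w]] cont[OF smooth_dir_deriv[OF smooth_dir_deriv[OF F v] w]]
        cont[OF smooth_dir_deriv[OF smooth_dir_deriv[OF F w] v]]]
    show ?thesis by simp
  qed
  show ?thesis
    using lin[OF bounded_linear_Re] lin[OF bounded_linear_Im] by (simp add: complex_eq_iff)
qed

lemma smooth_const: "smooth (\<lambda>z. c)"
  unfolding smooth_def using C_const by blast

lemma smooth_nth: "smooth (\<lambda>z. z $ a)"
  unfolding smooth_def using C_nth by blast

lemma smooth_add: "smooth F \<Longrightarrow> smooth G \<Longrightarrow> smooth (\<lambda>z. F z + G z)"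
  unfolding smooth_def using C_add by blast

lemma smooth_mult: "smooth F \<Longrightarrow> smooth G \<Longrightarrow> smooth (\<lambda>z. F z * G z)"
  unfolding smooth_def using C_mult by blast

lemma smooth_linear: "bounded_linear L \<Longrightarrow> smooth F \<Longrightarrow> smooth (\<lambda>z. L (F z))"
  unfolding smooth_def using C_linear by blast

lemma smooth_cong: "smooth F \<Longrightarrow> (\<And>z. z \<in> W \<Longrightarrow> G z = F z) \<Longrightarrow> smooth G"
  unfolding smooth_def using C_cong by blast

lemma smooth_sum: "(\<And>x. x \<in> B \<Longrightarrow> smooth (F x)) \<Longrightarrow> smooth (\<lambda>z. \<Sum>x\<in>B. F x z)"
  by (auto simp: smooth_def intro: C_sum)

lemma smooth_inverse: "(\<And>z. z \<in> W \<Longrightarrow> F z \<noteq> 0) \<Longrightarrow> smooth F \<Longrightarrow> smooth (\<lambda>z. inverse (F z))"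
  unfolding smooth_def using C_inverse by blast

end

section \<open>Wirtinger operators\<close>

text \<open>\<open>\<sigma> = 1\<close> gives \<open>\<partial>/\<partial>z\<^sub>i\<close> and \<open>\<sigma> = -1\<close> gives \<open>\<partial>/\<partial>\<bar>z\<^sub>i\<close>.\<close>

definition wop :: "complex \<Rightarrow> 'n::finite \<Rightarrow> (complex^'n \<Rightarrow> complex) \<Rightarrow> complex^'n \<Rightarrow> complex" where
  "wop \<sigma> i F z = (dir_deriv (axis i 1) F z - \<sigma> * \<i> * dir_deriv (axis i \<i>) F z) / 2"

lemma wirtinger_wop: "wirtinger i F z = wop 1 i F z" "wirtinger_bar i F z = wop (-1) i F z"
  by (simp_all add: wirtinger_def wirtinger_bar_def wop_def)

context model_set
begin

lemma wop_cong:
  assumes "\<And>z. z \<in> W \<Longrightarrow> F z = G z" "z \<in> W" "i \<in> I"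
  shows "wop \<sigma> i F z = wop \<sigma> i G z"
  using dir_deriv_cong[OF assms(1,2) axis_model_space[OF assms(3)]] by (simp add: wop_def)

lemma smooth_wop: "smooth F \<Longrightarrow> i \<in> I \<Longrightarrow> smooth (wop \<sigma> i F)"
proof -
  assume F: "smooth F" and i: "i \<in> I"
  have "smooth (\<lambda>z. (1/2) * dir_deriv (axis i 1) F z + (- \<sigma> * \<i> / 2) * dir_deriv (axis i \<i>) F z)"
    by (intro smooth_add smooth_mult smooth_const smooth_dir_deriv F axis_model_space i)
  then show ?thesis
    by (rule smooth_cong) (simp add: wop_def field_simps)
qed

lemma wop_add:
  assumes "smooth F" "smooth G" "z \<in> W" "i \<in> I"
  shows "wop \<sigma> i (\<lambda>z. F z + G z) z = wop \<sigma> i F z + wop \<sigma> i G z"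
  using dir_deriv_add[OF smooth_differentiable[OF assms(1,3)] smooth_differentiable[OF assms(2,3)] assms(3)
      axis_model_space[OF assms(4)]]
  by (simp add: wop_def field_simps)

lemma wop_mult:
  assumes "smooth F" "smooth G" "z \<in> W" "i \<in> I"
  shows "wop \<sigma> i (\<lambda>z. F z * G z) z = wop \<sigma> i F z * G z + F z * wop \<sigma> i G z"
  using dir_deriv_mult[OF smooth_differentiable[OF assms(1,3)] smooth_differentiable[OF assms(2,3)] assms(3)
      axis_model_space[OF assms(4)]]
  by (simp add: wop_def field_simps)

lemma wop_const: "z \<in> W \<Longrightarrow> i \<in> I \<Longrightarrow> wop \<sigma> i (\<lambda>z. c) z = 0"
  by (simp add: wop_def dir_deriv_const axis_model_space)

lemma wop_cnj:
  assumes "smooth F" "z \<in> W" "i \<in> I" "cnj \<sigma> = \<sigma>"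
  shows "wop \<sigma> i (\<lambda>z. cnj (F z)) z = cnj (wop (- \<sigma>) i F z)"
  using dir_deriv_linear[OF bounded_linear_cnj smooth_differentiable[OF assms(1,2)] assms(2)
      axis_model_space[OF assms(3)]] assms(4)
  by (simp add: wop_def)

lemma wop_nth:
  assumes "z \<in> W" "i \<in> I"
  shows "wop \<sigma> i (\<lambda>z. z $ a) z = (if a = i then (1 + \<sigma>) / 2 else 0)"
  using dir_deriv_nth[OF assms(1) axis_model_space[OF assms(2)], of _ a]
  by (simp add: wop_def axis_def field_simps)

lemma wop_commute:
  assumes F: "smooth F" and z: "z \<in> W" and ij: "i \<in> I" "j \<in> I"
  shows "wop \<sigma> i (wop \<tau> j F) z = wop \<tau> j (wop \<sigma> i F) z"
proof -
  let ?D = "\<lambda>i c. dir_deriv (axis i c)"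
  have expand: "?D i c (wop \<tau> j F) z = (?D i c (?D j 1 F) z - \<tau> * \<i> * ?D i c (?D j \<i> F) z) / 2"
    if i: "i \<in> I" and j: "j \<in> I" for i j c \<tau>
  proof -
    have s: "smooth (?D j c F)" for c
      by (intro smooth_dir_deriv F axis_model_space j)
    have d: "?D j c F differentiable (at z within W)" for c
      by (rule smooth_differentiable[OF s z])
    have s': "smooth (\<lambda>z. b * ?D j c F z)" for b c
      by (intro smooth_mult smooth_const s)
    have c1: "?D i c (\<lambda>z. b * ?D j c' F z) z = b * ?D i c (?D j c' F) z" for b c'
      by (rule dir_deriv_linear[OF bounded_linear_mult_right d z axis_model_space[OF i]])
    have "?D i c (wop \<tau> j F) z = ?D i c (\<lambda>z. (1/2) * ?D j 1 F z + (- \<tau> * \<i> / 2) * ?D j \<i> F z) z"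
      by (rule dir_deriv_cong[OF _ z axis_model_space[OF i]]) (simp add: wop_def field_simps)
    also have "\<dots> = (1/2) * ?D i c (?D j 1 F) z + (- \<tau> * \<i> / 2) * ?D i c (?D j \<i> F) z"
      using dir_deriv_add[OF smooth_differentiable[OF s' z] smooth_differentiable[OF s' z] z axis_model_space[OF i]]
      by (simp only: c1)
    finally show ?thesis by (simp add: field_simps)
  qed
  have com: "?D i c (?D j c' F) z = ?D j c' (?D i c F) z" for c c'
    by (rule dir_deriv_commute[OF F z]) (intro axis_model_space ij)+
  show ?thesis
    unfolding wop_def[of \<sigma> i "wop \<tau> j F"] wop_def[of \<tau> j "wop \<sigma> i F"] expand[OF ij] expand[OF ij(2,1)] com
    by (simp add: field_simps)
qed

text \<open>As \<phi> is a general smooth map, derivatives of \<open>F\<close> in both kinds of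
  variables contribute. The coefficient of the second kind is the derivative of the conjugate of
  \<phi>, which for real \<sigma> is the conjugate of the opposite derivative.\<close>

lemma wop_compose:
  assumes W': "model_open I W'" and \<phi>: "\<phi> ` W \<subseteq> W'"
    and s\<phi>: "\<And>a. smooth (\<lambda>z. \<phi> z $ a)" and F: "model_set.smooth I W' F"
    and z: "z \<in> W" and i: "i \<in> I" and \<sigma>: "cnj \<sigma> = \<sigma>"
  shows "wop \<sigma> i (\<lambda>z. F (\<phi> z)) z = (\<Sum>a\<in>I. wop \<sigma> i (\<lambda>z. \<phi> z $ a) z * wop 1 a F (\<phi> z)
    + cnj (wop (- \<sigma>) i (\<lambda>z. \<phi> z $ a) z) * wop (-1) a F (\<phi> z))"
proof -
  interpret V: model_set I W' by unfold_locales (rule W')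
  have "dir_deriv v (\<lambda>z. F (\<phi> z)) z
      = (\<Sum>a\<in>I. dir_deriv v (\<lambda>z. \<phi> z $ a) z * wop 1 a F (\<phi> z)
        + cnj (dir_deriv v (\<lambda>z. \<phi> z $ a) z) * wop (-1) a F (\<phi> z))" if v: "v \<in> model_space I" for v
  proof -
    have "dir_deriv v (\<lambda>z. F (\<phi> z)) z = (\<Sum>a\<in>I.
        of_real (Re (dir_deriv v (\<lambda>z. \<phi> z $ a) z)) * dir_deriv (axis a 1) F (\<phi> z)
      + of_real (Im (dir_deriv v (\<lambda>z. \<phi> z $ a) z)) * dir_deriv (axis a \<i>) F (\<phi> z))"
      by (rule dir_deriv_compose[OF W' \<phi> smooth_differentiable[OF s\<phi> z] V.smooth_differentiable[OF F] z v])
        (use \<phi> z in auto)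
    also have "\<dots> = (\<Sum>a\<in>I. dir_deriv v (\<lambda>z. \<phi> z $ a) z * wop 1 a F (\<phi> z)
        + cnj (dir_deriv v (\<lambda>z. \<phi> z $ a) z) * wop (-1) a F (\<phi> z))"
      by (intro sum.cong refl) (simp add: wop_def complex_eq_iff algebra_simps add_divide_distrib diff_divide_distrib)
    finally show ?thesis .
  qed
  note * = this[OF axis_model_space[OF i]]
  show ?thesis
    unfolding wop_def[of \<sigma> i "\<lambda>z. F (\<phi> z)"] * wop_def[of _ i "\<lambda>z. \<phi> z $ _"] sum_distrib_left
      sum_subtractf[symmetric] sum_divide_distrib
    using \<sigma> by (intro sum.cong refl) (simp add: field_simps)
qed

lemma smooth_compose:
  assumes W': "model_open I W'" and \<phi>: "\<phi> ` W \<subseteq> W'"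
    and s\<phi>: "\<And>a. smooth (\<lambda>z. \<phi> z $ a)" and F: "model_set.smooth I W' F"
  shows "smooth (\<lambda>z. F (\<phi> z))"
proof -
  interpret V: model_set I W' by unfold_locales (rule W')
  show ?thesis
    using C_compose[OF W' \<phi>, of _ F] s\<phi> F unfolding smooth_def V.smooth_def by blast
qed

lemma smooth_subset:
  assumes V: "model_open I V" "V \<subseteq> W" and F: "smooth F"
  shows "model_set.smooth I V F"
proof -
  interpret V: model_set I V by unfold_locales (rule V)
  show ?thesis
    using C_subset[OF V] F unfolding smooth_def V.smooth_def by blast
qed

lemma smooth_local:
  assumes "\<And>z. z \<in> W \<Longrightarrow> \<exists>V. model_open I V \<and> z \<in> V \<and> V \<subseteq> W \<and> model_set.smooth I V F"
  shows "smooth F"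
  unfolding smooth_def
proof (intro allI C_local)
  fix k z assume "z \<in> W"
  then obtain V where V: "model_open I V" "z \<in> V" "V \<subseteq> W" "model_set.smooth I V F"
    using assms by blast
  interpret V: model_set I V by unfold_locales (rule V)
  show "\<exists>V. model_open I V \<and> z \<in> V \<and> V \<subseteq> W \<and> Ck (model_space I) k V F"
    using V V.smooth_def by blast
qed

end

section \<open>Functions in a chart\<close>

locale cmfd =
  fixes M :: "('a, 'n::finite) cmanifold"
  assumes M: "complex_manifold M"
begin

lemma chart_open: "c \<in> atlas M \<Longrightarrow> openin (top_of M) (dom_of c)"
  using M by (simp add: complex_manifold_def)

lemma chart_homeo:
  "c \<in> atlas M \<Longrightarrow> homeomorphic_map (subtopology (top_of M) (dom_of c)) (top_of_set (snd c ` dom_of c)) (snd c)"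
  using M by (simp add: complex_manifold_def)

lemma chart_image: "c \<in> atlas M \<Longrightarrow> model_open (ind M) (snd c ` dom_of c)"
  using M by (simp add: complex_manifold_def)

lemma chart_inj: "c \<in> atlas M \<Longrightarrow> inj_on (snd c) (dom_of c)"
  using homeomorphic_imp_injective_map[OF chart_homeo] chart_open[THEN openin_subset]
  by (simp add: topspace_subtopology Int_absorb1)

lemma chart_open_image:
  assumes c: "c \<in> atlas M" and W: "openin (top_of M) W" "W \<subseteq> dom_of c"
  shows "model_open (ind M) (snd c ` W)"
proof -
  have "openin (subtopology (top_of M) (dom_of c)) W"
    using W by (metis inf.absorb_iff1 openin_subtopology)
  then have "openin (top_of_set (snd c ` dom_of c)) (snd c ` W)"
    using homeomorphic_imp_open_map[OF chart_homeo[OF c]] by (simp add: open_map_def)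
  then show ?thesis
    using chart_image[OF c] openin_trans by blast
qed

lemma local_rep_apply: "c \<in> atlas M \<Longrightarrow> x \<in> dom_of c \<Longrightarrow> local_rep c f (snd c x) = f x"
  by (simp add: local_rep_def chart_inj)

lemma chart_model: "c \<in> atlas M \<Longrightarrow> x \<in> dom_of c \<Longrightarrow> i \<notin> ind M \<Longrightarrow> coord c i x = 0"
  using model_open_subset[OF chart_image, of c] by (auto simp: model_space_def)

lemma transition: "c \<in> atlas M \<Longrightarrow> c' \<in> atlas M \<Longrightarrow> a \<in> ind M \<Longrightarrow>
    holomorphic_in (ind M) c (dom_of c \<inter> dom_of c') (coord c' a)"
  using M by (simp add: complex_manifold_def)

end

locale chart_domain = cmfd M for M :: "('a, 'n::finite) cmanifold" +
  fixes c :: "('a, 'n) chart" and W :: "'a set"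
  assumes c: "c \<in> atlas M" and W: "openin (top_of M) W" and Wc: "W \<subseteq> dom_of c"
begin

sublocale m: model_set "ind M" "snd c ` W"
  by unfold_locales (rule chart_open_image[OF c W Wc])

lemma smooth_in_iff: "smooth_in (ind M) c W f \<longleftrightarrow> m.smooth (local_rep c f)"
  by (simp add: smooth_in_def m.smooth_def)

lemma rep: "x \<in> W \<Longrightarrow> local_rep c f (snd c x) = f x"
  using Wc by (auto intro: local_rep_apply[OF c])

lemma smooth_in_cong:
  assumes "smooth_in (ind M) c W f" "\<And>x. x \<in> W \<Longrightarrow> g x = f x"
  shows "smooth_in (ind M) c W g"
  using assms unfolding smooth_in_iff by (auto intro: m.smooth_cong simp: rep)

lemma smooth_in_add: "smooth_in (ind M) c W f \<Longrightarrow> smooth_in (ind M) c W g \<Longrightarrow> smooth_in (ind M) c W (\<lambda>x. f x + g x)"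
  unfolding smooth_in_iff
  by (drule (1) m.smooth_add, erule m.smooth_cong) (auto simp: rep)

lemma smooth_in_mult: "smooth_in (ind M) c W f \<Longrightarrow> smooth_in (ind M) c W g \<Longrightarrow> smooth_in (ind M) c W (\<lambda>x. f x * g x)"
  unfolding smooth_in_iff
  by (drule (1) m.smooth_mult, erule m.smooth_cong) (auto simp: rep)

lemma smooth_in_const: "smooth_in (ind M) c W (\<lambda>x. k)"
  unfolding smooth_in_iff by (rule m.smooth_cong[OF m.smooth_const]) (auto simp: rep)

lemma smooth_in_linear: "bounded_linear L \<Longrightarrow> smooth_in (ind M) c W f \<Longrightarrow> smooth_in (ind M) c W (\<lambda>x. L (f x))"
  unfolding smooth_in_iff
  by (drule (1) m.smooth_linear, erule m.smooth_cong) (auto simp: rep)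

text \<open>Extension by zero makes equality in \<open>A\<close> the same as equality on
  \<open>W\<close>, so that identities can be stated in the ring of all functions.\<close>

definition A :: "('a \<Rightarrow> complex) set" where
  "A = {f. (\<forall>x. x \<notin> W \<longrightarrow> f x = 0) \<and> smooth_in (ind M) c W f}"

text \<open>The parameter \<sigma> is that of \<open>wop\<close>. The value zero for indices outside
  \<open>ind M\<close> reduces the sums over the whole index type in the abstract calculus to sums
  over \<open>ind M\<close>.\<close>

definition pd :: "complex \<Rightarrow> 'n \<Rightarrow> ('a \<Rightarrow> complex) \<Rightarrow> 'a \<Rightarrow> complex" where
  "pd \<sigma> i f x = (if x \<in> W \<and> i \<in> ind M then wop \<sigma> i (local_rep c f) (snd c x) else 0)"

lemma pd_dz: "x \<in> W \<Longrightarrow> i \<in> ind M \<Longrightarrow> pd 1 i f x = dz c i f x"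
  and pd_dzbar: "x \<in> W \<Longrightarrow> i \<in> ind M \<Longrightarrow> pd (-1) i f x = dzbar c i f x"
  by (simp_all add: pd_def dz_def dzbar_def wirtinger_wop)

lemma pd_cong:
  assumes "\<And>x. x \<in> W \<Longrightarrow> f x = g x"
  shows "pd \<sigma> i f = pd \<sigma> i g"
proof
  fix x
  show "pd \<sigma> i f x = pd \<sigma> i g x"
  proof (cases "x \<in> W \<and> i \<in> ind M")
    case True
    then show ?thesis
      unfolding pd_def using assms by (auto intro!: m.wop_cong simp: rep)
  qed (auto simp: pd_def)
qed

lemma rep_pd: "z \<in> snd c ` W \<Longrightarrow> i \<in> ind M \<Longrightarrow> local_rep c (pd \<sigma> i f) z = wop \<sigma> i (local_rep c f) z"
  by (auto simp: rep pd_def)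

lemma smooth_A: "f \<in> A \<Longrightarrow> m.smooth (local_rep c f)"
  by (simp add: A_def smooth_in_iff)

lemma A_I: "(\<And>x. x \<notin> W \<Longrightarrow> f x = 0) \<Longrightarrow> smooth_in (ind M) c W f \<Longrightarrow> f \<in> A"
  by (simp add: A_def)

lemma A_smooth: "f \<in> A \<Longrightarrow> smooth_in (ind M) c W f"
  and A_zero: "f \<in> A \<Longrightarrow> x \<notin> W \<Longrightarrow> f x = 0"
  by (simp_all add: A_def)

lemma pd_A: "f \<in> A \<Longrightarrow> pd \<sigma> i f \<in> A"
proof (rule A_I)
  assume f: "f \<in> A"
  show "smooth_in (ind M) c W (pd \<sigma> i f)"
  proof (cases "i \<in> ind M")
    case True
    show ?thesis
      unfolding smooth_in_iff
      by (rule m.smooth_cong[OF m.smooth_wop[OF smooth_A[OF f] True]]) (rule rep_pd[OF _ True])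
  next
    case False
    then show ?thesis
      by (intro smooth_in_cong[OF smooth_in_const[of 0]]) (simp add: pd_def)
  qed
qed (simp add: pd_def)

lemma pd_commute:
  assumes f: "f \<in> A"
  shows "pd \<sigma> i (pd \<tau> j f) = pd \<tau> j (pd \<sigma> i f)"
proof
  fix x
  have zero: "pd \<sigma> i (pd \<tau> j f) x = 0" if "j \<notin> ind M" for i j \<sigma> \<tau>
  proof -
    have "pd \<tau> j f = (\<lambda>x. 0)"
      using that by (auto simp: pd_def)
    moreover have "pd \<sigma> i (\<lambda>x. 0) x = wop \<sigma> i (\<lambda>z. 0) (snd c x)" if "x \<in> W" "i \<in> ind M"
      using that by (auto simp: pd_def rep intro!: m.wop_cong)
    ultimately show ?thesis
      by (cases "x \<in> W \<and> i \<in> ind M") (auto simp: m.wop_const, auto simp: pd_def)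
  qed
  show "pd \<sigma> i (pd \<tau> j f) x = pd \<tau> j (pd \<sigma> i f) x"
  proof (cases "x \<in> W \<and> i \<in> ind M \<and> j \<in> ind M")
    case True
    then have "pd \<sigma> i (pd \<tau> j f) x = wop \<sigma> i (wop \<tau> j (local_rep c f)) (snd c x)"
      and "pd \<tau> j (pd \<sigma> i f) x = wop \<tau> j (wop \<sigma> i (local_rep c f)) (snd c x)"
      unfolding pd_def[of \<sigma> i "pd \<tau> j f"] pd_def[of \<tau> j "pd \<sigma> i f"]
      by (auto intro!: m.wop_cong rep_pd)
    then show ?thesis
      using m.wop_commute[OF smooth_A[OF f]] True by simp
  next
    case False
    then show ?thesis
      using zero[of j \<sigma> i \<tau>] zero[of i \<tau> j \<sigma>] by (auto simp: pd_def)
  qed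
qed

lemma derivations: "derivation_algebra A (pd \<sigma>)"
proof
  show "(0 :: 'a \<Rightarrow> complex) \<in> A"
    by (rule A_I) (auto intro: smooth_in_cong[OF smooth_in_const[of 0]])
  fix f g :: "'a \<Rightarrow> complex" and i j
  assume f: "f \<in> A"
  show "- f \<in> A"
    by (rule A_I) (use f in \<open>auto intro: smooth_in_cong[OF smooth_in_linear[OF bounded_linear_minus[OF bounded_linear_ident] A_smooth]] simp: A_zero\<close>)
  show "pd \<sigma> i f \<in> A"
    by (rule pd_A[OF f])
  show "pd \<sigma> i (pd \<sigma> j f) = pd \<sigma> j (pd \<sigma> i f)"
    by (rule pd_commute[OF f])
  assume g: "g \<in> A"
  show "f + g \<in> A"
    by (rule A_I) (use f g in \<open>auto intro: smooth_in_cong[OF smooth_in_add] A_smooth simp: A_zero\<close>)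
  show "f * g \<in> A"
    by (rule A_I) (use f g in \<open>auto intro: smooth_in_cong[OF smooth_in_mult] A_smooth simp: A_zero\<close>)
  show "pd \<sigma> i (f + g) = pd \<sigma> i f + pd \<sigma> i g"
  proof
    fix x
    have "wop \<sigma> i (local_rep c (f + g)) (snd c x) = wop \<sigma> i (\<lambda>z. local_rep c f z + local_rep c g z) (snd c x)"
      if "x \<in> W" "i \<in> ind M"
      by (rule m.wop_cong) (use that in \<open>auto simp: rep\<close>)
    then show "pd \<sigma> i (f + g) x = (pd \<sigma> i f + pd \<sigma> i g) x"
      using m.wop_add[OF smooth_A[OF f] smooth_A[OF g]] by (simp add: pd_def)
  qed
  show "pd \<sigma> i (f * g) = pd \<sigma> i f * g + f * pd \<sigma> i g"
  proof
    fix x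
    have "wop \<sigma> i (local_rep c (f * g)) (snd c x) = wop \<sigma> i (\<lambda>z. local_rep c f z * local_rep c g z) (snd c x)"
      if "x \<in> W" "i \<in> ind M"
      by (rule m.wop_cong) (use that in \<open>auto simp: rep\<close>)
    then show "pd \<sigma> i (f * g) x = (pd \<sigma> i f * g + f * pd \<sigma> i g) x"
      using m.wop_mult[OF smooth_A[OF f] smooth_A[OF g]] by (simp add: pd_def rep)
  qed
qed

lemma cnj_A: "f \<in> A \<Longrightarrow> (\<lambda>x. cnj (f x)) \<in> A"
  by (rule A_I) (auto simp: A_zero intro: smooth_in_linear[OF bounded_linear_cnj] A_smooth)

lemma pd_cnj:
  assumes "f \<in> A" "cnj \<sigma> = \<sigma>"
  shows "pd \<sigma> i (\<lambda>x. cnj (f x)) x = cnj (pd (- \<sigma>) i f x)"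
proof -
  have "wop \<sigma> i (local_rep c (\<lambda>x. cnj (f x))) (snd c x) = wop \<sigma> i (\<lambda>z. cnj (local_rep c f z)) (snd c x)"
    if "x \<in> W" "i \<in> ind M"
    by (rule m.wop_cong) (use that in \<open>auto simp: rep\<close>)
  then show ?thesis
    using m.wop_cnj[OF smooth_A[OF assms(1)]] assms(2) by (simp add: pd_def)
qed

lemma cmult_A: "f \<in> A \<Longrightarrow> (\<lambda>x. k) * f \<in> A"
  by (rule A_I) (auto simp: A_zero times_fun_def intro: smooth_in_mult smooth_in_const A_smooth)

lemma smooth_in_subset:
  assumes "openin (top_of M) V" "V \<subseteq> W" "smooth_in (ind M) c W f"
  shows "smooth_in (ind M) c V f"
proof -
  interpret V: chart_domain M c V
    by unfold_locales (use c assms Wc in auto)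
  show ?thesis
    using m.smooth_subset[OF V.m.opn _ assms(3)[unfolded smooth_in_iff]] assms(2)
    by (auto simp: V.smooth_in_iff)
qed

lemma smooth_in_local:
  assumes "\<And>x. x \<in> W \<Longrightarrow> \<exists>V. openin (top_of M) V \<and> x \<in> V \<and> V \<subseteq> W \<and> smooth_in (ind M) c V f"
  shows "smooth_in (ind M) c W f"
  unfolding smooth_in_iff
proof (rule m.smooth_local)
  fix z assume "z \<in> snd c ` W"
  then obtain x where x: "x \<in> W" "z = snd c x" by blast
  obtain V where V: "openin (top_of M) V" "x \<in> V" "V \<subseteq> W" "smooth_in (ind M) c V f"
    using assms x by blast
  interpret V: chart_domain M c V
    by unfold_locales (use c V Wc in auto)
  show "\<exists>V. model_open (ind M) V \<and> z \<in> V \<and> V \<subseteq> snd c ` W \<and> model_set.smooth (ind M) V (local_rep c f)"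
    using V V.m.opn x by (intro exI[of _ "snd c ` V"]) (auto simp: V.smooth_in_iff)
qed

definition res :: "('a \<Rightarrow> complex) \<Rightarrow> 'a \<Rightarrow> complex" where
  "res f x = (if x \<in> W then f x else 0)"

lemma res_A: "smooth_in (ind M) c W f \<Longrightarrow> res f \<in> A"
  by (rule A_I) (auto simp: res_def intro: smooth_in_cong)

lemma pd_res: "pd \<sigma> i (res f) = pd \<sigma> i f"
  by (rule pd_cong) (simp add: res_def)

end

section \<open>Change of charts\<close>

locale chart_change = cmfd M for M :: "('a, 'n::finite) cmanifold" +
  fixes c c' :: "('a, 'n) chart" and W :: "'a set"
  assumes cc: "c \<in> atlas M" "c' \<in> atlas M" and Wop: "openin (top_of M) W"
    and Wcc: "W \<subseteq> dom_of c \<inter> dom_of c'"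
begin

sublocale X: chart_domain M c W
  by unfold_locales (use cc Wop Wcc in auto)

sublocale Y: chart_domain M c' W
  by unfold_locales (use cc Wop Wcc in auto)

lemma overlap_domain: "chart_domain M c (dom_of c \<inter> dom_of c')"
  by unfold_locales (use cc in \<open>auto intro: openin_Int chart_open\<close>)

lemma smooth_coord: "smooth_in (ind M) c W (coord c' a)"
proof (cases "a \<in> ind M")
  case True
  interpret O: chart_domain M c "dom_of c \<inter> dom_of c'"
    by (rule overlap_domain)
  show ?thesis
    using transition[OF cc True] O.smooth_in_subset[OF Wop Wcc] by (simp add: holomorphic_in_def)
next
  case False
  then show ?thesis
    using Wcc chart_model[OF cc(2)] by (intro X.smooth_in_cong[OF X.smooth_in_const[of 0]]) auto
qed

definition \<xi> :: "'n \<Rightarrow> 'a \<Rightarrow> complex" where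
  "\<xi> a = X.res (coord c' a)"

definition Jac :: "'n \<Rightarrow> 'n \<Rightarrow> 'a \<Rightarrow> complex" where
  "Jac a i = X.pd 1 i (\<xi> a)"

text \<open>By holomorphy of the transition map, the Jacobian of the conjugate coordinates.\<close>

definition Jbar :: "'n \<Rightarrow> 'n \<Rightarrow> 'a \<Rightarrow> complex" where
  "Jbar a i x = cnj (Jac a i x)"

lemma \<xi>_A: "\<xi> a \<in> X.A"
  unfolding \<xi>_def by (rule X.res_A[OF smooth_coord])

lemma \<xi>_hol: "X.pd (-1) i (\<xi> a) = 0"
proof
  fix x
  show "X.pd (-1) i (\<xi> a) x = 0 x"
  proof (cases "x \<in> W \<and> i \<in> ind M \<and> a \<in> ind M")
    case True
    then have "dzbar c i (coord c' a) x = 0"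
      using transition[OF cc, of a] Wcc by (auto simp: holomorphic_in_def)
    then show ?thesis
      using True X.pd_dzbar[of x i "coord c' a"] by (simp add: \<xi>_def X.pd_res)
  next
    case False
    show ?thesis
    proof (cases "a \<in> ind M")
      case True
      then show ?thesis using False by (auto simp: X.pd_def)
    next
      case False
      then have "\<xi> a = 0"
        using Wcc chart_model[OF cc(2)] by (auto simp: \<xi>_def X.res_def fun_eq_iff)
      interpret D: derivation_algebra X.A "X.pd (-1)"
        by (rule X.derivations)
      show ?thesis
        using \<open>\<xi> a = 0\<close> by simp
    qed
  qed
qed

lemma Jac_dz: "x \<in> W \<Longrightarrow> i \<in> ind M \<Longrightarrow> Jac a i x = dz c i (coord c' a) x"
  by (simp add: Jac_def \<xi>_def X.pd_res X.pd_dz)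

lemma Jac_zero: "a \<notin> ind M \<or> i \<notin> ind M \<or> x \<notin> W \<Longrightarrow> Jac a i x = 0"
proof (cases "a \<in> ind M")
  case False
  then have "\<xi> a = 0"
    using Wcc chart_model[OF cc(2)] by (auto simp: \<xi>_def X.res_def fun_eq_iff)
  interpret D: derivation_algebra X.A "X.pd 1"
    by (rule X.derivations)
  show ?thesis
    using \<open>\<xi> a = 0\<close> by (simp add: Jac_def)
qed (auto simp: Jac_def X.pd_def)

lemma Jac_A: "Jac a i \<in> X.A"
  unfolding Jac_def by (rule X.pd_A[OF \<xi>_A])

lemma Jbar_A: "Jbar a i \<in> X.A"
  unfolding Jbar_def by (rule X.cnj_A[OF Jac_A])

text \<open>Derivatives commute, and the coordinates are already killed by the conjugate
  derivation.\<close>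

lemma pdbar_Jac: "X.pd (-1) j (Jac a i) = 0"
proof -
  interpret D: derivation_algebra X.A "X.pd 1"
    by (rule X.derivations)
  show ?thesis
    unfolding Jac_def X.pd_commute[OF \<xi>_A, of "-1"] \<xi>_hol by simp
qed

lemma pd_Jbar: "X.pd 1 j (Jbar a i) = 0"
proof
  fix x
  show "X.pd 1 j (Jbar a i) x = 0 x"
    unfolding Jbar_def X.pd_cnj[OF Jac_A complex_cnj_one] pdbar_Jac by simp
qed

text \<open>The representative of \<open>f\<close> in \<open>c\<close> is the one in
  \<open>c'\<close> composed with the transition map.\<close>

lemma smooth_transfer:
  assumes "smooth_in (ind M) c' W f"
  shows "smooth_in (ind M) c W f"
proof -
  let ?\<phi> = "\<lambda>z. snd c' (inv_into (dom_of c) (snd c) z)"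
  have \<phi>: "?\<phi> (snd c x) = snd c' x" if "x \<in> W" for x
    by (simp add: inv_into_f_f chart_inj[OF cc(1)] subsetD[OF X.Wc that])
  have "X.m.smooth (\<lambda>z. local_rep c' f (?\<phi> z))"
  proof (rule X.m.smooth_compose[OF Y.m.opn])
    show "?\<phi> ` snd c ` W \<subseteq> snd c' ` W"
      using \<phi> by auto
    show "X.m.smooth (\<lambda>z. ?\<phi> z $ a)" for a
      using smooth_coord[of a] by (simp add: X.smooth_in_iff local_rep_def o_def)
    show "model_set.smooth (ind M) (snd c' ` W) (local_rep c' f)"
      using assms by (simp add: Y.smooth_in_iff)
  qed
  then show ?thesis
    unfolding X.smooth_in_iff by (rule X.m.smooth_cong) (auto simp: \<phi> X.rep Y.rep)
qed

text \<open>The general chain rule for Wirtinger operators has two terms; one of them carries a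
  conjugate derivative of a holomorphic transition function and disappears.\<close>

lemma chain_rule:
  assumes f: "f \<in> Y.A"
  shows "X.pd 1 i f = (\<Sum>a\<in>UNIV. Jac a i * Y.pd 1 a f)"
    and "X.pd (-1) i f = (\<Sum>a\<in>UNIV. Jbar a i * Y.pd (-1) a f)"
proof -
  let ?\<phi> = "\<lambda>z. snd c' (inv_into (dom_of c) (snd c) z)"
  have \<phi>: "?\<phi> (snd c x) = snd c' x" if "x \<in> W" for x
    by (simp add: inv_into_f_f chart_inj[OF cc(1)] subsetD[OF X.Wc that])
  have coord: "(\<lambda>z. ?\<phi> z $ a) = local_rep c (coord c' a)" for a
    by (simp add: local_rep_def o_def)
  have main: "X.pd \<sigma> i f x = (\<Sum>a\<in>ind M. X.pd \<sigma> i (\<xi> a) x * Y.pd 1 a f x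
      + cnj (X.pd (- \<sigma>) i (\<xi> a) x) * Y.pd (-1) a f x)" if xi: "x \<in> W" "i \<in> ind M" and \<sigma>: "cnj \<sigma> = \<sigma>" for \<sigma> x
  proof -
    have "X.pd \<sigma> i f x = wop \<sigma> i (\<lambda>z. local_rep c' f (?\<phi> z)) (snd c x)"
      unfolding X.pd_def using xi by (auto intro!: X.m.wop_cong simp: X.rep \<phi> Y.rep)
    also have "\<dots> = (\<Sum>a\<in>ind M. wop \<sigma> i (\<lambda>z. ?\<phi> z $ a) (snd c x) * wop 1 a (local_rep c' f) (?\<phi> (snd c x))
        + cnj (wop (- \<sigma>) i (\<lambda>z. ?\<phi> z $ a) (snd c x)) * wop (-1) a (local_rep c' f) (?\<phi> (snd c x)))"
    proof (rule X.m.wop_compose[OF Y.m.opn])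
      show "?\<phi> ` snd c ` W \<subseteq> snd c' ` W"
        using \<phi> by auto
      show "X.m.smooth (\<lambda>z. ?\<phi> z $ a)" for a
        using smooth_coord[of a] by (simp add: X.smooth_in_iff local_rep_def o_def)
      show "model_set.smooth (ind M) (snd c' ` W) (local_rep c' f)"
        by (rule Y.smooth_A[OF f])
    qed (use xi \<sigma> in auto)
    also have "\<dots> = (\<Sum>a\<in>ind M. X.pd \<sigma> i (\<xi> a) x * Y.pd 1 a f x
      + cnj (X.pd (- \<sigma>) i (\<xi> a) x) * Y.pd (-1) a f x)"
      using xi by (simp add: \<xi>_def X.pd_res coord \<phi>) (simp add: X.pd_def Y.pd_def)
    finally show ?thesis .
  qed
  have sum_apply: "(\<Sum>a\<in>UNIV. g a) x = (\<Sum>a\<in>UNIV. g a x)" for g :: "'n \<Rightarrow> 'a \<Rightarrow> complex" and x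
    by (induction rule: finite_induct[OF finite]) auto
  show "X.pd 1 i f = (\<Sum>a\<in>UNIV. Jac a i * Y.pd 1 a f)"
  proof
    fix x
    have "(\<Sum>a\<in>UNIV. Jac a i x * Y.pd 1 a f x) = (\<Sum>a\<in>ind M. Jac a i x * Y.pd 1 a f x)"
      by (rule sum.mono_neutral_right) (auto simp: Jac_zero)
    then show "X.pd 1 i f x = (\<Sum>a\<in>UNIV. Jac a i * Y.pd 1 a f) x"
    proof (cases "x \<in> W \<and> i \<in> ind M")
      case True
      then show ?thesis
        using main[of x 1] \<open>(\<Sum>a\<in>UNIV. Jac a i x * Y.pd 1 a f x) = _\<close>
        by (simp add: sum_apply \<xi>_hol Jac_def)
    qed (auto simp: sum_apply Jac_zero X.pd_def)
  qed
  show "X.pd (-1) i f = (\<Sum>a\<in>UNIV. Jbar a i * Y.pd (-1) a f)"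
  proof
    fix x
    have "(\<Sum>a\<in>UNIV. Jbar a i x * Y.pd (-1) a f x) = (\<Sum>a\<in>ind M. Jbar a i x * Y.pd (-1) a f x)"
      by (rule sum.mono_neutral_right) (auto simp: Jac_zero Jbar_def)
    then show "X.pd (-1) i f x = (\<Sum>a\<in>UNIV. Jbar a i * Y.pd (-1) a f) x"
    proof (cases "x \<in> W \<and> i \<in> ind M")
      case True
      then show ?thesis
        using main[of x "-1"] \<open>(\<Sum>a\<in>UNIV. Jbar a i x * Y.pd (-1) a f x) = _\<close>
        by (simp add: sum_apply \<xi>_hol Jac_def Jbar_def)
    qed (auto simp: sum_apply Jac_zero Jbar_def X.pd_def)
  qed
qed

lemma swapped: "chart_change M c' c W"
  by unfold_locales (use cc Wop Wcc in auto)

text \<open>Lets the derivations of both charts act on one algebra, as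
  \<open>coordinate_change\<close> requires.\<close>

lemma A_eq: "X.A = Y.A"
proof -
  interpret S: chart_change M c' c W by (rule swapped)
  show ?thesis
    unfolding X.A_def Y.A_def using smooth_transfer S.smooth_transfer by blast
qed

lemma change: "coordinate_change X.A (X.pd 1) (Y.pd 1) Jac"
  and change_bar: "coordinate_change X.A (X.pd (-1)) (Y.pd (-1)) Jbar"
proof -
  show "coordinate_change X.A (X.pd 1) (Y.pd 1) Jac"
    unfolding coordinate_change_def coordinate_change_axioms_def
  proof (intro conjI allI impI)
    show "derivation_algebra X.A (X.pd 1)" by (rule X.derivations)
    show "derivation_algebra X.A (Y.pd 1)" unfolding A_eq by (rule Y.derivations)
    show "X.pd 1 i (Jac a j) = X.pd 1 j (Jac a i)" for a i j
      unfolding Jac_def by (rule X.pd_commute[OF \<xi>_A])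
    show "X.pd 1 i f = (\<Sum>a\<in>UNIV. Jac a i * Y.pd 1 a f)" if "f \<in> X.A" for i f
      using chain_rule(1) that by (simp add: A_eq)
  qed (rule Jac_A)
  show "coordinate_change X.A (X.pd (-1)) (Y.pd (-1)) Jbar"
    unfolding coordinate_change_def coordinate_change_axioms_def
  proof (intro conjI allI impI)
    show "derivation_algebra X.A (X.pd (-1))" by (rule X.derivations)
    show "derivation_algebra X.A (Y.pd (-1))" unfolding A_eq by (rule Y.derivations)
    show "X.pd (-1) i (Jbar a j) = X.pd (-1) j (Jbar a i)" for a i j
    proof
      fix x
      show "X.pd (-1) i (Jbar a j) x = X.pd (-1) j (Jbar a i) x"
        unfolding Jbar_def
        by (subst (1 2) X.pd_cnj[OF Jac_A]) (auto simp: Jac_def X.pd_commute[OF \<xi>_A, of 1 i 1 j])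
    qed
    show "X.pd (-1) i f = (\<Sum>a\<in>UNIV. Jbar a i * Y.pd (-1) a f)" if "f \<in> X.A" for i f
      using chain_rule(2) that by (simp add: A_eq)
  qed (rule Jbar_A)
qed

end

section \<open>The Poisson bivector in a chart\<close>

lemma sum_fun_apply: "(sum f B :: 'a \<Rightarrow> 'b::comm_monoid_add) x = (\<Sum>a\<in>B. f a x)"
  by (induction B rule: infinite_finite_induct) auto

locale poisson_mfd =
  fixes M :: "('a, 'n::finite) cmanifold" and \<pi> :: "('a, 'n) bivector"
  assumes hpm: "holomorphic_poisson_manifold M \<pi>"
begin

sublocale cmfd M
  by unfold_locales (use hpm in \<open>simp add: holomorphic_poisson_manifold_def\<close>)

lemma bivector: "holomorphic_bivector M \<pi>"
  using hpm by (simp add: holomorphic_poisson_manifold_def)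

lemma \<pi>_transform:
  assumes "c \<in> atlas M" "c' \<in> atlas M" "x \<in> dom_of c" "x \<in> dom_of c'" "a \<in> ind M" "b \<in> ind M"
  shows "\<pi> c' x a b = (\<Sum>i\<in>ind M. \<Sum>j\<in>ind M. \<pi> c x i j * dz c i (coord c' a) x * dz c j (coord c' b) x)"
  using bivector assms unfolding holomorphic_bivector_def by blast

end

locale poisson_chart = poisson_mfd M \<pi> + chart_domain M c W
  for M :: "('a, 'n::finite) cmanifold" and \<pi> c W
begin

definition P :: "'n \<Rightarrow> 'n \<Rightarrow> 'a \<Rightarrow> complex" where
  "P a b x = (if x \<in> W \<and> a \<in> ind M \<and> b \<in> ind M then \<pi> c x a b else 0)"

lemma P_res: "a \<in> ind M \<Longrightarrow> b \<in> ind M \<Longrightarrow> P a b = res (\<lambda>x. \<pi> c x a b)"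
  and P_zero: "\<not> (a \<in> ind M \<and> b \<in> ind M) \<Longrightarrow> P a b = 0"
  by (auto simp: P_def res_def fun_eq_iff)

lemma whole: "chart_domain M c (dom_of c)"
  by unfold_locales (use c chart_open in auto)

lemma \<pi>_hol: "a \<in> ind M \<Longrightarrow> b \<in> ind M \<Longrightarrow> holomorphic_in (ind M) c (dom_of c) (\<lambda>x. \<pi> c x a b)"
  using bivector c unfolding holomorphic_bivector_def by blast

lemma P_A: "P a b \<in> A"
proof (cases "a \<in> ind M \<and> b \<in> ind M")
  case True
  interpret D: chart_domain M c "dom_of c" by (rule whole)
  show ?thesis
    using \<pi>_hol[of a b] True D.smooth_in_subset[OF W Wc]
    by (simp add: P_res res_A holomorphic_in_def)
next
  case False
  interpret D: derivation_algebra A "pd 1" by (rule derivations)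
  show ?thesis
    using False by (simp add: P_zero)
qed

lemma P_antisym: "P b a = - P a b"
proof
  fix x
  have "\<pi> c x b a = - \<pi> c x a b" if "x \<in> W" "a \<in> ind M" "b \<in> ind M"
    using bivector c Wc that unfolding holomorphic_bivector_def by blast
  then show "P b a x = (- P a b) x"
    by (auto simp: P_def)
qed

lemma pdbar_P: "pd (-1) j (P a b) = 0"
proof (cases "a \<in> ind M \<and> b \<in> ind M")
  case True
  show ?thesis
  proof
    fix x
    have "dzbar c j (\<lambda>x. \<pi> c x a b) x = 0" if "x \<in> W" "j \<in> ind M"
      using \<pi>_hol[of a b] True that Wc unfolding holomorphic_in_def by blast
    then show "pd (-1) j (P a b) x = 0 x"
      using True pd_dzbar[of x j "\<lambda>x. \<pi> c x a b"] by (auto simp: P_res pd_res) (auto simp: pd_def)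
  qed
next
  case False
  interpret D: derivation_algebra A "pd (-1)" by (rule derivations)
  show ?thesis
    using False by (simp add: P_zero)
qed

text \<open>\<open>poisson_bracket\<close> chooses a chart at every point. The transformation law of
  \<pi> and the chain rule for \<open>f\<close> and \<open>g\<close> involve the same Jacobian
  factors, so the chart \<open>c\<close> may be used instead.\<close>

lemma bracket_eq:
  assumes f: "f \<in> hol_functions M W" and g: "g \<in> hol_functions M W" and x: "x \<in> W"
  shows "poisson_bracket M \<pi> W f g x = (\<Sum>i\<in>ind M. \<Sum>j\<in>ind M. \<pi> c x i j * dz c i f x * dz c j g x)"
proof -
  define c0 where "c0 = (SOME c. c \<in> atlas M \<and> x \<in> dom_of c)"
  have "\<exists>c. c \<in> atlas M \<and> x \<in> dom_of c"
    using c x Wc by blast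
  then have c0: "c0 \<in> atlas M" "x \<in> dom_of c0"
    unfolding c0_def by (metis (mono_tags, lifting) someI_ex)+
  interpret X: chart_change M c c0 "W \<inter> dom_of c0"
    by unfold_locales (use c c0 W Wc in \<open>auto intro: openin_Int chart_open\<close>)
  have xW: "x \<in> W \<inter> dom_of c0" and xc: "x \<in> dom_of c"
    using x c0 Wc by auto
  have chain: "dz c i f x = (\<Sum>a\<in>ind M. dz c i (coord c0 a) x * dz c0 a f x)"
    if f: "f \<in> hol_functions M W" and i: "i \<in> ind M" for f i
  proof -
    have "X.Y.res f \<in> X.Y.A"
      using f c0 by (intro X.Y.res_A) (auto simp: hol_functions_def holomorphic_in_def)
    from X.chain_rule(1)[OF this, of i]
    have "X.X.pd 1 i f x = (\<Sum>a\<in>UNIV. X.Jac a i x * X.Y.pd 1 a f x)"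
      unfolding X.X.pd_res X.Y.pd_res
      by (simp add: sum_fun_apply)
    also have "\<dots> = (\<Sum>a\<in>ind M. X.Jac a i x * X.Y.pd 1 a f x)"
      by (rule sum.mono_neutral_right) (auto simp: X.Jac_zero)
    finally show ?thesis
      using xW i by (simp add: X.X.pd_dz X.Y.pd_dz X.Jac_dz)
  qed
  have "poisson_bracket M \<pi> W f g x = (\<Sum>a\<in>ind M. \<Sum>b\<in>ind M. \<pi> c0 x a b * dz c0 a f x * dz c0 b g x)"
    using x by (simp add: poisson_bracket_def c0_def Let_def)
  also have "\<dots> = (\<Sum>a\<in>ind M. \<Sum>b\<in>ind M. \<Sum>i\<in>ind M. \<Sum>j\<in>ind M.
      \<pi> c x i j * (dz c i (coord c0 a) x * dz c0 a f x) * (dz c j (coord c0 b) x * dz c0 b g x))"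
    by (simp add: \<pi>_transform[OF c c0(1) xc c0(2)] sum_distrib_right sum_distrib_left mult_ac)
  also have "\<dots> = (\<Sum>i\<in>ind M. \<Sum>j\<in>ind M. \<Sum>a\<in>ind M. \<Sum>b\<in>ind M.
      \<pi> c x i j * (dz c i (coord c0 a) x * dz c0 a f x) * (dz c j (coord c0 b) x * dz c0 b g x))"
    by (rule sum4_swap)
  also have "\<dots> = (\<Sum>i\<in>ind M. \<Sum>j\<in>ind M. \<pi> c x i j * dz c i f x * dz c j g x)"
    by (intro sum.cong refl) (simp add: chain[OF f] chain[OF g] sum_distrib_left sum_distrib_right mult_ac)
  finally show ?thesis .
qed

text \<open>Coordinates as elements of \<open>hol_functions M W\<close>: the Jacobi identity is
  given only for such functions.\<close>

definition z_fun :: "'n \<Rightarrow> 'a \<Rightarrow> complex" where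
  "z_fun i = res (coord c i)"

text \<open>Holomorphy has to be checked in every chart of the atlas, where it is holomorphy of the
  transition map to \<open>c\<close>.\<close>

lemma z_fun_hol:
  assumes j: "j \<in> ind M"
  shows "z_fun j \<in> hol_functions M W"
  unfolding hol_functions_def
proof (intro CollectI conjI ballI allI impI)
  fix c' assume c': "c' \<in> atlas M"
  interpret X: chart_change M c' c "W \<inter> dom_of c'"
    by unfold_locales (use c c' W Wc in \<open>auto intro: openin_Int chart_open\<close>)
  have eq: "coord c j x = z_fun j x" if "x \<in> W \<inter> dom_of c'" for x
    using that by (simp add: z_fun_def res_def)
  have "smooth_in (ind M) c' (W \<inter> dom_of c') (z_fun j)"
    by (rule X.X.smooth_in_cong[OF X.smooth_coord[of j]]) (simp add: eq)
  moreover have "dzbar c' i (z_fun j) x = 0" if "i \<in> ind M" "x \<in> W \<inter> dom_of c'" for i x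
  proof -
    have "X.\<xi> j x = z_fun j x" if "x \<in> W \<inter> dom_of c'" for x
      using eq[OF that] that by (simp add: X.\<xi>_def X.X.res_def)
    then have "X.X.pd (-1) i (z_fun j) x = 0"
      using X.X.pd_cong[of "X.\<xi> j" "z_fun j" "-1" i] X.\<xi>_hol[of i j] by simp
    then show ?thesis
      using X.X.pd_dzbar that by simp
  qed
  ultimately show "holomorphic_in (ind M) c' (W \<inter> dom_of c') (z_fun j)"
    by (simp add: holomorphic_in_def)
qed (simp add: z_fun_def res_def)

lemma pd_z_fun: "x \<in> W \<Longrightarrow> i \<in> ind M \<Longrightarrow> dz c i (z_fun j) x = (if j = i then 1 else 0)"
proof -
  assume xi: "x \<in> W" "i \<in> ind M"
  have "dz c i (z_fun j) x = pd 1 i (coord c j) x"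
    using xi pd_dz[of x i "z_fun j"] by (simp add: z_fun_def pd_res)
  also have "\<dots> = wop 1 i (\<lambda>z. z $ j) (snd c x)"
    using xi unfolding pd_def by (auto intro!: m.wop_cong simp: rep)
  finally show ?thesis
    using xi m.wop_nth[of "snd c x" i 1 j] by simp
qed

lemma bracket_z_fun:
  assumes jk: "j \<in> ind M" "k \<in> ind M"
  shows "poisson_bracket M \<pi> W (z_fun j) (z_fun k) = P j k"
proof
  fix x
  show "poisson_bracket M \<pi> W (z_fun j) (z_fun k) x = P j k x"
  proof (cases "x \<in> W")
    case True
    have "poisson_bracket M \<pi> W (z_fun j) (z_fun k) x
        = (\<Sum>a\<in>ind M. \<Sum>b\<in>ind M. if k = b then (if j = a then \<pi> c x a b else 0) else 0)"
      unfolding bracket_eq[OF z_fun_hol[OF jk(1)] z_fun_hol[OF jk(2)] True]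
      by (intro sum.cong refl) (simp add: pd_z_fun[OF True])
    then show ?thesis
      using jk True by (simp add: P_def)
  qed (simp add: poisson_bracket_def P_def)
qed

lemma bracket_z_fun_P:
  assumes ijk: "i \<in> ind M" "j \<in> ind M" "k \<in> ind M"
  shows "poisson_bracket M \<pi> W (z_fun i) (P j k) = - (\<Sum>a\<in>UNIV. P a i * pd 1 a (P j k))"
proof
  fix x
  have alg: "poisson_algebra (hol_functions M W) (poisson_bracket M \<pi> W)"
    using hpm W by (simp add: holomorphic_poisson_manifold_def)
  \<comment> \<open>As a bracket of two coordinate functions, \<open>P j k\<close> is holomorphic in
    every chart, because the Poisson algebra is closed under its bracket.\<close>
  have hol: "P j k \<in> hol_functions M W"
    using alg z_fun_hol[OF ijk(2)] z_fun_hol[OF ijk(3)] bracket_z_fun[OF ijk(2,3)]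
    unfolding poisson_algebra_def by metis
  show "poisson_bracket M \<pi> W (z_fun i) (P j k) x = (- (\<Sum>a\<in>UNIV. P a i * pd 1 a (P j k))) x"
  proof (cases "x \<in> W")
    case True
    have "poisson_bracket M \<pi> W (z_fun i) (P j k) x
        = (\<Sum>a\<in>ind M. \<Sum>b\<in>ind M. if i = a then P a b x * pd 1 b (P j k) x else 0)"
      unfolding bracket_eq[OF z_fun_hol[OF ijk(1)] hol True]
      by (intro sum.cong refl) (simp add: pd_z_fun[OF True] P_def pd_dz True)
    also have "\<dots> = (\<Sum>b\<in>ind M. P i b x * pd 1 b (P j k) x)"
      using ijk by (subst sum.swap) simp
    also have "\<dots> = (\<Sum>b\<in>UNIV. P i b x * pd 1 b (P j k) x)"
      by (rule sum.mono_neutral_left) (auto simp: pd_def)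
    also have "\<dots> = (\<Sum>b\<in>UNIV. - (P b i x * pd 1 b (P j k) x))"
      by (rule sum.cong[OF refl], subst P_antisym) simp
    finally show ?thesis
      by (simp add: sum_fun_apply sum_negf)
  qed (simp add: poisson_bracket_def P_def sum_fun_apply)
qed

text \<open>Read off from three coordinate functions; an index outside \<open>ind M\<close> makes
  every summand zero.\<close>

lemma jacobi_P: "(\<Sum>a\<in>UNIV. P a i * pd 1 a (P j k)) + (\<Sum>a\<in>UNIV. P a j * pd 1 a (P k i))
   + (\<Sum>a\<in>UNIV. P a k * pd 1 a (P i j)) = 0"
proof (cases "i \<in> ind M \<and> j \<in> ind M \<and> k \<in> ind M")
  case True
  let ?br = "poisson_bracket M \<pi> W"
  have alg: "poisson_algebra (hol_functions M W) ?br"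
    using hpm W by (simp add: holomorphic_poisson_manifold_def)
  have "?br (z_fun i) (?br (z_fun j) (z_fun k)) + ?br (z_fun j) (?br (z_fun k) (z_fun i))
      + ?br (z_fun k) (?br (z_fun i) (z_fun j)) = 0"
    using alg z_fun_hol True unfolding poisson_algebra_def by blast
  then have "- ((\<Sum>a\<in>UNIV. P a i * pd 1 a (P j k)) + (\<Sum>a\<in>UNIV. P a j * pd 1 a (P k i))
      + (\<Sum>a\<in>UNIV. P a k * pd 1 a (P i j))) = 0"
    using True by (simp add: bracket_z_fun bracket_z_fun_P)
  then show ?thesis
    by (simp only: neg_equal_0_iff_equal)
next
  case False
  interpret D: derivation_algebra A "pd 1" by (rule derivations)
  show ?thesis
    using False P_zero by auto
qed

abbreviation half :: "'a \<Rightarrow> complex" where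
  "half \<equiv> (\<lambda>x. 1 / 2)"

sublocale calc: dolbeault_calculus A "pd 1" half P "pd (-1)"
proof -
  interpret D: derivation_algebra A "pd 1" by (rule derivations)
  interpret E: derivation_algebra A "pd (-1)" by (rule derivations)
  show "dolbeault_calculus A (pd 1) half P (pd (-1))"
  proof (unfold_locales, goal_cases)
    case 1
    show ?case by (simp add: fun_eq_iff)
  next
    case (2 f)
    then show ?case by (rule cmult_A)
  next
    case (3 f)
    show ?case
    proof
      fix x
      have "(f + f + f) x = 0"
        by (simp only: 3 zero_fun_apply)
      then show "f x = 0 x" by simp
    qed
  next
    case (4 a b)
    show ?case by (rule P_A)
  next
    case (5 b a)
    show ?case by (rule P_antisym)
  next
    case (6 i j k)
    show ?case by (rule jacobi_P)
  next
    case (7 f i j)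
    then show ?case by (rule pd_commute)
  next
    case (8 j a b)
    show ?case by (rule pdbar_P)
  qed
qed

end

section \<open>Forms\<close>

text \<open>An adjacent exchange is \<open>swap\<close> at consecutive positions; lists of another
  length are harmless because \<open>w\<close> is zero on them.\<close>

lemma alternating_vanish:
  assumes "\<And>r s K. r < s \<Longrightarrow> s < p \<Longrightarrow> length K = p \<Longrightarrow> w (swap r s K) = - w K"
    and "\<And>K. length K \<noteq> p \<Longrightarrow> w K = 0"
  shows "alternating w"
  unfolding alternating_def
proof (intro allI)
  fix xs a b ys
  show "w (xs @ b # a # ys) = - w (xs @ a # b # ys)"
  proof (cases "length (xs @ a # b # ys) = p")
    case True
    have "swap (length xs) (Suc (length xs)) (xs @ a # b # ys) = xs @ b # a # ys"
      by (simp add: swap_def nth_append list_update_append)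
    then show ?thesis
      using assms(1)[of "length xs" "Suc (length xs)" "xs @ a # b # ys"] True by simp
  next
    case False
    then show ?thesis using assms(2) by simp
  qed
qed

lemma pull_index_cong:
  assumes "\<And>a i. i \<in> set I \<Longrightarrow> J a i = J' a i"
  shows "pull J w I = pull J' w I"
  using assms by (induction I arbitrary: w) auto

lemma pull_index_zero: "i \<in> set I \<Longrightarrow> (\<And>a. J a i = 0) \<Longrightarrow> pull J w I = 0"
  by (induction I arbitrary: w) auto

lemma pull_apply: "pull J w I x = pull (\<lambda>a i. J a i x) (\<lambda>A. w A x) I"
  by (induction I arbitrary: w) (auto simp: sum_fun_apply)

lemma pull_swap:
  "pull J (\<lambda>A. pull K (\<lambda>B. v A B) Js) I = pull K (\<lambda>B. pull J (\<lambda>A. v A B) I) Js"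
proof (induction I arbitrary: v)
  case (Cons i I)
  then show ?case by (simp add: pull_mult pull_sum)
qed simp

definition rs :: "'a set \<Rightarrow> ('a, 'n) form \<Rightarrow> ('a, 'n) form" where
  "rs U \<omega> c x is js = (if x \<in> U then \<omega> c x is js else 0)"

lemma restrict_form_rs: "restrict_form U \<omega> p q = rs U (\<omega> p q)"
  by (simp add: restrict_form_def rs_def fun_eq_iff)

context cmfd
begin

text \<open>Each translation into \<open>alternating\<close> and \<open>pull\<close> uses the
  support clause: it extends alternation from lists of length \<open>p\<close> or \<open>q\<close>
  to all lists, and the sums over \<open>multi_ind\<close> to sums over all lists of the given
  length.\<close>

lemma forms_iff:
  "\<omega> \<in> forms M U p q \<longleftrightarrow>
     (\<forall>c x is js. \<not> (c \<in> atlas M \<and> x \<in> U \<inter> dom_of c \<and> is \<in> multi_ind M p \<and> js \<in> multi_ind M q)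
        \<longrightarrow> \<omega> c x is js = 0) \<and>
     (\<forall>c x js. alternating (\<lambda>is. \<omega> c x is js)) \<and> (\<forall>c x is. alternating (\<omega> c x is)) \<and>
     (\<forall>c\<in>atlas M. \<forall>is js. smooth_in (ind M) c (U \<inter> dom_of c) (\<lambda>x. \<omega> c x is js)) \<and>
     (\<forall>c\<in>atlas M. \<forall>c'\<in>atlas M. \<forall>x\<in>U \<inter> dom_of c \<inter> dom_of c'. \<forall>is\<in>multi_ind M p. \<forall>js\<in>multi_ind M q.
        \<omega> c x is js = pull (\<lambda>a i. dz c i (coord c' a) x) (\<lambda>A. pull (\<lambda>a i. cnj (dz c i (coord c' a) x)) (\<omega> c' x A) js) is)"
  (is "_ \<longleftrightarrow> ?Z \<and> ?L \<and> ?R \<and> ?S \<and> ?T")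
proof -
  have sums: "(\<Sum>as\<in>multi_ind M p. \<Sum>bs\<in>multi_ind M q. (\<Prod>r<p. dz c (is ! r) (coord c' (as ! r)) x) *
               (\<Prod>s<q. cnj (dz c (js ! s) (coord c' (bs ! s)) x)) * \<omega> c' x as bs)
     = pull (\<lambda>a i. dz c i (coord c' a) x) (\<lambda>A. pull (\<lambda>a i. cnj (dz c i (coord c' a) x)) (\<omega> c' x A) js) is"
    if Z: ?Z and len: "is \<in> multi_ind M p" "js \<in> multi_ind M q" for c c' x "is" js
  proof -
    have fin: "finite {A :: 'n list. length A = k}" for k
      using finite_lists_length_eq[of "UNIV :: 'n set" k] by simp
    have inner: "pull (\<lambda>a i. cnj (dz c i (coord c' a) x)) (\<omega> c' x A) js
       = (\<Sum>B\<in>multi_ind M q. (\<Prod>s<q. cnj (dz c (js ! s) (coord c' (B ! s)) x)) * \<omega> c' x A B)" for A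
      unfolding pull_eq_sum using len
      by (intro sum.mono_neutral_cong_right fin) (auto simp: multi_ind_def intro!: Z[rule_format])
    have outer: "pull (\<lambda>a i. dz c i (coord c' a) x) w is
       = (\<Sum>A\<in>multi_ind M p. (\<Prod>s<p. dz c (is ! s) (coord c' (A ! s)) x) * w A)"
      if "\<And>A. A \<notin> multi_ind M p \<Longrightarrow> w A = 0" for w
      unfolding pull_eq_sum using len that
      by (intro sum.mono_neutral_cong_right fin) (auto simp: multi_ind_def)
    show ?thesis
    proof (subst outer)
      fix A assume "A \<notin> multi_ind M p"
      then have "\<omega> c' x A B = 0" for B
        using Z by blast
      then show "pull (\<lambda>a i. cnj (dz c i (coord c' a) x)) (\<omega> c' x A) js = 0"
        unfolding inner by simp
    qed (simp only: inner sum_distrib_left mult.assoc)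
  qed
  have alt1: "(\<forall>c x is js r s. r < s \<and> s < p \<and> length is = p \<longrightarrow> \<omega> c x (swap r s is) js = - \<omega> c x is js) \<longleftrightarrow> ?L"
    if Z: ?Z
  proof
    assume *: "\<forall>c x is js r s. r < s \<and> s < p \<and> length is = p \<longrightarrow> \<omega> c x (swap r s is) js = - \<omega> c x is js"
    show ?L
      by (intro allI alternating_vanish[of p]) (use * Z in \<open>auto simp: multi_ind_def\<close>)
  next
    assume ?L
    then show "\<forall>c x is js r s. r < s \<and> s < p \<and> length is = p \<longrightarrow> \<omega> c x (swap r s is) js = - \<omega> c x is js"
      using alternating_swap by fastforce
  qed
  have alt2: "(\<forall>c x is js r s. r < s \<and> s < q \<and> length js = q \<longrightarrow> \<omega> c x is (swap r s js) = - \<omega> c x is js) \<longleftrightarrow> ?R"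
    if Z: ?Z
  proof
    assume *: "\<forall>c x is js r s. r < s \<and> s < q \<and> length js = q \<longrightarrow> \<omega> c x is (swap r s js) = - \<omega> c x is js"
    show ?R
      by (intro allI alternating_vanish[of q]) (use * Z in \<open>auto simp: multi_ind_def\<close>)
  next
    assume ?R
    then show "\<forall>c x is js r s. r < s \<and> s < q \<and> length js = q \<longrightarrow> \<omega> c x is (swap r s js) = - \<omega> c x is js"
      using alternating_swap by fastforce
  qed
  show ?thesis
  proof (cases ?Z)
    case True
    show ?thesis
      unfolding forms_def mem_Collect_eq alt1[OF True] alt2[OF True] using sums[OF True]
      by (simp cong: ball_cong)
  next
    case False
    then show ?thesis unfolding forms_def by blast
  qed
qed

end

section \<open>The differentials on forms\<close>

text \<open>Reorders the arguments so that a component is a function on the manifold, an element of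
  the ring in which the abstract calculus works.\<close>

definition comps :: "('a, 'n) form \<Rightarrow> ('a, 'n) chart \<Rightarrow> 'n list \<Rightarrow> 'n list \<Rightarrow> 'a \<Rightarrow> complex" where
  "comps \<omega> c is js x = \<omega> c x is js"

lemma asum_apply: "asum f I x = asum (\<lambda>i K. f i K x) I"
  by (induction I arbitrary: f) auto

lemma asum_apply_omit:
  "asum f I x = (\<Sum>r<length I. (-1) ^ r * f (I ! r) (omit r I) x :: 'r::ring_1)"
  unfolding asum_apply by (rule asum_eq_omit)

lemma alternating_apply:
  assumes "alternating w"
  shows "alternating (\<lambda>K. w K x)"
  unfolding alternating_def
proof (intro allI)
  fix xs a b ys
  show "w (xs @ b # a # ys) x = - w (xs @ a # b # ys) x"
    using fun_cong[OF alternatingD[OF assms, of xs b a ys], of x] by simp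
qed

lemma alternating_fun:
  assumes "\<And>x. alternating (\<lambda>K. w K x)"
  shows "alternating w"
  unfolding alternating_def
proof (intro allI ext)
  fix xs a b ys x
  show "w (xs @ b # a # ys) x = (- w (xs @ a # b # ys)) x"
    using alternatingD[OF assms, where xs = xs and a = a and b = b and ys = ys] by simp
qed

lemma alternating_diff:
  assumes "alternating v" "alternating w"
  shows "alternating (\<lambda>K. v K - w K)"
  unfolding alternating_def
proof (intro allI)
  fix xs a b ys
  show "v (xs @ b # a # ys) - w (xs @ b # a # ys) = - (v (xs @ a # b # ys) - w (xs @ a # b # ys))"
    using alternatingD[OF assms(1), of xs b a ys] alternatingD[OF assms(2), of xs b a ys] by simp
qed

lemma alternating_mult:
  fixes w :: "'i list \<Rightarrow> 'r::ring"
  assumes "alternating w"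
  shows "alternating (\<lambda>K. r * w K)"
  unfolding alternating_def
proof (intro allI)
  fix xs a b ys
  show "r * w (xs @ b # a # ys) = - (r * w (xs @ a # b # ys))"
    using alternatingD[OF assms, of xs b a ys] by simp
qed

lemma alternating_zero: "alternating (\<lambda>K. 0)"
  unfolding alternating_def by simp

lemma con_pull_const:
  "con h P (\<lambda>K. pull J (\<lambda>B. g B K) Js) I = pull J (\<lambda>B. con h P (g B) I) Js"
  unfolding con_def by (simp only: pull_mult pull_sum)

section \<open>Degree and alternation under the differentials\<close>

context derivation_algebra
begin

lemma del_op_pull_const:
  assumes "\<And>a j. J a j \<in> A" and "\<And>i a j. d i (J a j) = 0" and "\<And>B K. g B K \<in> A"
  shows "del_op (\<lambda>K. pull J (\<lambda>B. g B K) Js) I = pull J (\<lambda>B. del_op (g B) I) Js"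
  unfolding del_op_def pull_asum
  by (rule asum_cong, rule d_pull_constant) (rule assms)+

lemma del_op_length:
  assumes "\<And>K. length K \<noteq> p \<Longrightarrow> w K = 0" "length I \<noteq> Suc p"
  shows "del_op w I = 0"
proof -
  have "del_op w I = asum (\<lambda>i K. 0) I"
    unfolding del_op_def by (rule asum_cong) (use assms in auto)
  then show ?thesis by simp
qed

end

context poisson_calculus
begin

lemma delp_diff:
  assumes "\<And>K. v K \<in> A" "\<And>K. w K \<in> A"
  shows "delp (\<lambda>K. v K - w K) I = delp v I - delp w I"
  using assms by (simp add: delp_eq diff_closed E_diff R_diff)

lemma delp_minus:
  assumes "\<And>K. w K \<in> A"
  shows "delp (\<lambda>K. - w K) I = - delp w I"
proof -
  have "delp (\<lambda>K. 0) I = 0"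
    using delp_diff[of w w] assms by simp
  then show ?thesis
    using delp_diff[of "\<lambda>K. 0" w I] assms by simp
qed

lemma alternating_delp:
  assumes "alternating w" "\<And>K. w K \<in> A"
  shows "alternating (delp w)"
  unfolding delp_def
  by (intro alternating_diff alternating_con alternating_del_op con_closed assms)

lemma delp_length:
  assumes "\<And>K. length K \<noteq> Suc p \<Longrightarrow> w K = 0" "length I \<noteq> p"
  shows "delp w I = 0"
proof -
  have "del_op w (a # b # I) = 0" for a b
    by (rule del_op_length[of "Suc p"]) (use assms in auto)
  then have "con h P (del_op w) I = 0"
    by (simp add: con_def)
  moreover have "del_op (con h P w) I = asum (\<lambda>i K. 0) I"
    unfolding del_op_def con_def
    by (rule asum_cong) (use assms in simp)
  ultimately show ?thesis
    by (simp add: delp_def)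
qed

end

context chart_domain
begin

text \<open>The second clause is preserved by the differentials because of
  \<open>asum_bad_index\<close>, and it matches the index tests built into \<open>del\<close> and
  \<open>delbar\<close>.\<close>

definition fam :: "('n list \<Rightarrow> 'n list \<Rightarrow> 'a \<Rightarrow> complex) \<Rightarrow> bool" where
  "fam f \<longleftrightarrow> (\<forall>is js. f is js \<in> A) \<and> (\<forall>is js. \<not> (set is \<subseteq> ind M \<and> set js \<subseteq> ind M) \<longrightarrow> f is js = 0)"

lemma fam_A: "fam f \<Longrightarrow> f is js \<in> A"
  by (simp add: fam_def)

lemma fam_zero: "fam f \<Longrightarrow> \<not> (set is \<subseteq> ind M \<and> set js \<subseteq> ind M) \<Longrightarrow> f is js = 0"
  by (simp add: fam_def)

lemma pd_zero: "pd \<sigma> i 0 = 0"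
proof -
  interpret derivation_algebra A "pd \<sigma>" by (rule derivations)
  show ?thesis by simp
qed

text \<open>A bad entry either is the one removed, where \<open>pd\<close> is zero by default, or
  survives in the remaining list, where \<open>g\<close> is zero.\<close>

lemma asum_bad_index:
  assumes "\<And>K. \<not> set K \<subseteq> ind M \<Longrightarrow> g K = 0" and "\<not> set I \<subseteq> ind M"
  shows "asum (\<lambda>i K. pd \<sigma> i (g K)) I = 0"
  using assms
proof (induction I arbitrary: g)
  case (Cons i I)
  have "pd \<sigma> i (g I) = 0"
  proof (cases "i \<in> ind M")
    case True
    then have "g I = 0" using Cons.prems by auto
    then show ?thesis by (simp only: pd_zero)
  qed (auto simp: pd_def)
  moreover have "asum (\<lambda>j K. pd \<sigma> j (g (i # K))) I = 0"
  proof (cases "i \<in> ind M")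
    case True
    then show ?thesis
      using Cons.prems by (intro Cons.IH) auto
  next
    case False
    then have "g (i # K) = 0" for K
      using Cons.prems(1) by auto
    then show ?thesis by (simp only: pd_zero asum_zero)
  qed
  ultimately show ?case by simp
qed simp

lemma del_comps:
  assumes WU: "W = U \<inter> dom_of c" and f: "fam (comps \<omega> c)"
  shows "comps (del M U \<omega>) c is js = derivation_algebra.del_op (pd 1) (\<lambda>K. comps \<omega> c K js) is"
proof -
  interpret D: derivation_algebra A "pd 1" by (rule derivations)
  show ?thesis
  proof (cases "set is \<subseteq> ind M \<and> set js \<subseteq> ind M")
    case True
    show ?thesis
    proof
      fix x
      show "comps (del M U \<omega>) c is js x = D.del_op (\<lambda>K. comps \<omega> c K js) is x"
      proof (cases "x \<in> W")
        case x: True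
        have "pd 1 (is ! r) (comps \<omega> c (omit r is) js) x = dz c (is ! r) (\<lambda>y. \<omega> c y (omit r is) js) x"
          if "r < length is" for r
          using True x nth_mem[OF that] by (subst pd_dz) (auto simp: comps_def[abs_def])
        moreover have "x \<in> U" "x \<in> dom_of c"
          using x WU by auto
        ultimately show ?thesis
          using True c
          by (simp add: comps_def[of "del M U \<omega>"] del_def D.del_op_def asum_apply_omit)
      next
        case False
        then show ?thesis
          by (simp add: comps_def[of "del M U \<omega>"] del_def WU[symmetric] D.del_op_def asum_apply pd_def)
      qed
    qed
  next
    case False
    have "D.del_op (\<lambda>K. comps \<omega> c K js) is = 0"
    proof (cases "set js \<subseteq> ind M")
      case True
      then show ?thesis
        unfolding D.del_op_def using False fam_zero[OF f] by (intro asum_bad_index) auto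
    next
      case js: False
      then have "comps \<omega> c K js = 0" for K
        using fam_zero[OF f] by simp
      then show ?thesis by (simp add: D.del_op_def)
    qed
    then show ?thesis
      using False by (auto simp: fun_eq_iff comps_def del_def)
  qed
qed

lemma fam_del:
  assumes f: "fam f"
  shows "fam (\<lambda>is js. derivation_algebra.del_op (pd 1) (\<lambda>K. f K js) is)"
proof -
  interpret D: derivation_algebra A "pd 1" by (rule derivations)
  have "D.del_op (\<lambda>K. f K js) is = 0" if "\<not> (set is \<subseteq> ind M \<and> set js \<subseteq> ind M)" for "is" js
  proof (cases "set js \<subseteq> ind M")
    case True
    then show ?thesis
      unfolding D.del_op_def using that fam_zero[OF f] by (intro asum_bad_index) auto
  next
    case False
    then have "f K js = 0" for K
      using fam_zero[OF f] by simp
    then show ?thesis by (simp add: D.del_op_def)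
  qed
  then show ?thesis
    using D.del_op_closed fam_A[OF f] unfolding fam_def by auto
qed

lemma fam_delbar:
  assumes f: "fam f"
  shows "fam (\<lambda>is js. (-1) ^ length is * derivation_algebra.del_op (pd (-1)) (f is) js)"
proof -
  interpret D: derivation_algebra A "pd (-1)" by (rule derivations)
  have "D.del_op (f is) js = 0" if "\<not> (set is \<subseteq> ind M \<and> set js \<subseteq> ind M)" for "is" js
  proof (cases "set is \<subseteq> ind M")
    case True
    then show ?thesis
      unfolding D.del_op_def using that fam_zero[OF f] by (intro asum_bad_index) auto
  next
    case False
    then have "f is K = 0" for K
      using fam_zero[OF f] by simp
    then show ?thesis by (simp add: D.del_op_def)
  qed
  moreover have "(-1) ^ n * g \<in> A" if "g \<in> A" for n and g :: "'a \<Rightarrow> complex"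
    using that by (cases "even n") (auto simp: D.minus_closed)
  ultimately show ?thesis
    using D.del_op_closed fam_A[OF f] unfolding fam_def by simp
qed

lemma delbar_comps:
  assumes WU: "W = U \<inter> dom_of c" and f: "fam (comps \<omega> c)"
  shows "comps (delbar M U \<omega>) c is js
    = (-1) ^ length is * derivation_algebra.del_op (pd (-1)) (comps \<omega> c is) js"
proof -
  interpret D: derivation_algebra A "pd (-1)" by (rule derivations)
  have sgn: "((-1) ^ n) x = ((-1) ^ n :: complex)" for n and x :: 'a
    by (cases "even n") auto
  show ?thesis
  proof (cases "set is \<subseteq> ind M \<and> set js \<subseteq> ind M")
    case True
    show ?thesis
    proof
      fix x
      show "comps (delbar M U \<omega>) c is js x = ((-1) ^ length is * D.del_op (comps \<omega> c is) js) x"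
      proof (cases "x \<in> W")
        case x: True
        have "pd (-1) (js ! r) (comps \<omega> c is (omit r js)) x = dzbar c (js ! r) (\<lambda>y. \<omega> c y is (omit r js)) x"
          if "r < length js" for r
          using True x nth_mem[OF that] by (subst pd_dzbar) (auto simp: comps_def[abs_def])
        moreover have "x \<in> U" "x \<in> dom_of c"
          using x WU by auto
        ultimately show ?thesis
          using True c
          by (simp add: comps_def[of "delbar M U \<omega>"] delbar_def D.del_op_def asum_apply_omit sgn)
      next
        case False
        then show ?thesis
          by (simp add: comps_def[of "delbar M U \<omega>"] delbar_def WU[symmetric] D.del_op_def asum_apply pd_def)
      qed
    qed
  next
    case False
    then have "(-1) ^ length is * D.del_op (comps \<omega> c is) js = 0"
      by (rule fam_zero[OF fam_delbar[OF f]])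
    then show ?thesis
      using False by (auto simp: fun_eq_iff comps_def delbar_def)
  qed
qed

end

context poisson_chart
begin

lemma contraction_comps:
  assumes f: "fam (comps \<omega> c)"
  shows "comps (contraction M \<pi> \<omega>) c is js = con half P (\<lambda>K. comps \<omega> c K js) is"
proof
  fix x
  show "comps (contraction M \<pi> \<omega>) c is js x = con half P (\<lambda>K. comps \<omega> c K js) is x"
  proof (cases "x \<in> W")
    case True
    have "(\<Sum>a\<in>UNIV. \<Sum>b\<in>UNIV. P a b x * \<omega> c x (a # b # is) js)
        = (\<Sum>a\<in>ind M. \<Sum>b\<in>UNIV. P a b x * \<omega> c x (a # b # is) js)"
      by (rule sum.mono_neutral_right) (auto simp: P_def)
    also have "\<dots> = (\<Sum>a\<in>ind M. \<Sum>b\<in>ind M. P a b x * \<omega> c x (a # b # is) js)"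
      by (intro sum.cong refl sum.mono_neutral_right) (auto simp: P_def)
    also have "\<dots> = (\<Sum>a\<in>ind M. \<Sum>b\<in>ind M. \<pi> c x a b * \<omega> c x (a # b # is) js)"
      using True by (intro sum.cong refl) (auto simp: P_def)
    finally show ?thesis
      by (simp add: comps_def contraction_def con_def sum_fun_apply)
  next
    case False
    have "\<omega> c x K js = 0" for K
      using A_zero[OF fam_A[OF f] False] by (simp add: comps_def)
    then show ?thesis
      by (simp add: comps_def contraction_def con_def sum_fun_apply)
  qed
qed

lemma fam_con:
  assumes f: "fam f"
  shows "fam (\<lambda>is js. con half P (\<lambda>K. f K js) is)"
proof -
  have "con half P (\<lambda>K. f K js) is = 0" if "\<not> (set is \<subseteq> ind M \<and> set js \<subseteq> ind M)" for "is" js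
  proof -
    have "f (a # b # is) js = 0" for a b
      using that fam_zero[OF f] by auto
    then show ?thesis by (simp add: con_def)
  qed
  then show ?thesis
    using calc.con_closed fam_A[OF f] unfolding fam_def by auto
qed

lemma fam_delP:
  assumes f: "fam f"
  shows "fam (calc.delP f)"
  unfolding fam_def
proof (intro conjI allI impI)
  show "calc.delP f is js \<in> A" for "is" js
    by (rule calc.delP_closed) (rule fam_A[OF f])
  show "calc.delP f is js = 0" if "\<not> (set is \<subseteq> ind M \<and> set js \<subseteq> ind M)" for "is" js
    using fam_zero[OF fam_con[OF fam_del[OF f]] that] fam_zero[OF fam_del[OF fam_con[OF f]] that]
    by (simp add: calc.delP_def calc.delp_def)
qed

lemma fam_delB: "fam f \<Longrightarrow> fam (calc.delB f)"
  using fam_delbar unfolding calc.delB_def[abs_def] .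

text \<open>Identifies the operator on forms, chart by chart, with that of the abstract calculus,
  whose identities thereby transfer.\<close>

lemma del_pi_comps:
  assumes WU: "W = U \<inter> dom_of c" and f: "fam (comps \<omega> c)"
  shows "comps (del_pi M \<pi> U \<omega>) c = calc.delP (comps \<omega> c)"
proof (intro ext)
  fix "is" js x
  have del: "comps (del M U \<omega>) c = (\<lambda>is js. calc.del_op (\<lambda>K. comps \<omega> c K js) is)"
    using del_comps[OF WU f] by blast
  have con: "comps (contraction M \<pi> \<omega>) c = (\<lambda>is js. con half P (\<lambda>K. comps \<omega> c K js) is)"
    using contraction_comps[OF f] by blast
  have "comps (contraction M \<pi> (del M U \<omega>)) c is js = con half P (calc.del_op (\<lambda>K. comps \<omega> c K js)) is"
    using contraction_comps[of "del M U \<omega>"] fam_del[OF f] unfolding del by simp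
  moreover have "comps (del M U (contraction M \<pi> \<omega>)) c is js = calc.del_op (con half P (\<lambda>K. comps \<omega> c K js)) is"
    using del_comps[OF WU, of "contraction M \<pi> \<omega>"] fam_con[OF f] unfolding con by simp
  ultimately show "comps (del_pi M \<pi> U \<omega>) c is js x = calc.delP (comps \<omega> c) is js x"
    by (simp add: calc.delP_def calc.delp_def del_pi_def comps_def fun_eq_iff)
qed

lemma delbar_comps_delB:
  assumes WU: "W = U \<inter> dom_of c" and f: "fam (comps \<omega> c)"
  shows "comps (delbar M U \<omega>) c = calc.delB (comps \<omega> c)"
  using delbar_comps[OF WU f] by (intro ext) (simp add: calc.delB_def)

end

section \<open>Spaces of forms and restriction to smaller open sets\<close>

context poisson_mfd
begin

lemma form_supp:
  "\<omega> \<in> forms M U p q \<Longrightarrow> \<not> (c \<in> atlas M \<and> x \<in> U \<inter> dom_of c \<and> is \<in> multi_ind M p \<and> js \<in> multi_ind M q)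
    \<Longrightarrow> \<omega> c x is js = 0"
  unfolding forms_iff by (elim conjE) blast

lemma form_alt:
  assumes "\<omega> \<in> forms M U p q"
  shows "alternating (\<lambda>is. \<omega> c x is js)" "alternating (\<omega> c x is)"
  using assms unfolding forms_iff by (elim conjE; blast)+

lemma form_smooth:
  "\<omega> \<in> forms M U p q \<Longrightarrow> c \<in> atlas M \<Longrightarrow> smooth_in (ind M) c (U \<inter> dom_of c) (\<lambda>x. \<omega> c x is js)"
  unfolding forms_iff by (elim conjE) blast

lemma form_transform:
  "\<omega> \<in> forms M U p q \<Longrightarrow> c \<in> atlas M \<Longrightarrow> c' \<in> atlas M \<Longrightarrow> x \<in> U \<inter> dom_of c \<inter> dom_of c' \<Longrightarrow>
    is \<in> multi_ind M p \<Longrightarrow> js \<in> multi_ind M q \<Longrightarrow>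
    \<omega> c x is js = pull (\<lambda>a i. dz c i (coord c' a) x)
      (\<lambda>A. pull (\<lambda>a i. cnj (dz c i (coord c' a) x)) (\<omega> c' x A) js) is"
  unfolding forms_iff by (elim conjE) blast

lemma poisson_chart_inter: "openin (top_of M) U \<Longrightarrow> c \<in> atlas M \<Longrightarrow> poisson_chart M \<pi> c (U \<inter> dom_of c)"
  by unfold_locales (auto intro: openin_Int chart_open)

lemma form_nonatlas: "\<omega> \<in> forms M U p q \<Longrightarrow> c \<notin> atlas M \<Longrightarrow> \<omega> c x is js = 0"
  by (rule form_supp) auto

lemma form_outside: "\<omega> \<in> forms M U p q \<Longrightarrow> x \<notin> U \<Longrightarrow> \<omega> c x is js = 0"
  by (rule form_supp) auto

lemma form_length: "\<omega> \<in> forms M U p q \<Longrightarrow> length is \<noteq> p \<or> length js \<noteq> q \<Longrightarrow> \<omega> c x is js = 0"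
  by (rule form_supp) (auto simp: multi_ind_def)

lemma form_fam:
  assumes U: "openin (top_of M) U" and c: "c \<in> atlas M" and \<omega>: "\<omega> \<in> forms M U p q"
  shows "chart_domain.fam M c (U \<inter> dom_of c) (comps \<omega> c)"
proof -
  interpret poisson_chart M \<pi> c "U \<inter> dom_of c" by (rule poisson_chart_inter[OF U c])
  have Z: "\<omega> c x is js = 0" if "\<not> (x \<in> U \<inter> dom_of c \<and> is \<in> multi_ind M p \<and> js \<in> multi_ind M q)" for x "is" js
    using form_supp[OF \<omega>] that by blast
  have "comps \<omega> c is js \<in> A" for "is" js
    by (rule A_I) (use form_smooth[OF \<omega> c] Z in \<open>auto simp: comps_def[abs_def]\<close>)
  then show ?thesis
    unfolding fam_def using Z by (auto simp: comps_def fun_eq_iff multi_ind_def)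
qed

lemma form_alternating:
  assumes "\<omega> \<in> forms M U p q"
  shows "alternating (\<lambda>is. comps \<omega> c is js)" "alternating (comps \<omega> c is)"
  by (intro alternating_fun; simp add: comps_def form_alt[OF assms])+

lemma nonatlas_del_pi:
  assumes "\<And>x is js. \<omega> c x is js = 0" "c \<notin> atlas M"
  shows "del_pi M \<pi> U \<omega> c x is js = 0" "delbar M U \<omega> c x is js = 0"
  using assms by (simp_all add: del_pi_def contraction_def del_def delbar_def)

lemma form_eqI:
  assumes "\<And>c x is js. c \<notin> atlas M \<Longrightarrow> \<omega> c x is js = \<eta> c x is js"
    and "\<And>c is js. c \<in> atlas M \<Longrightarrow> comps \<omega> c is js = comps \<eta> c is js"
  shows "\<omega> = \<eta>"
proof (intro ext)
  fix c x "is" js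
  show "\<omega> c x is js = \<eta> c x is js"
    using assms(1)[of c x "is" js] assms(2)[of c "is" js] by (cases "c \<in> atlas M") (auto simp: comps_def fun_eq_iff)
qed

lemma comps_diff: "comps (\<omega> - \<eta>) c = (\<lambda>is js. comps \<omega> c is js - comps \<eta> c is js)"
  by (simp add: comps_def fun_eq_iff)

lemma forms_zero: "0 \<in> forms M U p q"
proof -
  have "smooth_in (ind M) c (U \<inter> dom_of c) (\<lambda>x. 0)" for c :: "('a, 'n) chart"
  proof -
    have "Ck S k V (\<lambda>z. 0)" for S k and V :: "(complex^'n) set"
    proof (induction k)
      case (Suc k)
      have "dir_deriv v (\<lambda>z. 0) = (\<lambda>z. 0)" for v :: "complex^'n"
        by (rule ext) (simp add: dir_deriv_def)
      with Suc show ?case by (simp add: differentiable_on_def)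
    qed simp
    then show ?thesis
      by (simp add: smooth_in_def local_rep_def o_def)
  qed
  then show ?thesis
    by (simp add: forms_def)
qed

lemma forms_diff:
  assumes U: "openin (top_of M) U" and \<omega>: "\<omega> \<in> forms M U p q" and \<eta>: "\<eta> \<in> forms M U p q"
  shows "\<omega> - \<eta> \<in> forms M U p q"
  unfolding forms_iff
proof (intro conjI allI impI ballI)
  fix c x "is" js
  assume "\<not> (c \<in> atlas M \<and> x \<in> U \<inter> dom_of c \<and> is \<in> multi_ind M p \<and> js \<in> multi_ind M q)"
  then have "\<omega> c x is js = 0" "\<eta> c x is js = 0"
    using form_supp[OF \<omega>, of c x "is" js] form_supp[OF \<eta>, of c x "is" js] by blast+
  then show "(\<omega> - \<eta>) c x is js = 0" by simp
next
  fix c x js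
  show "alternating (\<lambda>is. (\<omega> - \<eta>) c x is js)"
    using alternating_diff[OF form_alt(1)[OF \<omega>] form_alt(1)[OF \<eta>]] by simp
next
  fix c x "is"
  have "alternating (\<lambda>js. \<omega> c x is js - \<eta> c x is js)"
    by (rule alternating_diff[OF form_alt(2)[OF \<omega>] form_alt(2)[OF \<eta>]])
  moreover have "(\<omega> - \<eta>) c x is = (\<lambda>js. \<omega> c x is js - \<eta> c x is js)"
    by (simp add: fun_eq_iff)
  ultimately show "alternating ((\<omega> - \<eta>) c x is)"
    by simp
next
  fix c "is" js assume c: "c \<in> atlas M"
  interpret poisson_chart M \<pi> c "U \<inter> dom_of c" by (rule poisson_chart_inter[OF U c])
  have "comps \<omega> c is js - comps \<eta> c is js \<in> A"
    by (rule calc.diff_closed[OF fam_A[OF form_fam[OF U c \<omega>]] fam_A[OF form_fam[OF U c \<eta>]]])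
  from A_smooth[OF this] show "smooth_in (ind M) c (U \<inter> dom_of c) (\<lambda>x. (\<omega> - \<eta>) c x is js)"
    by (simp add: comps_def fun_diff_def)
next
  fix c c' x "is" js
  assume "c \<in> atlas M" "c' \<in> atlas M" "x \<in> U \<inter> dom_of c \<inter> dom_of c'" "is \<in> multi_ind M p" "js \<in> multi_ind M q"
  note * = form_transform[OF \<omega> this] form_transform[OF \<eta> this]
  have "(\<omega> - \<eta>) c' x A = (\<lambda>B. \<omega> c' x A B - \<eta> c' x A B)" for A
    by (simp add: fun_eq_iff)
  then show "(\<omega> - \<eta>) c x is js = pull (\<lambda>a i. dz c i (coord c' a) x)
     (\<lambda>A. pull (\<lambda>a i. cnj (dz c i (coord c' a) x)) ((\<omega> - \<eta>) c' x A) js) is"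
    using * by (simp add: pull_diff)
qed

text \<open>Derivatives at a point of the open set \<open>U'\<close> see only the values in
  \<open>U'\<close>.\<close>

lemma del_rs:
  assumes U': "openin (top_of M) U'" "U' \<subseteq> U"
  shows "rs U' (del M U \<omega>) = del M U' (rs U' \<omega>)" "rs U' (delbar M U \<omega>) = delbar M U' (rs U' \<omega>)"
proof -
  have dz: "dz c i f x = dz c i (\<lambda>y. if y \<in> U' then f y else 0) x"
    and dzb: "dzbar c i f x = dzbar c i (\<lambda>y. if y \<in> U' then f y else 0) x"
    if "c \<in> atlas M" "x \<in> U' \<inter> dom_of c" "i \<in> ind M" for c i f x
  proof -
    interpret poisson_chart M \<pi> c "U' \<inter> dom_of c" by (rule poisson_chart_inter[OF U'(1) that(1)])
    have "pd \<sigma> i f = pd \<sigma> i (\<lambda>y. if y \<in> U' then f y else 0)" for \<sigma>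
      by (rule pd_cong) auto
    from fun_cong[OF this[of 1], of x] fun_cong[OF this[of "-1"], of x]
    show "dz c i f x = dz c i (\<lambda>y. if y \<in> U' then f y else 0) x"
      "dzbar c i f x = dzbar c i (\<lambda>y. if y \<in> U' then f y else 0) x"
      unfolding pd_dz[OF that(2,3)] pd_dzbar[OF that(2,3)] .
  qed
  show "rs U' (del M U \<omega>) = del M U' (rs U' \<omega>)"
  proof (intro ext)
    fix c x "is" js
    show "rs U' (del M U \<omega>) c x is js = del M U' (rs U' \<omega>) c x is js"
      using U'(2) unfolding rs_def del_def by (auto intro!: sum.cong dz nth_mem)
  qed
  show "rs U' (delbar M U \<omega>) = delbar M U' (rs U' \<omega>)"
  proof (intro ext)
    fix c x "is" js
    show "rs U' (delbar M U \<omega>) c x is js = delbar M U' (rs U' \<omega>) c x is js"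
      using U'(2) unfolding rs_def delbar_def by (auto intro!: sum.cong dzb nth_mem)
  qed
qed

lemma del_pi_rs:
  assumes U': "openin (top_of M) U'" "U' \<subseteq> U"
  shows "rs U' (del_pi M \<pi> U \<omega>) = del_pi M \<pi> U' (rs U' \<omega>)"
proof -
  have con: "contraction M \<pi> (rs U' \<eta>) = rs U' (contraction M \<pi> \<eta>)" for \<eta>
    by (simp add: fun_eq_iff contraction_def rs_def)
  have "rs U' (\<alpha> - \<beta>) = rs U' \<alpha> - rs U' \<beta>" for \<alpha> \<beta> :: "('a, 'n) form"
    by (simp add: fun_eq_iff rs_def)
  then show ?thesis
    unfolding del_pi_def by (simp only: con[symmetric] del_rs(1)[OF U'])
qed

lemma forms_rs:
  assumes U: "openin (top_of M) U" and U': "openin (top_of M) U'" "U' \<subseteq> U" and \<omega>: "\<omega> \<in> forms M U p q"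
  shows "rs U' \<omega> \<in> forms M U' p q"
  unfolding forms_iff
proof (intro conjI allI impI ballI)
  fix c x "is" js
  assume "\<not> (c \<in> atlas M \<and> x \<in> U' \<inter> dom_of c \<and> is \<in> multi_ind M p \<and> js \<in> multi_ind M q)"
  then show "rs U' \<omega> c x is js = 0"
    using form_supp[OF \<omega>, of c x "is" js] by (auto simp: rs_def)
next
  fix c x js
  show "alternating (\<lambda>is. rs U' \<omega> c x is js)"
    by (cases "x \<in> U'") (simp_all add: rs_def form_alt[OF \<omega>] alternating_zero)
next
  fix c x "is"
  show "alternating (rs U' \<omega> c x is)"
    by (cases "x \<in> U'") (simp_all add: rs_def[abs_def] form_alt[OF \<omega>] alternating_zero)
next
  fix c "is" js assume c: "c \<in> atlas M"
  interpret X: poisson_chart M \<pi> c "U \<inter> dom_of c" by (rule poisson_chart_inter[OF U c])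
  interpret Y: poisson_chart M \<pi> c "U' \<inter> dom_of c" by (rule poisson_chart_inter[OF U'(1) c])
  have "smooth_in (ind M) c (U \<inter> dom_of c) (\<lambda>x. \<omega> c x is js)"
    by (rule form_smooth[OF \<omega> c])
  then have "smooth_in (ind M) c (U' \<inter> dom_of c) (\<lambda>x. \<omega> c x is js)"
    by (rule X.smooth_in_subset[rotated 2]) (use U' Y.W in auto)
  then show "smooth_in (ind M) c (U' \<inter> dom_of c) (\<lambda>x. rs U' \<omega> c x is js)"
    by (rule Y.smooth_in_cong) (simp add: rs_def)
next
  fix c c' x "is" js
  assume *: "c \<in> atlas M" "c' \<in> atlas M" "x \<in> U' \<inter> dom_of c \<inter> dom_of c'" "is \<in> multi_ind M p" "js \<in> multi_ind M q"
  then have x: "x \<in> U \<inter> dom_of c \<inter> dom_of c'" using U'(2) by auto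
  show "rs U' \<omega> c x is js = pull (\<lambda>a i. dz c i (coord c' a) x)
     (\<lambda>A. pull (\<lambda>a i. cnj (dz c i (coord c' a) x)) (rs U' \<omega> c' x A) js) is"
    using *(3) form_transform[OF \<omega> *(1,2) x *(4,5)] by (simp add: rs_def[abs_def])
qed

end

section \<open>Independence of the differentials from the chart\<close>

locale poisson_change = poisson_mfd M \<pi> + chart_change M c c' W
  for M :: "('a, 'n::finite) cmanifold" and \<pi> c c' W
begin

sublocale PX: poisson_chart M \<pi> c W
  by unfold_locales

sublocale PY: poisson_chart M \<pi> c' W
  by unfold_locales

lemma P_change: "PY.P a b = (\<Sum>i\<in>UNIV. \<Sum>j\<in>UNIV. PX.P i j * Jac a i * Jac b j)"
proof
  fix x
  show "PY.P a b x = (\<Sum>i\<in>UNIV. \<Sum>j\<in>UNIV. PX.P i j * Jac a i * Jac b j) x"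
  proof (cases "x \<in> W \<and> a \<in> ind M \<and> b \<in> ind M")
    case True
    then have x: "x \<in> dom_of c" "x \<in> dom_of c'"
      using Wcc by auto
    have "(\<Sum>i\<in>UNIV. \<Sum>j\<in>UNIV. PX.P i j x * Jac a i x * Jac b j x)
        = (\<Sum>i\<in>ind M. \<Sum>j\<in>UNIV. PX.P i j x * Jac a i x * Jac b j x)"
      by (rule sum.mono_neutral_right) (auto simp: PX.P_def)
    also have "\<dots> = (\<Sum>i\<in>ind M. \<Sum>j\<in>ind M. PX.P i j x * Jac a i x * Jac b j x)"
      by (intro sum.cong refl sum.mono_neutral_right) (auto simp: PX.P_def)
    also have "\<dots> = PY.P a b x"
      using True \<pi>_transform[OF cc x, of a b] by (simp add: PX.P_def PY.P_def Jac_dz)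
    finally show ?thesis
      by (simp add: sum_fun_apply)
  next
    case False
    then have "Jac a i x = 0 \<or> Jac b j x = 0" for i j
      using Jac_zero by blast
    then show ?thesis
      using False by (auto simp: sum_fun_apply PY.P_def intro!: sum.neutral)
  qed
qed

lemma delp_pull:
  assumes w: "alternating w" "\<And>K. w K \<in> X.A"
  shows "PX.calc.delp (pull Jac w) I = pull Jac (PY.calc.delp w) I"
proof -
  interpret ch: coordinate_change X.A "X.pd 1" "Y.pd 1" Jac by (rule change)
  have con: "con PX.half PX.P (pull Jac v) = pull Jac (con PX.half PY.P v)" for v
    by (intro ext con_pull P_change)
  have del: "PX.calc.del_op (pull Jac v) = pull Jac (PY.calc.del_op v)"
    if "alternating v" "\<And>K. v K \<in> X.A" for v
    using ch.del_op_pull[OF that] by blast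
  have cl: "con PX.half PY.P w K \<in> X.A" for K
    using PY.calc.con_closed w(2) unfolding A_eq by blast
  show ?thesis
    unfolding PX.calc.delp_def PY.calc.delp_def
    by (simp only: del[OF w] con del[OF alternating_con[OF w(1)] cl]) (rule pull_diff[symmetric])
qed

text \<open>The transformation law in \<open>forms\<close> speaks of points and admissible indices.
  Extended to all lists it becomes an identity in the ring, to which the abstract calculus applies;
  in the inadmissible cases both sides vanish.\<close>

lemma forms_pull:
  assumes \<omega>: "\<omega> \<in> forms M W p q"
  shows "comps \<omega> c is js = pull Jac (\<lambda>A. pull Jbar (comps \<omega> c' A) js) is"
proof
  fix x
  have rhs: "pull Jac (\<lambda>A. pull Jbar (comps \<omega> c' A) js) is x
    = pull (\<lambda>a i. Jac a i x) (\<lambda>A. pull (\<lambda>a i. Jbar a i x) (\<omega> c' x A) js) is"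
    by (simp add: pull_apply comps_def)
  show "comps \<omega> c is js x = pull Jac (\<lambda>A. pull Jbar (comps \<omega> c' A) js) is x"
  proof (cases "x \<in> W \<and> is \<in> multi_ind M p \<and> js \<in> multi_ind M q")
    case True
    then have "pull (\<lambda>a i. Jac a i x) w is = pull (\<lambda>a i. dz c i (coord c' a) x) w is"
      "pull (\<lambda>a i. Jbar a i x) w js = pull (\<lambda>a i. cnj (dz c i (coord c' a) x)) w js" for w
      by (auto intro!: pull_index_cong simp: Jac_dz Jbar_def multi_ind_def)
    then show ?thesis
      unfolding rhs using True Wcc form_transform[OF \<omega> cc, of x "is" js] by (auto simp: comps_def)
  next
    case False
    have Z: "\<omega> c'' x A B = 0" if "\<not> (x \<in> W \<and> A \<in> multi_ind M p \<and> B \<in> multi_ind M q)" for c'' A B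
      by (rule form_supp[OF \<omega>]) (use that in blast)
    \<comment> \<open>If \<open>x\<close> is in \<open>W\<close> and the lengths are right, some
      index lies outside \<open>ind M\<close> and its Jacobian entries are zero. Otherwise the
      components of \<omega> vanish, as \<open>pull\<close> only evaluates lists of the same
      length.\<close>
    have "pull (\<lambda>a i. Jac a i x) (\<lambda>A. pull (\<lambda>a i. Jbar a i x) (\<omega> c' x A) js) is = 0"
    proof (cases "x \<in> W \<and> length is = p \<and> length js = q")
      case True
      then consider i where "i \<in> set is" "i \<notin> ind M" | j where "j \<in> set js" "j \<notin> ind M"
        using False by (auto simp: multi_ind_def)
      then show ?thesis
      proof cases
        case 1
        then show ?thesis
          by (intro pull_index_zero[of i]) (simp_all add: Jac_zero)
      next
        case 2
        then have "pull (\<lambda>a i. Jbar a i x) w js = 0" for w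
          by (intro pull_index_zero[of j]) (simp_all add: Jac_zero Jbar_def)
        then show ?thesis by simp
      qed
    next
      case False
      have "pull (\<lambda>a i. Jac a i x) (\<lambda>A. pull (\<lambda>a i. Jbar a i x) (\<omega> c' x A) js) is
          = pull (\<lambda>a i. Jac a i x) (\<lambda>A. pull (\<lambda>a i. Jbar a i x) (\<lambda>B. 0) js) is"
      proof (intro pull_cong)
        fix A B :: "'n list" assume "length A = length is" "length B = length js"
        then show "\<omega> c' x A B = 0"
          by (intro Z) (use False in \<open>auto simp: multi_ind_def\<close>)
      qed
      then show ?thesis by simp
    qed
    then show ?thesis
      unfolding rhs using Z[OF False] by (simp add: comps_def)
  qed
qed

lemma forms_pullD:
  assumes "comps \<theta> c is js = pull Jac (\<lambda>A. pull Jbar (comps \<theta> c' A) js) is"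
    and "x \<in> W" "is \<in> multi_ind M p" "js \<in> multi_ind M q"
  shows "\<theta> c x is js = pull (\<lambda>a i. dz c i (coord c' a) x)
     (\<lambda>A. pull (\<lambda>a i. cnj (dz c i (coord c' a) x)) (\<theta> c' x A) js) is"
proof -
  have "\<theta> c x is js = pull (\<lambda>a i. Jac a i x) (\<lambda>A. pull (\<lambda>a i. Jbar a i x) (\<theta> c' x A) js) is"
    using fun_cong[OF assms(1), of x] by (simp add: pull_apply comps_def)
  also have "\<dots> = pull (\<lambda>a i. dz c i (coord c' a) x) (\<lambda>A. pull (\<lambda>a i. Jbar a i x) (\<theta> c' x A) js) is"
    using assms by (intro pull_index_cong) (auto simp: Jac_dz multi_ind_def)
  also have "\<dots> = pull (\<lambda>a i. dz c i (coord c' a) x) (\<lambda>A. pull (\<lambda>a i. cnj (dz c i (coord c' a) x)) (\<theta> c' x A) js) is"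
    using assms by (intro pull_cong pull_index_cong) (auto simp: Jac_dz Jbar_def multi_ind_def)
  finally show ?thesis .
qed

text \<open>The Jacobian of the conjugate coordinates is constant for holomorphic derivations, so
  its pullback moves outside the operator; the remaining pullback in the holomorphic indices is
  dealt with by \<open>delp_pull\<close>.\<close>

lemma del_pi_pull:
  assumes \<omega>: "\<omega> \<in> forms M W p q"
  shows "comps (del_pi M \<pi> W \<omega>) c is js = pull Jac (\<lambda>A. pull Jbar (comps (del_pi M \<pi> W \<omega>) c' A) js) is"
proof -
  have Wc: "W = W \<inter> dom_of c" "W = W \<inter> dom_of c'"
    using Wcc by auto
  have fX: "X.fam (comps \<omega> c)" and fY: "Y.fam (comps \<omega> c')"
    using form_fam[OF Wop cc(1) \<omega>] form_fam[OF Wop cc(2) \<omega>] Wc by auto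
  have vA: "comps \<omega> c' K L \<in> X.A" for K L
    using Y.fam_A[OF fY] by (simp add: A_eq)
  have 1: "(\<lambda>K. comps \<omega> c K js) = (\<lambda>K. pull Jbar (\<lambda>B. pull Jac (\<lambda>A. comps \<omega> c' A B) K) js)"
    unfolding forms_pull[OF \<omega>] by (rule ext) (rule pull_swap)
  have "comps (del_pi M \<pi> W \<omega>) c is js = PX.calc.delp (\<lambda>K. comps \<omega> c K js) is"
    unfolding PX.del_pi_comps[OF Wc(1) fX] PX.calc.delP_def ..
  also have "\<dots> = pull Jbar (\<lambda>B. PX.calc.delp (\<lambda>K. pull Jac (\<lambda>A. comps \<omega> c' A B) K) is) js"
  proof -
    have cl: "pull Jac (\<lambda>A. comps \<omega> c' A B) K \<in> X.A" for B K
      by (rule PX.calc.pull_closed) (rule Jac_A vA)+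
    have cl2: "con PX.half PX.P (\<lambda>K. pull Jac (\<lambda>A. comps \<omega> c' A B) K) K \<in> X.A" for B K
      by (rule PX.calc.con_closed) (rule cl)
    have "PX.calc.del_op (\<lambda>K. pull Jbar (\<lambda>B. pull Jac (\<lambda>A. comps \<omega> c' A B) K) js)
        = (\<lambda>I. pull Jbar (\<lambda>B. PX.calc.del_op (\<lambda>K. pull Jac (\<lambda>A. comps \<omega> c' A B) K) I) js)"
      by (intro ext PX.calc.del_op_pull_const Jbar_A pd_Jbar cl)
    moreover have "con PX.half PX.P (\<lambda>K. pull Jbar (\<lambda>B. pull Jac (\<lambda>A. comps \<omega> c' A B) K) js)
        = (\<lambda>I. pull Jbar (\<lambda>B. con PX.half PX.P (\<lambda>K. pull Jac (\<lambda>A. comps \<omega> c' A B) K) I) js)"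
      by (intro ext con_pull_const)
    ultimately show ?thesis
      unfolding PX.calc.delp_def 1
      by (simp only: con_pull_const PX.calc.del_op_pull_const[of Jbar, OF Jbar_A pd_Jbar cl2] pull_diff)
  qed
  also have "\<dots> = pull Jbar (\<lambda>B. pull Jac (PY.calc.delp (\<lambda>A. comps \<omega> c' A B)) is) js"
    by (simp only: delp_pull[OF form_alternating(1)[OF \<omega>] vA])
  also have "\<dots> = pull Jac (\<lambda>A. pull Jbar (\<lambda>B. PY.calc.delp (\<lambda>A. comps \<omega> c' A B) A) js) is"
    by (rule pull_swap)
  also have "\<dots> = pull Jac (\<lambda>A. pull Jbar (comps (del_pi M \<pi> W \<omega>) c' A) js) is"
    unfolding PY.del_pi_comps[OF Wc(2) fY] by (simp only: PY.calc.delP_def[abs_def])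
  finally show ?thesis .
qed

text \<open>The mirror image: here the holomorphic Jacobian is constant, and the conjugate one is
  handled by \<open>del_op_pull\<close>. The sign is the same in both charts because
  \<open>pull\<close> preserves the length of the list.\<close>

lemma delbar_pull:
  assumes \<omega>: "\<omega> \<in> forms M W p q"
  shows "comps (delbar M W \<omega>) c is js = pull Jac (\<lambda>A. pull Jbar (comps (delbar M W \<omega>) c' A) js) is"
proof -
  interpret ch: coordinate_change X.A "X.pd (-1)" "Y.pd (-1)" Jbar by (rule change_bar)
  have Wc: "W = W \<inter> dom_of c" "W = W \<inter> dom_of c'"
    using Wcc by auto
  have fX: "X.fam (comps \<omega> c)" and fY: "Y.fam (comps \<omega> c')"
    using form_fam[OF Wop cc(1) \<omega>] form_fam[OF Wop cc(2) \<omega>] Wc by auto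
  have vA: "comps \<omega> c' K L \<in> X.A" for K L
    using Y.fam_A[OF fY] by (simp add: A_eq)
  have cl: "pull Jbar (comps \<omega> c' A) K \<in> X.A" for A K
    by (rule PX.calc.pull_closed) (rule Jbar_A vA)+
  have 1: "comps \<omega> c is = (\<lambda>L. pull Jac (\<lambda>A. pull Jbar (comps \<omega> c' A) L) is)"
    unfolding forms_pull[OF \<omega>] ..
  have "comps (delbar M W \<omega>) c is js = (-1) ^ length is * PX.calc.bar.del_op (comps \<omega> c is) js"
    unfolding PX.delbar_comps_delB[OF Wc(1) fX] PX.calc.delB_def ..
  also have "PX.calc.bar.del_op (comps \<omega> c is) js = pull Jac (\<lambda>A. PX.calc.bar.del_op (pull Jbar (comps \<omega> c' A)) js) is"
    unfolding 1 by (rule PX.calc.bar.del_op_pull_const) (rule Jac_A pdbar_Jac cl)+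
  also have "\<dots> = pull Jac (\<lambda>A. pull Jbar (PY.calc.bar.del_op (comps \<omega> c' A)) js) is"
    by (simp only: ch.del_op_pull[OF form_alternating(2)[OF \<omega>] vA])
  also have "(-1) ^ length is * \<dots> = pull Jac (\<lambda>A. (-1) ^ length is * pull Jbar (PY.calc.bar.del_op (comps \<omega> c' A)) js) is"
    by (rule pull_mult[symmetric])
  also have "\<dots> = pull Jac (\<lambda>A. pull Jbar (PY.calc.delB (comps \<omega> c') A) js) is"
    by (rule pull_cong) (simp only: PY.calc.delB_def[abs_def] pull_mult)
  finally show ?thesis
    unfolding PY.delbar_comps_delB[OF Wc(2) fY] .
qed

end

section \<open>The differentials as operators between spaces of forms\<close>

context poisson_mfd
begin

lemma forms_intro:
  assumes U: "openin (top_of M) U"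
    and na: "\<And>c x is js. c \<notin> atlas M \<Longrightarrow> \<theta> c x is js = 0"
    and len: "\<And>c x is js. c \<in> atlas M \<Longrightarrow> length is \<noteq> p \<or> length js \<noteq> q \<Longrightarrow> comps \<theta> c is js = 0"
    and fam: "\<And>c. c \<in> atlas M \<Longrightarrow> chart_domain.fam M c (U \<inter> dom_of c) (comps \<theta> c)"
    and alt1: "\<And>c js. c \<in> atlas M \<Longrightarrow> alternating (\<lambda>is. comps \<theta> c is js)"
    and alt2: "\<And>c is. c \<in> atlas M \<Longrightarrow> alternating (comps \<theta> c is)"
    and tr: "\<And>c c' W x is js. c \<in> atlas M \<Longrightarrow> c' \<in> atlas M \<Longrightarrow> W = U \<inter> dom_of c \<inter> dom_of c' \<Longrightarrow> poisson_change M \<pi> c c' W \<Longrightarrow>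
      x \<in> W \<Longrightarrow> is \<in> multi_ind M p \<Longrightarrow> js \<in> multi_ind M q \<Longrightarrow>
      \<theta> c x is js = pull (\<lambda>a i. dz c i (coord c' a) x)
        (\<lambda>A. pull (\<lambda>a i. cnj (dz c i (coord c' a) x)) (\<theta> c' x A) js) is"
  shows "\<theta> \<in> forms M U p q"
  unfolding forms_iff
proof (intro conjI allI impI ballI)
  fix c x "is" js
  assume *: "\<not> (c \<in> atlas M \<and> x \<in> U \<inter> dom_of c \<and> is \<in> multi_ind M p \<and> js \<in> multi_ind M q)"
  show "\<theta> c x is js = 0"
  proof (cases "c \<in> atlas M")
    case c: True
    interpret poisson_chart M \<pi> c "U \<inter> dom_of c" by (rule poisson_chart_inter[OF U c])
    consider "x \<notin> U \<inter> dom_of c" | "\<not> (set is \<subseteq> ind M \<and> set js \<subseteq> ind M)" | "length is \<noteq> p \<or> length js \<noteq> q"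
      using * c by (auto simp: multi_ind_def)
    then have "comps \<theta> c is js x = 0"
    proof cases
      case 1
      then show ?thesis by (rule A_zero[OF fam_A[OF fam[OF c]]])
    qed (simp_all only: fam_zero[OF fam[OF c]] len[OF c] zero_fun_apply not_False_eq_True)
    then show ?thesis by (simp add: comps_def)
  qed (rule na)
next
  fix c x js
  show "alternating (\<lambda>is. \<theta> c x is js)"
    using alternating_apply[OF alt1[of c js], of x] by (cases "c \<in> atlas M") (auto simp: comps_def na alternating_zero)
next
  fix c x "is"
  show "alternating (\<theta> c x is)"
  proof (cases "c \<in> atlas M")
    case True
    then show ?thesis
      using alternating_apply[OF alt2[of c "is"], of x] by (simp add: comps_def)
  next
    case False
    then have "\<theta> c x is = (\<lambda>K. 0)" by (auto simp: na)
    then show ?thesis by (simp only: alternating_zero)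
  qed
next
  fix c "is" js assume c: "c \<in> atlas M"
  interpret poisson_chart M \<pi> c "U \<inter> dom_of c" by (rule poisson_chart_inter[OF U c])
  show "smooth_in (ind M) c (U \<inter> dom_of c) (\<lambda>x. \<theta> c x is js)"
    using A_smooth[OF fam_A[OF fam[OF c], of "is" js]] by (simp add: comps_def[abs_def])
next
  fix c c' x "is" js
  assume *: "c \<in> atlas M" "c' \<in> atlas M" "x \<in> U \<inter> dom_of c \<inter> dom_of c'" "is \<in> multi_ind M p" "js \<in> multi_ind M q"
  have "poisson_change M \<pi> c c' (U \<inter> dom_of c \<inter> dom_of c')"
    by unfold_locales (use * U in \<open>auto intro: openin_Int chart_open\<close>)
  then show "\<theta> c x is js = pull (\<lambda>a i. dz c i (coord c' a) x)
        (\<lambda>A. pull (\<lambda>a i. cnj (dz c i (coord c' a) x)) (\<theta> c' x A) js) is"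
    using * tr by blast
qed

text \<open>The change of charts is carried out for forms on an open set inside both charts, whereas
  a differential is formed on a larger set. As differentials are compatible with restriction, the
  law at \<open>x\<close> can be taken from the overlap.\<close>

lemma transform_from_overlap:
  assumes ch: "poisson_change M \<pi> c c' W" and x: "x \<in> W" "is \<in> multi_ind M p" "js \<in> multi_ind M q"
    and eq: "rs W \<theta> = \<zeta>"
    and pull: "comps \<zeta> c is js = pull (chart_change.Jac M c c' W) (\<lambda>A. pull (chart_change.Jbar M c c' W) (comps \<zeta> c' A) js) is"
  shows "\<theta> c x is js = pull (\<lambda>a i. dz c i (coord c' a) x)
        (\<lambda>A. pull (\<lambda>a i. cnj (dz c i (coord c' a) x)) (\<theta> c' x A) js) is"
proof -
  interpret poisson_change M \<pi> c c' W by (rule ch)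
  have "\<zeta> c'' x A B = \<theta> c'' x A B" for c'' A B
    using x by (simp add: eq[symmetric] rs_def)
  then have "\<zeta> c'' x = \<theta> c'' x" for c''
    by blast
  then show ?thesis
    using forms_pullD[OF pull x] by simp
qed

lemma del_pi_forms:
  assumes U: "openin (top_of M) U" and \<omega>: "\<omega> \<in> forms M U (Suc p) q"
  shows "del_pi M \<pi> U \<omega> \<in> forms M U p q"
proof (rule forms_intro[OF U])
  show "del_pi M \<pi> U \<omega> c x is js = 0" if "c \<notin> atlas M" for c x "is" js
    using nonatlas_del_pi(1) form_nonatlas[OF \<omega> that] that by blast
next
  fix c c' W x "is" js
  assume *: "c \<in> atlas M" "c' \<in> atlas M" "W = U \<inter> dom_of c \<inter> dom_of c'" "poisson_change M \<pi> c c' W"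
    "x \<in> W" "is \<in> multi_ind M p" "js \<in> multi_ind M q"
  interpret poisson_change M \<pi> c c' W by (rule *)
  have WU: "W \<subseteq> U" using * by auto
  show "del_pi M \<pi> U \<omega> c x is js = pull (\<lambda>a i. dz c i (coord c' a) x)
        (\<lambda>A. pull (\<lambda>a i. cnj (dz c i (coord c' a) x)) (del_pi M \<pi> U \<omega> c' x A) js) is"
    by (rule transform_from_overlap[OF *(4-7) del_pi_rs[OF Wop WU]]) (rule del_pi_pull[OF forms_rs[OF U Wop WU \<omega>]])
next
  fix c :: "('a, 'n) chart" assume c: "c \<in> atlas M"
  interpret poisson_chart M \<pi> c "U \<inter> dom_of c" by (rule poisson_chart_inter[OF U c])
  have f: "fam (comps \<omega> c)" by (rule form_fam[OF U c \<omega>])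
  note eq = del_pi_comps[OF refl f]
  show "fam (comps (del_pi M \<pi> U \<omega>) c)"
    unfolding eq by (rule fam_delP[OF f])
  show "comps (del_pi M \<pi> U \<omega>) c is js = 0" if "length is \<noteq> p \<or> length js \<noteq> q" for "is" js
  proof (cases "length js = q")
    case True
    show ?thesis
      unfolding eq calc.delP_def using that True form_length[OF \<omega>]
      by (intro calc.delp_length[of p]) (auto simp: comps_def fun_eq_iff)
  next
    case False
    then have "(\<lambda>K. comps \<omega> c K js) = (\<lambda>K. 0)"
      using form_length[OF \<omega>] by (auto simp: comps_def fun_eq_iff)
    then show ?thesis
      using calc.delp_minus[of "\<lambda>K. 0" "is"] unfolding eq calc.delP_def
      by (simp add: calc.delp_def con_def calc.del_op_def)
  qed
  show "alternating (\<lambda>is. comps (del_pi M \<pi> U \<omega>) c is js)" for js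
    unfolding eq calc.delP_def by (intro calc.alternating_delp form_alternating[OF \<omega>] fam_A[OF f])
  show "alternating (comps (del_pi M \<pi> U \<omega>) c is)" for "is"
    unfolding alternating_def
  proof (intro allI)
    fix xs a b ys
    have "(\<lambda>K. comps \<omega> c K (xs @ b # a # ys)) = (\<lambda>K. - comps \<omega> c K (xs @ a # b # ys))"
      by (intro ext alternatingD[OF form_alternating(2)[OF \<omega>], THEN fun_cong])
    then show "comps (del_pi M \<pi> U \<omega>) c is (xs @ b # a # ys) = - comps (del_pi M \<pi> U \<omega>) c is (xs @ a # b # ys)"
      unfolding eq calc.delP_def by (simp add: calc.delp_minus fam_A[OF f])
  qed
qed

lemma delbar_forms:
  assumes U: "openin (top_of M) U" and \<omega>: "\<omega> \<in> forms M U p q"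
  shows "delbar M U \<omega> \<in> forms M U p (Suc q)"
proof (rule forms_intro[OF U])
  show "delbar M U \<omega> c x is js = 0" if "c \<notin> atlas M" for c x "is" js
    using that by (simp add: delbar_def)
next
  fix c c' W x "is" js
  assume *: "c \<in> atlas M" "c' \<in> atlas M" "W = U \<inter> dom_of c \<inter> dom_of c'" "poisson_change M \<pi> c c' W"
    "x \<in> W" "is \<in> multi_ind M p" "js \<in> multi_ind M (Suc q)"
  interpret poisson_change M \<pi> c c' W by (rule *)
  have WU: "W \<subseteq> U" using * by auto
  show "delbar M U \<omega> c x is js = pull (\<lambda>a i. dz c i (coord c' a) x)
        (\<lambda>A. pull (\<lambda>a i. cnj (dz c i (coord c' a) x)) (delbar M U \<omega> c' x A) js) is"
    by (rule transform_from_overlap[OF *(4-7) del_rs(2)[OF Wop WU]]) (rule delbar_pull[OF forms_rs[OF U Wop WU \<omega>]])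
next
  fix c :: "('a, 'n) chart" assume c: "c \<in> atlas M"
  interpret poisson_chart M \<pi> c "U \<inter> dom_of c" by (rule poisson_chart_inter[OF U c])
  have f: "fam (comps \<omega> c)" by (rule form_fam[OF U c \<omega>])
  note eq = delbar_comps_delB[OF refl f]
  show "fam (comps (delbar M U \<omega>) c)"
    unfolding eq by (rule fam_delB[OF f])
  show "comps (delbar M U \<omega>) c is js = 0" if "length is \<noteq> p \<or> length js \<noteq> Suc q" for "is" js
  proof -
    have "calc.bar.del_op (comps \<omega> c is) js = 0"
    proof (cases "length is = p")
      case True
      then show ?thesis
        using that form_length[OF \<omega>] by (intro calc.bar.del_op_length[of q]) (auto simp: comps_def fun_eq_iff)
    next
      case False
      then have "comps \<omega> c is = (\<lambda>K. 0)"
        using form_length[OF \<omega>] by (auto simp: comps_def fun_eq_iff)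
      then show ?thesis by (simp add: calc.bar.del_op_def)
    qed
    then show ?thesis
      unfolding eq calc.delB_def by simp
  qed
  have alt: "alternating (calc.bar.del_op (comps \<omega> c is))" for "is"
    by (intro calc.bar.alternating_del_op form_alternating[OF \<omega>] fam_A[OF f])
  show "alternating (comps (delbar M U \<omega>) c is)" for "is"
    unfolding eq calc.delB_def[abs_def] by (rule alternating_mult[OF alt])
  show "alternating (\<lambda>is. comps (delbar M U \<omega>) c is js)" for js
    unfolding alternating_def
  proof (intro allI)
    fix xs a b ys
    have "comps \<omega> c (xs @ b # a # ys) = (\<lambda>L. - comps \<omega> c (xs @ a # b # ys) L)"
      by (intro ext alternatingD[OF form_alternating(1)[OF \<omega>], THEN fun_cong])
    then show "comps (delbar M U \<omega>) c (xs @ b # a # ys) js = - comps (delbar M U \<omega>) c (xs @ a # b # ys) js"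
      unfolding eq calc.delB_def calc.bar.del_op_def
      by (simp add: calc.bar.d_minus fam_A[OF f] asum_minus)
  qed
qed

lemma del_pi_diff:
  assumes U: "openin (top_of M) U" and \<omega>: "\<omega> \<in> forms M U p q" and \<eta>: "\<eta> \<in> forms M U p q"
  shows "del_pi M \<pi> U (\<omega> - \<eta>) = del_pi M \<pi> U \<omega> - del_pi M \<pi> U \<eta>"
    "delbar M U (\<omega> - \<eta>) = delbar M U \<omega> - delbar M U \<eta>"
proof -
  have na: "(\<omega> - \<eta>) c x is js = 0" "\<omega> c x is js = 0" "\<eta> c x is js = 0" if "c \<notin> atlas M" for c x "is" js
    using form_nonatlas[OF \<omega> that] form_nonatlas[OF \<eta> that] by auto
  show "del_pi M \<pi> U (\<omega> - \<eta>) = del_pi M \<pi> U \<omega> - del_pi M \<pi> U \<eta>"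
  proof (rule form_eqI)
    fix c "is" js assume c: "c \<in> atlas M"
    interpret poisson_chart M \<pi> c "U \<inter> dom_of c" by (rule poisson_chart_inter[OF U c])
    note f = form_fam[OF U c \<omega>] form_fam[OF U c \<eta>] form_fam[OF U c forms_diff[OF U \<omega> \<eta>]]
    show "comps (del_pi M \<pi> U (\<omega> - \<eta>)) c is js = comps (del_pi M \<pi> U \<omega> - del_pi M \<pi> U \<eta>) c is js"
      unfolding comps_diff[of "del_pi M \<pi> U \<omega>"] del_pi_comps[OF refl f(1)] del_pi_comps[OF refl f(2)] del_pi_comps[OF refl f(3)]
      unfolding comps_diff calc.delP_def by (rule calc.delp_diff) (rule fam_A[OF f(1)] fam_A[OF f(2)])+
  qed (simp add: nonatlas_del_pi na)
  show "delbar M U (\<omega> - \<eta>) = delbar M U \<omega> - delbar M U \<eta>"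
  proof (rule form_eqI)
    fix c "is" js assume c: "c \<in> atlas M"
    interpret poisson_chart M \<pi> c "U \<inter> dom_of c" by (rule poisson_chart_inter[OF U c])
    note f = form_fam[OF U c \<omega>] form_fam[OF U c \<eta>] form_fam[OF U c forms_diff[OF U \<omega> \<eta>]]
    show "comps (delbar M U (\<omega> - \<eta>)) c is js = comps (delbar M U \<omega> - delbar M U \<eta>) c is js"
      unfolding comps_diff[of "delbar M U \<omega>"] delbar_comps_delB[OF refl f(1)] delbar_comps_delB[OF refl f(2)] delbar_comps_delB[OF refl f(3)]
      unfolding comps_diff by (rule calc.delB_diff) (rule fam_A[OF f(1)] fam_A[OF f(2)])+
  qed (simp add: nonatlas_del_pi na)
qed

lemma differentials_square:
  assumes U: "openin (top_of M) U"
  shows "\<omega> \<in> forms M U (Suc (Suc p)) q \<Longrightarrow> del_pi M \<pi> U (del_pi M \<pi> U \<omega>) = 0" (is "_ \<Longrightarrow> ?A")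
    and "\<omega> \<in> forms M U p q \<Longrightarrow> delbar M U (delbar M U \<omega>) = 0" (is "_ \<Longrightarrow> ?B")
    and "\<omega> \<in> forms M U (Suc p) q \<Longrightarrow> del_pi M \<pi> U (delbar M U \<omega>) + delbar M U (del_pi M \<pi> U \<omega>) = 0" (is "_ \<Longrightarrow> ?C")
proof -
  have na: "del_pi M \<pi> U (del_pi M \<pi> U \<omega>) c x is js = 0" "delbar M U (delbar M U \<omega>) c x is js = 0"
    "del_pi M \<pi> U (delbar M U \<omega>) c x is js = 0" "delbar M U (del_pi M \<pi> U \<omega>) c x is js = 0"
    if "c \<notin> atlas M" "\<omega> \<in> forms M U p q" for c x "is" js p q
    using that form_nonatlas[OF that(2,1)] by (simp_all add: nonatlas_del_pi)
  have z: "comps 0 c is js = 0" for c :: "('a, 'n) chart" and "is" js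
    by (simp add: comps_def fun_eq_iff)
  show ?A if \<omega>: "\<omega> \<in> forms M U (Suc (Suc p)) q"
  proof (rule form_eqI)
    fix c "is" js assume c: "c \<in> atlas M"
    interpret poisson_chart M \<pi> c "U \<inter> dom_of c" by (rule poisson_chart_inter[OF U c])
    note f = form_fam[OF U c \<omega>] form_fam[OF U c del_pi_forms[OF U \<omega>]]
    show "comps (del_pi M \<pi> U (del_pi M \<pi> U \<omega>)) c is js = comps 0 c is js"
      unfolding del_pi_comps[OF refl f(2)] del_pi_comps[OF refl f(1)] calc.delP_def z
      by (rule calc.delp_delp[OF fam_A[OF f(1)] form_alternating(1)[OF \<omega>]])
  qed (use na \<omega> in auto)
  show ?B if \<omega>: "\<omega> \<in> forms M U p q"
  proof (rule form_eqI)
    fix c "is" js assume c: "c \<in> atlas M"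
    interpret poisson_chart M \<pi> c "U \<inter> dom_of c" by (rule poisson_chart_inter[OF U c])
    note f = form_fam[OF U c \<omega>] form_fam[OF U c delbar_forms[OF U \<omega>]]
    show "comps (delbar M U (delbar M U \<omega>)) c is js = comps 0 c is js"
      unfolding delbar_comps_delB[OF refl f(2)] delbar_comps_delB[OF refl f(1)] z
      by (rule calc.delB_delB[OF fam_A[OF f(1)]])
  qed (use na \<omega> in auto)
  show ?C if \<omega>: "\<omega> \<in> forms M U (Suc p) q"
  proof (rule form_eqI)
    fix c "is" js assume c: "c \<in> atlas M"
    interpret poisson_chart M \<pi> c "U \<inter> dom_of c" by (rule poisson_chart_inter[OF U c])
    note f = form_fam[OF U c \<omega>] form_fam[OF U c delbar_forms[OF U \<omega>]] form_fam[OF U c del_pi_forms[OF U \<omega>]]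
    have "comps (del_pi M \<pi> U (delbar M U \<omega>) + delbar M U (del_pi M \<pi> U \<omega>)) c is js
        = comps (del_pi M \<pi> U (delbar M U \<omega>)) c is js + comps (delbar M U (del_pi M \<pi> U \<omega>)) c is js"
      by (simp add: comps_def fun_eq_iff)
    also have "\<dots> = 0"
      unfolding del_pi_comps[OF refl f(2)] delbar_comps_delB[OF refl f(3)]
        del_pi_comps[OF refl f(1)] delbar_comps_delB[OF refl f(1)]
      by (rule calc.delP_delB[OF fam_A[OF f(1)]])
    finally show "comps (del_pi M \<pi> U (delbar M U \<omega>) + delbar M U (del_pi M \<pi> U \<omega>)) c is js = comps 0 c is js"
      unfolding z .
  qed (use na \<omega> in auto)
qed

end

section \<open>Bump functions\<close>

text \<open>The functions \<open>t^(-n) * exp (-1/t)\<close> for positive \<open>t\<close>, extended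
  by zero. Each derivative is a combination of two members of the family, so smoothness of
  \<open>flat 0\<close>, the one used for bumps, follows by an induction that stays inside
  it.\<close>

definition flat :: "nat \<Rightarrow> real \<Rightarrow> real" where
  "flat n t = (if t \<le> 0 then 0 else inverse t ^ n * exp (- inverse t))"

lemma power_le_fact_exp:
  fixes x :: real
  assumes "x \<ge> 0"
  shows "x ^ m \<le> fact m * exp x"
proof -
  have "(\<Sum>n\<in>{m}. x ^ n /\<^sub>R fact n) \<le> (\<Sum>n. x ^ n /\<^sub>R fact n)"
    by (rule sum_le_suminf[OF summable_exp_generic]) (use assms in auto)
  then have "x ^ m /\<^sub>R fact m \<le> exp x"
    by (simp add: exp_def)
  then show ?thesis
    by (simp add: divide_simps mult.commute)
qed

text \<open>One term of the exponential series at \<open>inverse h\<close>, with exponent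
  \<open>n + 2\<close>: the two extra powers survive as the square of \<open>h\<close>, which makes
  the difference quotient at zero tend to zero.\<close>

lemma flat_bound: "\<bar>flat n h\<bar> \<le> fact (n + 2) * h\<^sup>2"
proof (cases "h \<le> 0")
  case False
  then have h: "h > 0" by simp
  have "inverse h ^ (n + 2) * exp (- inverse h) \<le> fact (n + 2)"
    using power_le_fact_exp[of "inverse h" "n + 2"] h
    unfolding exp_minus divide_inverse[symmetric] by (subst pos_divide_le_eq) auto
  then have "h\<^sup>2 * (inverse h ^ (n + 2) * exp (- inverse h)) \<le> h\<^sup>2 * fact (n + 2)"
    by (rule mult_left_mono) simp
  moreover have "h\<^sup>2 * (inverse h ^ (n + 2) * exp (- inverse h)) = flat n h"
    using h by (simp add: flat_def power_add power2_eq_square field_simps)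
  moreover have "flat n h \<ge> 0"
    using h by (simp add: flat_def)
  ultimately show ?thesis
    by (simp add: mult.commute)
qed (simp add: flat_def)

text \<open>For positive \<open>t\<close> this is the product rule; at zero
  \<open>flat_bound\<close> dominates the difference quotient by a multiple of
  \<open>\<bar>h\<bar>\<close>.\<close>

lemma flat_deriv: "(flat n has_real_derivative flat (n + 2) t - real n * flat (n + 1) t) (at t)"
proof -
  consider "t < 0" | "t = 0" | "t > 0" by linarith
  then show ?thesis
  proof cases
    case 1
    have "((\<lambda>t. 0) has_real_derivative 0) (at t)" by simp
    then have "(flat n has_real_derivative 0) (at t)"
      by (rule has_field_derivative_transform_within_open[where S = "{..<0}"]) (use 1 in \<open>auto simp: flat_def\<close>)
    then show ?thesis using 1 by (simp add: flat_def)
  next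
    case 2
    have "((\<lambda>h. (flat n (0 + h) - flat n 0) / h) \<longlongrightarrow> 0) (at 0)"
    proof (rule Lim_null_comparison)
      show "eventually (\<lambda>h. norm ((flat n (0 + h) - flat n 0) / h) \<le> fact (n + 2) * \<bar>h\<bar>) (at 0)"
      proof (rule eventually_at_topological[THEN iffD2], intro exI[of _ UNIV] conjI ballI impI)
        fix h :: real assume "h \<noteq> 0"
        then show "norm ((flat n (0 + h) - flat n 0) / h) \<le> fact (n + 2) * \<bar>h\<bar>"
          using flat_bound[of n h] by (simp add: flat_def[of n 0] abs_divide divide_le_eq power2_eq_square abs_mult[symmetric] mult.assoc)
      qed auto
      show "((\<lambda>h. fact (n + 2) * \<bar>h\<bar>) \<longlongrightarrow> (0::real)) (at 0)"
        by (auto intro!: tendsto_eq_intros)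
    qed
    then show ?thesis
      using 2 by (simp add: DERIV_def flat_def)
  next
    case 3
    then have inv: "(inverse has_real_derivative - (inverse t ^ Suc (Suc 0))) (at t)"
      by (intro DERIV_inverse) auto
    have "((\<lambda>t. inverse t ^ n * exp (- inverse t)) has_real_derivative
      flat (n + 2) t - real n * flat (n + 1) t) (at t)"
      by (rule DERIV_cong[OF DERIV_mult[OF DERIV_power[OF inv] DERIV_fun_exp[OF DERIV_minus[OF inv]]]])
        (cases n; use 3 in \<open>simp add: flat_def algebra_simps\<close>)
    then show ?thesis
      by (rule has_field_derivative_transform_within_open[where S = "{0<..}"]) (use 3 in \<open>auto simp: flat_def\<close>)
  qed
qed

context model_set
begin

text \<open>The induction has to range over \<open>n\<close>, since a derivative of the function
  with index \<open>n\<close> involves the indices \<open>n + 1\<close> and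
  \<open>n + 2\<close>.\<close>

lemma C_flat:
  assumes Q: "smooth (\<lambda>z. complex_of_real (Q z))"
  shows "C k (\<lambda>z. complex_of_real (flat n (Q z)))"
proof (induction k arbitrary: n)
  case 0
  have "continuous_on W (\<lambda>z. complex_of_real (Q z))"
    using Q unfolding smooth_def by (metis Ck.simps(1))
  from continuous_on_Re[OF this] have "continuous_on W Q" by simp
  moreover have cf: "continuous_on UNIV (flat n)"
    by (rule DERIV_continuous_on, rule DERIV_subset, rule flat_deriv) auto
  ultimately have "continuous_on W (\<lambda>z. flat n (Q z))"
    by (intro continuous_on_compose2[OF cf]) auto
  then show ?case
    by (auto intro: continuous_on_of_real)
next
  case (Suc k)
  have deriv: "\<exists>Q'. ((\<lambda>z. complex_of_real (Q z)) has_derivative (\<lambda>v. complex_of_real (Q' v))) (at z within W) \<and>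
      ((\<lambda>z. complex_of_real (flat n (Q z))) has_derivative
        (\<lambda>v. complex_of_real (Q' v * (flat (n + 2) (Q z) - real n * flat (n + 1) (Q z))))) (at z within W)"
    if z: "z \<in> W" for z
  proof -
    obtain q where q: "((\<lambda>z. complex_of_real (Q z)) has_derivative q) (at z within W)"
      using smooth_differentiable[OF Q z] unfolding differentiable_def by blast
    have Q': "(Q has_derivative (\<lambda>v. Re (q v))) (at z within W)"
      using has_derivative_Re[OF q] by simp
    have 1: "((\<lambda>z. flat n (Q z)) has_derivative (\<lambda>v. Re (q v) * (flat (n + 2) (Q z) - real n * flat (n + 1) (Q z)))) (at z within W)"
      using DERIV_compose_FDERIV[OF flat_deriv Q'] .
    show ?thesis
      by (intro exI[of _ "\<lambda>v. Re (q v)"] conjI has_derivative_of_real[OF Q'] has_derivative_of_real[OF 1])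
  qed
  have IH: "C k (\<lambda>z. complex_of_real (flat m (Q z)))" for m
    by (rule Suc.IH)
  show ?case
  proof (rule C_SucI[where D = "\<lambda>v z. dir_deriv v (\<lambda>z. complex_of_real (Q z)) z *
      (complex_of_real (flat (n + 2) (Q z)) + (- of_nat n) * complex_of_real (flat (n + 1) (Q z)))"])
    show "(\<lambda>z. complex_of_real (flat n (Q z))) differentiable (at z within W)" if "z \<in> W" for z
      using deriv[OF that] unfolding differentiable_def by blast
    show "C k (\<lambda>z. dir_deriv v (\<lambda>z. complex_of_real (Q z)) z *
      (complex_of_real (flat (n + 2) (Q z)) + (- of_nat n) * complex_of_real (flat (n + 1) (Q z))))"
      if "v \<in> model_space I" for v
      using smooth_dir_deriv[OF Q that] unfolding smooth_def
      by (intro C_mult C_add C_const IH) blast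
    show "dir_deriv v (\<lambda>z. complex_of_real (flat n (Q z))) z = dir_deriv v (\<lambda>z. complex_of_real (Q z)) z *
      (complex_of_real (flat (n + 2) (Q z)) + (- of_nat n) * complex_of_real (flat (n + 1) (Q z)))"
      if vz: "v \<in> model_space I" "z \<in> W" for v z
    proof -
      obtain Q' where Q': "((\<lambda>z. complex_of_real (Q z)) has_derivative (\<lambda>v. complex_of_real (Q' v))) (at z within W)"
        "((\<lambda>z. complex_of_real (flat n (Q z))) has_derivative
          (\<lambda>v. complex_of_real (Q' v * (flat (n + 2) (Q z) - real n * flat (n + 1) (Q z))))) (at z within W)"
        using deriv[OF vz(2)] by blast
      show ?thesis
        using dir_deriv_eq[OF Q'(1) vz(2,1)] dir_deriv_eq[OF Q'(2) vz(2,1)] by simp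
    qed
  qed
qed

text \<open>The squared norm is a polynomial in the coordinates and their conjugates.\<close>

lemma smooth_norm: "smooth (\<lambda>z. complex_of_real ((norm (z - w))\<^sup>2))"
proof -
  have "complex_of_real ((norm (z - w))\<^sup>2) = (\<Sum>a\<in>UNIV. (z $ a + (- (w $ a))) * cnj (z $ a + (- (w $ a))))" for z
    by (simp add: norm_vec_def L2_set_def sum_nonneg complex_norm_square[symmetric] del: of_real_power complex_cnj_diff)
  moreover have "smooth (\<lambda>z. \<Sum>a\<in>UNIV. (z $ a + (- (w $ a))) * cnj (z $ a + (- (w $ a))))"
    by (intro smooth_sum smooth_mult smooth_linear[OF bounded_linear_cnj] smooth_add smooth_nth smooth_const)
  ultimately show ?thesis by simp
qed

text \<open>The classical quotient \<open>f1 / (f1 + f2)\<close>, where \<open>f1\<close> is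
  positive inside radius \<open>R\<close> and \<open>f2\<close> outside radius \<open>r\<close>.
  Squared norms are used because the norm itself is not smooth at the centre.\<close>

lemma bump_exists:
  assumes rR: "0 < r" "r < R"
  obtains B where "smooth B" "\<And>z. norm (z - w) \<le> r \<Longrightarrow> B z = 1" "\<And>z. norm (z - w) \<ge> R \<Longrightarrow> B z = 0"
proof
  let ?f1 = "\<lambda>z. flat 0 (R\<^sup>2 - (norm (z - w))\<^sup>2)" and ?f2 = "\<lambda>z. flat 0 ((norm (z - w))\<^sup>2 - r\<^sup>2)"
  let ?B = "\<lambda>z. complex_of_real (?f1 z) * inverse (complex_of_real (?f1 z) + complex_of_real (?f2 z))"
  have pos: "flat 0 t > 0 \<longleftrightarrow> t > 0" and nonneg: "flat 0 t \<ge> 0" for t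
    by (auto simp: flat_def)
  \<comment> \<open>As \<open>r < R\<close>, no point is at distance at least \<open>R\<close> and
    at most \<open>r\<close> at the same time.\<close>
  have "?f1 z + ?f2 z > 0" for z
  proof (cases "norm (z - w) \<le> r")
    case True
    then have "norm (z - w) < R" using rR by simp
    then have "(norm (z - w))\<^sup>2 < R\<^sup>2"
      by (simp add: power_strict_mono)
    then have "?f1 z > 0" by (simp add: pos)
    then show ?thesis using nonneg[of "(norm (z - w))\<^sup>2 - r\<^sup>2"] by linarith
  next
    case False
    then have "r\<^sup>2 < (norm (z - w))\<^sup>2" using rR by (intro power_strict_mono) auto
    then have "?f2 z > 0" by (simp add: pos)
    then show ?thesis using nonneg[of "R\<^sup>2 - (norm (z - w))\<^sup>2"] by linarith
  qed
  then have nz: "complex_of_real (?f1 z) + complex_of_real (?f2 z) \<noteq> 0" for z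
    unfolding of_real_add[symmetric] of_real_eq_0_iff by (rule less_imp_neq[symmetric])
  have s1: "smooth (\<lambda>z. complex_of_real (R\<^sup>2 - (norm (z - w))\<^sup>2))"
  proof -
    have "smooth (\<lambda>z. complex_of_real (R\<^sup>2) + (- 1) * complex_of_real ((norm (z - w))\<^sup>2))"
      by (intro smooth_add smooth_mult smooth_const smooth_norm)
    then show ?thesis by simp
  qed
  have s2: "smooth (\<lambda>z. complex_of_real ((norm (z - w))\<^sup>2 - r\<^sup>2))"
  proof -
    have "smooth (\<lambda>z. complex_of_real ((norm (z - w))\<^sup>2) + (- complex_of_real (r\<^sup>2)))"
      by (intro smooth_add smooth_const smooth_norm)
    then show ?thesis by simp
  qed
  have f: "smooth (\<lambda>z. complex_of_real (?f1 z))" "smooth (\<lambda>z. complex_of_real (?f2 z))"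
    using C_flat[OF s1] C_flat[OF s2] unfolding smooth_def by blast+
  show "smooth ?B"
    using nz by (intro smooth_mult smooth_inverse smooth_add f)
  show "?B z = 1" if "norm (z - w) \<le> r" for z
  proof -
    have "(norm (z - w))\<^sup>2 \<le> r\<^sup>2"
      using that by (intro power_mono) auto
    then have "?f2 z = 0"
      by (simp add: flat_def)
    then show ?thesis using nz[of z] by simp
  qed
  show "?B z = 0" if "norm (z - w) \<ge> R" for z
  proof -
    have "R\<^sup>2 \<le> (norm (z - w))\<^sup>2"
      using that rR by (intro power_mono) auto
    then have "?f1 z = 0" by (simp add: flat_def)
    then show ?thesis by simp
  qed
qed

end

section \<open>Partitions of unity for two open sets\<close>

lemma closed_model_space: "closed (model_space I)"
proof -
  have "model_space I = (\<Inter>i\<in>-I. {z. z $ i = 0})"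
    by (auto simp: model_space_def)
  then show ?thesis
    by (auto intro!: closed_INT closed_Collect_eq continuous_intros)
qed

context chart_domain
begin

lemma smooth_in_sum: "(\<And>n. n \<in> B \<Longrightarrow> smooth_in (ind M) c W (f n)) \<Longrightarrow> smooth_in (ind M) c W (\<lambda>x. \<Sum>n\<in>B. f n x)"
  by (induction B rule: infinite_finite_induct) (auto intro: smooth_in_add smooth_in_const)

lemma smooth_in_prod: "(\<And>n. n \<in> B \<Longrightarrow> smooth_in (ind M) c W (f n)) \<Longrightarrow> smooth_in (ind M) c W (\<lambda>x. \<Prod>n\<in>B. f n x)"
  by (induction B rule: infinite_finite_induct) (auto intro: smooth_in_mult smooth_in_const)

lemma smooth_in_one_minus: "smooth_in (ind M) c W f \<Longrightarrow> smooth_in (ind M) c W (\<lambda>x. 1 - f x)"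
  by (rule smooth_in_cong[OF smooth_in_add[OF smooth_in_const[of 1] smooth_in_mult[OF smooth_in_const[of "-1"]]]]) auto

end

context cmfd
begin

lemma chart_domain_I: "c \<in> atlas M \<Longrightarrow> openin (top_of M) W \<Longrightarrow> W \<subseteq> dom_of c \<Longrightarrow> chart_domain M c W"
  by unfold_locales

lemma chart_exists: "openin (top_of M) U \<Longrightarrow> x \<in> U \<Longrightarrow> \<exists>c\<in>atlas M. x \<in> dom_of c"
  using M openin_subset[of "top_of M" U] unfolding complex_manifold_def by auto

text \<open>The set is the image of a compact set under the inverse of the chart, hence compact,
  hence closed in a Hausdorff space. This rules out that the support of a bump accumulates at points
  outside the chart.\<close>

lemma chart_compact_closed:
  assumes c: "c \<in> atlas M" and K: "compact K" "K \<subseteq> snd c ` dom_of c"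
  shows "closedin (top_of M) {y \<in> dom_of c. snd c y \<in> K}"
proof -
  obtain g where g: "homeomorphic_maps (subtopology (top_of M) (dom_of c)) (top_of_set (snd c ` dom_of c)) (snd c) g"
    using chart_homeo[OF c] homeomorphic_map_maps by blast
  have top: "topspace (subtopology (top_of M) (dom_of c)) = dom_of c"
    using chart_open[OF c, THEN openin_subset] by (simp add: topspace_subtopology Int_absorb1)
  have gK: "g ` K = {y \<in> dom_of c. snd c y \<in> K}"
  proof -
    have gs: "g (snd c y) = y" if "y \<in> dom_of c" for y
      using g that unfolding homeomorphic_maps_def top by blast
    show ?thesis
    proof
      show "g ` K \<subseteq> {y \<in> dom_of c. snd c y \<in> K}"
        using K(2) gs by fastforce
      show "{y \<in> dom_of c. snd c y \<in> K} \<subseteq> g ` K"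
        using gs by force
    qed
  qed
  have "compactin (top_of_set (snd c ` dom_of c)) K"
    using K by (simp add: compactin_subtopology)
  then have "compactin (subtopology (top_of M) (dom_of c)) (g ` K)"
    using g unfolding homeomorphic_maps_def by (blast intro: image_compactin)
  then have "compactin (top_of M) (g ` K)"
    by (simp add: compactin_subtopology)
  moreover have "Hausdorff_space (top_of M)"
    using M by (simp add: complex_manifold_def)
  ultimately show ?thesis
    unfolding gK by (rule compactin_imp_closedin[rotated])
qed

text \<open>A bump is transplanted from a chart and extended by zero. Its smoothness outside
  \<open>W\<close> comes from the closedness of \<open>C\<close>: off \<open>C\<close> it is zero on
  an open set.\<close>

lemma manifold_bump:
  assumes U: "openin (top_of M) U" and x: "x \<in> U"
  obtains b :: "'a \<Rightarrow> complex" and N C where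
    "\<And>c. c \<in> atlas M \<Longrightarrow> smooth_in (ind M) c (dom_of c) b"
    "openin (top_of M) N" "x \<in> N" "\<And>y. y \<in> N \<Longrightarrow> b y = 1"
    "closedin (top_of M) C" "C \<subseteq> U" "\<And>y. y \<notin> C \<Longrightarrow> b y = 0"
proof -
  obtain c where c: "c \<in> atlas M" "x \<in> dom_of c"
    using chart_exists[OF U x] by blast
  define W where "W = U \<inter> dom_of c"
  have Wop: "openin (top_of M) W"
    unfolding W_def by (intro openin_Int U chart_open c)
  interpret X: chart_domain M c W
    by (rule chart_domain_I) (use c Wop in \<open>auto simp: W_def\<close>)
  let ?w = "snd c x"
  have xW: "x \<in> W" using x c by (simp add: W_def)
  then obtain e where e: "e > 0" "ball ?w e \<inter> model_space (ind M) \<subseteq> snd c ` W"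
    using X.m.opn by (auto simp: openin_contains_ball)
  \<comment> \<open>Half of \<open>e\<close> keeps the part of the closed ball of radius
    \<open>R\<close> in the model space, which carries the support, inside the chart image.\<close>
  define R where "R = e / 2"
  have R: "0 < R / 2" "R / 2 < R" "R < e" using e by (auto simp: R_def)
  obtain B where B: "X.m.smooth B" "\<And>z. norm (z - ?w) \<le> R / 2 \<Longrightarrow> B z = 1" "\<And>z. norm (z - ?w) \<ge> R \<Longrightarrow> B z = 0"
    using X.m.bump_exists[OF R(1,2), of ?w] by blast
  let ?K = "cball ?w R \<inter> model_space (ind M)"
  define C where "C = {y \<in> dom_of c. snd c y \<in> ?K}"
  define N where "N = {y \<in> W. snd c y \<in> ball ?w (R / 2)}"
  define b where "b y = (if y \<in> W then B (snd c y) else 0)" for y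
  have KW: "?K \<subseteq> snd c ` W"
    using e R by auto
  have CW: "C \<subseteq> W"
  proof
    fix y assume "y \<in> C"
    then have "y \<in> dom_of c" "snd c y \<in> snd c ` W"
      using KW by (auto simp: C_def)
    then show "y \<in> W"
      using inj_onD[OF chart_inj[OF c(1)]] X.Wc by blast
  qed
  have Ccl: "closedin (top_of M) C"
    unfolding C_def using KW X.Wc
    by (intro chart_compact_closed[OF c(1)] compact_Int_closed compact_cball closed_model_space) auto
  have b0: "b y = 0" if "y \<notin> C" for y
  proof (cases "y \<in> W")
    case True
    then have "snd c y \<in> model_space (ind M)" "y \<in> dom_of c"
      using model_open_subset[OF X.m.opn] X.Wc by auto
    then have "norm (snd c y - ?w) \<ge> R"
      using that by (auto simp: C_def dist_norm norm_minus_commute)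
    then show ?thesis using B(3) by (simp add: b_def)
  qed (simp add: b_def)
  have smooth_c: "smooth_in (ind M) c W b"
    unfolding X.smooth_in_iff by (rule X.m.smooth_cong[OF B(1)]) (auto simp: X.rep b_def)
  show ?thesis
  proof
    show "smooth_in (ind M) c' (dom_of c') b" if c': "c' \<in> atlas M" for c'
    proof -
      interpret Y: chart_domain M c' "dom_of c'"
        by (rule chart_domain_I[OF c' chart_open[OF c'] order_refl])
      show ?thesis
      proof (rule Y.smooth_in_local)
        fix y assume y: "y \<in> dom_of c'"
        show "\<exists>V. openin (top_of M) V \<and> y \<in> V \<and> V \<subseteq> dom_of c' \<and> smooth_in (ind M) c' V b"
        proof (cases "y \<in> W")
          case True
          interpret Z: chart_change M c' c "W \<inter> dom_of c'"
            by unfold_locales (use c c' Wop X.Wc in \<open>auto intro: openin_Int chart_open\<close>)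
          have "smooth_in (ind M) c (W \<inter> dom_of c') b"
            by (rule X.smooth_in_subset[OF Z.Wop _ smooth_c]) auto
          then have "smooth_in (ind M) c' (W \<inter> dom_of c') b"
            by (rule Z.smooth_transfer)
          then show ?thesis
            using True y Z.Wop by (intro exI[of _ "W \<inter> dom_of c'"]) auto
        next
          case False
          have op: "openin (top_of M) (dom_of c' - C)"
            by (intro openin_diff chart_open c' Ccl)
          interpret Z: chart_domain M c' "dom_of c' - C"
            by (rule chart_domain_I[OF c' op]) auto
          have "smooth_in (ind M) c' (dom_of c' - C) b"
            by (rule Z.smooth_in_cong[OF Z.smooth_in_const[of 0]]) (simp add: b0)
          then show ?thesis
            using False y CW op by (intro exI[of _ "dom_of c' - C"]) auto
        qed
      qed
    qed
    show "openin (top_of M) N"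
    proof -
      have "continuous_map (subtopology (top_of M) (dom_of c)) euclidean (snd c)"
        using homeomorphic_imp_continuous_map[OF chart_homeo[OF c(1)]]
        by (simp add: continuous_map_in_subtopology)
      then have "openin (subtopology (top_of M) (dom_of c)) {y \<in> topspace (subtopology (top_of M) (dom_of c)). snd c y \<in> ball ?w (R / 2)}"
        by (rule openin_continuous_map_preimage) simp
      then have "openin (top_of M) {y \<in> topspace (subtopology (top_of M) (dom_of c)). snd c y \<in> ball ?w (R / 2)}"
        by (rule openin_trans_full[OF _ chart_open[OF c(1)]])
      from openin_Int[OF this Wop] show ?thesis
        by (rule back_subst[of "openin (top_of M)"])
          (use X.Wc openin_subset[OF Wop] in \<open>auto simp: N_def\<close>)
    qed
    show "x \<in> N" using xW R by (simp add: N_def)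
    show "b y = 1" if "y \<in> N" for y
      using that B(2)[of "snd c y"] by (simp add: N_def b_def dist_norm norm_minus_commute)
    show "C \<subseteq> U" using CW by (auto simp: W_def)
  qed (fact Ccl, fact b0)
qed

text \<open>The partial products of \<open>1 - b i\<close> are what each stage leaves over from
  1.\<close>

lemma partition_telescope:
  "(\<Sum>n\<le>m. b n * (\<Prod>i<n. 1 - b i)) = 1 - (\<Prod>i\<le>m. 1 - b i)" for b :: "nat \<Rightarrow> complex"
proof (induction m)
  case (Suc m)
  then show ?case by (simp add: lessThan_Suc_atMost algebra_simps)
qed simp

text \<open>If the sets where \<open>b\<^sub>n = 1\<close> have interiors covering \<open>U \<union> V\<close>, then
  \<open>b\<^sub>n (1 - b\<^sub>0) \<dots> (1 - b\<^sub>n\<^sub>-\<^sub>1)\<close> vanishes near a given point for all large \<open>n\<close>; so no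
  locally finite refinement has to be constructed.\<close>

lemma partition_of_unity:
  assumes U: "openin (top_of M) U" and V: "openin (top_of M) V"
  obtains \<rho> :: "'a \<Rightarrow> complex" where
    "\<And>c. c \<in> atlas M \<Longrightarrow> smooth_in (ind M) c ((U \<union> V) \<inter> dom_of c) \<rho>"
    "\<And>x. x \<in> U - V \<Longrightarrow> \<exists>N. openin (top_of M) N \<and> x \<in> N \<and> (\<forall>y\<in>N. 1 - \<rho> y = 0)"
    "\<And>x. x \<in> V - U \<Longrightarrow> \<exists>N. openin (top_of M) N \<and> x \<in> N \<and> (\<forall>y\<in>N. \<rho> y = 0)"
proof (cases "U \<union> V = {}")
  case True
  show ?thesis
  proof (rule that[of "\<lambda>x. 0"])
    fix c assume c: "c \<in> atlas M"
    interpret X: chart_domain M c "(U \<union> V) \<inter> dom_of c"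
      by (rule chart_domain_I) (auto intro: openin_Int openin_Un chart_open c U V)
    show "smooth_in (ind M) c ((U \<union> V) \<inter> dom_of c) (\<lambda>x. 0)"
      by (rule X.smooth_in_const)
  qed (use True in auto)
next
  case ne: False
  \<comment> \<open>Every bump is supported in \<open>U\<close> or in \<open>V\<close>; the terms
    built on bumps supported in \<open>U\<close> will be added up to \<rho>.\<close>
  have "\<exists>b N C. (\<forall>c\<in>atlas M. smooth_in (ind M) c (dom_of c) (b :: 'a \<Rightarrow> complex)) \<and>
      openin (top_of M) N \<and> x \<in> N \<and> (\<forall>y\<in>N. b y = 1) \<and>
      closedin (top_of M) C \<and> (C \<subseteq> U \<or> C \<subseteq> V) \<and> (\<forall>y. y \<notin> C \<longrightarrow> b y = 0)" if "x \<in> U \<union> V" for x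
  proof (cases "x \<in> U")
    case True
    show ?thesis by (rule manifold_bump[OF U True]) blast
  next
    case False
    then have "x \<in> V" using that by blast
    then show ?thesis by (rule manifold_bump[OF V]) blast
  qed
  then obtain b N C where bNC: "\<And>x. x \<in> U \<union> V \<Longrightarrow> (\<forall>c\<in>atlas M. smooth_in (ind M) c (dom_of c) (b x :: 'a \<Rightarrow> complex)) \<and>
      openin (top_of M) (N x) \<and> x \<in> N x \<and> (\<forall>y\<in>N x. b x y = 1) \<and>
      closedin (top_of M) (C x) \<and> (C x \<subseteq> U \<or> C x \<subseteq> V) \<and> (\<forall>y. y \<notin> C x \<longrightarrow> b x y = 0)"
    by metis
  have top: "U \<union> V \<subseteq> topspace (top_of M)"
    using U V by (simp add: openin_subset)
  have L: "Lindelof_space (subtopology (top_of M) (U \<union> V))"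
    using M by (intro second_countable_imp_Lindelof_space second_countable_subtopology)
      (simp add: complex_manifold_def)
  moreover have "\<forall>S\<in>N ` (U \<union> V). openin (top_of M) S" "U \<union> V \<subseteq> \<Union>(N ` (U \<union> V))"
    using bNC by blast+
  ultimately obtain \<V> where \<V>: "countable \<V>" "\<V> \<subseteq> N ` (U \<union> V)" "U \<union> V \<subseteq> \<Union>\<V>"
    using Lindelof_space_subtopology_subset[OF top] by meson
  then obtain T where T: "countable T" "T \<subseteq> U \<union> V" "\<V> = N ` T"
    using countable_subset_image by metis
  \<comment> \<open>The enumeration by \<open>from_nat_into\<close> is onto for a nonempty set; a
    finite \<open>T\<close> is listed with repetitions, which the construction tolerates.\<close>
  have "T \<noteq> {}" using ne \<V>(3) T(3) by auto
  define t where "t = from_nat_into T"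
  have t: "range t = T"
    unfolding t_def by (rule range_from_nat_into[OF \<open>T \<noteq> {}\<close> T(1)])
  define \<beta> where "\<beta> n = b (t n)" for n
  define \<phi> where "\<phi> n x = \<beta> n x * (\<Prod>i<n. 1 - \<beta> i x)" for n x
  define A where "A = {n. C (t n) \<subseteq> U}"
  \<comment> \<open>Terms after an index whose \<open>N\<close> contains \<open>x\<close> vanish at
    \<open>x\<close>, so the sum is cut off at the first such index. By \<open>\<rho>_eq\<close> any
    later such index gives the same value, so locally the cut-off may be kept fixed.\<close>
  define \<rho> where "\<rho> x = (\<Sum>n\<in>{n \<in> A. n \<le> (LEAST m. x \<in> N (t m))}. \<phi> n x)" for x
  have tUV: "t n \<in> U \<union> V" for n using t T(2) by blast
  note props = bNC[OF tUV]
  have cover: "\<exists>m. x \<in> N (t m)" if "x \<in> U \<union> V" for x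
    using that \<V>(3) T(3) t by blast
  have \<phi>0: "\<phi> n x = 0" if "x \<in> N (t m)" "m < n" for x m n
  proof -
    have "1 - \<beta> m x = 0" using props[of m] that by (simp add: \<beta>_def)
    then have "(\<Prod>i<n. 1 - \<beta> i x) = 0"
      using that(2) by (intro prod_zero) auto
    then show ?thesis by (simp add: \<phi>_def)
  qed
  have \<rho>_eq: "\<rho> x = (\<Sum>n\<in>{n \<in> A. n \<le> m}. \<phi> n x)" if "x \<in> N (t m)" for x m
  proof -
    let ?l = "LEAST m. x \<in> N (t m)"
    have l: "x \<in> N (t ?l)" "?l \<le> m"
      using that by (auto intro: LeastI Least_le)
    show ?thesis
      unfolding \<rho>_def
    proof (rule sum.mono_neutral_left)
      show "\<forall>i\<in>{n \<in> A. n \<le> m} - {n \<in> A. n \<le> ?l}. \<phi> i x = 0"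
      proof
        fix i assume "i \<in> {n \<in> A. n \<le> m} - {n \<in> A. n \<le> ?l}"
        then have "?l < i" by auto
        then show "\<phi> i x = 0" by (rule \<phi>0[OF l(1)])
      qed
    qed (use l in auto)
  qed
  have total: "(\<Sum>n\<le>m. \<phi> n x) = 1" if "x \<in> N (t m)" for x m
  proof -
    have "1 - \<beta> m x = 0" using props[of m] that by (simp add: \<beta>_def)
    then have "(\<Prod>i\<le>m. 1 - \<beta> i x) = 0"
      by (intro prod_zero) auto
    then show ?thesis
      using partition_telescope[of "\<lambda>n. \<beta> n x" m] by (simp add: \<phi>_def)
  qed
  \<comment> \<open>Only the finitely many terms up to \<open>m\<close> are involved, so their
    closed supports can be removed from \<open>N (t m)\<close> and leave an open set around
    \<open>x\<close>.\<close>
  have vanish: "\<exists>N'. openin (top_of M) N' \<and> x \<in> N' \<and> (\<forall>y\<in>N'. (\<Sum>n\<in>{n \<in> S. n \<le> m}. \<phi> n y) = 0)"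
    if "x \<in> N (t m)" "\<And>n. n \<in> S \<Longrightarrow> x \<notin> C (t n)" for x m S
  proof (intro exI[of _ "N (t m) - (\<Union>n\<in>{n \<in> S. n \<le> m}. C (t n))"] conjI ballI)
    show "openin (top_of M) (N (t m) - (\<Union>n\<in>{n \<in> S. n \<le> m}. C (t n)))"
      using props by (intro openin_diff closedin_Union) auto
    show "x \<in> N (t m) - (\<Union>n\<in>{n \<in> S. n \<le> m}. C (t n))"
      using that by auto
    fix y assume "y \<in> N (t m) - (\<Union>n\<in>{n \<in> S. n \<le> m}. C (t n))"
    then show "(\<Sum>n\<in>{n \<in> S. n \<le> m}. \<phi> n y) = 0"
      using props by (intro sum.neutral) (auto simp: \<phi>_def \<beta>_def)
  qed
  show ?thesis
  proof
    fix c assume c: "c \<in> atlas M"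
    interpret X: chart_domain M c "(U \<union> V) \<inter> dom_of c"
      by (rule chart_domain_I) (auto intro: openin_Int openin_Un chart_open c U V)
    show "smooth_in (ind M) c ((U \<union> V) \<inter> dom_of c) \<rho>"
    proof (rule X.smooth_in_local)
      fix x assume x: "x \<in> (U \<union> V) \<inter> dom_of c"
      then obtain m where m: "x \<in> N (t m)" using cover by blast
      let ?N = "N (t m) \<inter> ((U \<union> V) \<inter> dom_of c)"
      have op: "openin (top_of M) ?N"
        by (rule openin_Int[OF _ X.W]) (use props in blast)
      interpret Y: chart_domain M c ?N
        by (rule chart_domain_I[OF c op]) auto
      interpret D: chart_domain M c "dom_of c"
        by (rule chart_domain_I[OF c chart_open[OF c] order_refl])
      have \<beta>: "smooth_in (ind M) c ?N (\<beta> n)" for n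
        by (rule D.smooth_in_subset[OF op]) (use props c in \<open>auto simp: \<beta>_def\<close>)
      have "smooth_in (ind M) c ?N (\<phi> n)" for n
        unfolding \<phi>_def[abs_def]
        by (rule Y.smooth_in_mult[OF \<beta> Y.smooth_in_prod[OF Y.smooth_in_one_minus[OF \<beta>]]])
      then have "smooth_in (ind M) c ?N (\<lambda>x. \<Sum>n\<in>{n \<in> A. n \<le> m}. \<phi> n x)"
        by (intro Y.smooth_in_sum)
      then have "smooth_in (ind M) c ?N \<rho>"
        by (rule Y.smooth_in_cong) (simp add: \<rho>_eq)
      then show "\<exists>V'. openin (top_of M) V' \<and> x \<in> V' \<and> V' \<subseteq> (U \<union> V) \<inter> dom_of c \<and> smooth_in (ind M) c V' \<rho>"
        using x m op by (intro exI[of _ ?N]) auto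
    qed
  next
    fix x assume x: "x \<in> V - U"
    then obtain m where m: "x \<in> N (t m)" using cover by blast
    obtain N' where N': "openin (top_of M) N'" "x \<in> N'" "\<And>y. y \<in> N' \<Longrightarrow> (\<Sum>n\<in>{n \<in> A. n \<le> m}. \<phi> n y) = 0"
      using vanish[OF m, of A] x by (auto simp: A_def)
    show "\<exists>N. openin (top_of M) N \<and> x \<in> N \<and> (\<forall>y\<in>N. \<rho> y = 0)"
      using m N' props[of m] by (intro exI[of _ "N (t m) \<inter> N'"]) (auto simp: \<rho>_eq)
  next
    fix x assume x: "x \<in> U - V"
    then obtain m where m: "x \<in> N (t m)" using cover by blast
    \<comment> \<open>A support not contained in \<open>U\<close> lies in \<open>V\<close>, hence
      misses \<open>x\<close>.\<close>
    have "x \<notin> C (t n)" if "n \<in> - A" for n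
      using props[of n] x that by (auto simp: A_def)
    from vanish[of x m "- A", OF m this]
    obtain N' where N': "openin (top_of M) N' \<and> x \<in> N' \<and> (\<forall>y\<in>N'. (\<Sum>n\<in>{n \<in> - A. n \<le> m}. \<phi> n y) = 0)"
      by (rule exE)
    have "1 - \<rho> y = 0" if "y \<in> N (t m) \<inter> N'" for y
    proof -
      have "(\<Sum>n\<le>m. \<phi> n y) = (\<Sum>n\<in>{n \<in> A. n \<le> m} \<union> {n \<in> - A. n \<le> m}. \<phi> n y)"
        by (rule sum.cong) auto
      also have "\<dots> = (\<Sum>n\<in>{n \<in> A. n \<le> m}. \<phi> n y) + (\<Sum>n\<in>{n \<in> - A. n \<le> m}. \<phi> n y)"
        by (rule sum.union_disjoint) auto
      finally have "(\<Sum>n\<le>m. \<phi> n y) = \<dots>" .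
      then show ?thesis
        using that total[of y m] N' \<rho>_eq[of y m] by simp
    qed
    then show "\<exists>N. openin (top_of M) N \<and> x \<in> N \<and> (\<forall>y\<in>N. 1 - \<rho> y = 0)"
      using m N' props[of m] by (intro exI[of _ "N (t m) \<inter> N'"]) auto
  qed
qed

end

section \<open>Gluing and extending forms\<close>

context poisson_mfd
begin

text \<open>Every defining condition of \<open>forms\<close> can be tested near each point, and each
  point of the union lies in \<open>U\<close> or in \<open>V\<close>, where \<omega> restricts to a
  form.\<close>

lemma forms_glue:
  assumes U: "openin (top_of M) U" and V: "openin (top_of M) V"
    and out: "\<And>c x is js. x \<notin> U \<union> V \<Longrightarrow> \<omega> c x is js = 0"
    and \<omega>U: "rs U \<omega> \<in> forms M U p q" and \<omega>V: "rs V \<omega> \<in> forms M V p q"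
  shows "\<omega> \<in> forms M (U \<union> V) p q"
proof -
  have local: "\<exists>S. openin (top_of M) S \<and> x \<in> S \<and> S \<subseteq> U \<union> V \<and> rs S \<omega> \<in> forms M S p q" if "x \<in> U \<union> V" for x
    using that assms by blast
  have eq: "\<omega> c x = rs S \<omega> c x" if "x \<in> S" for S c x
    using that by (intro ext) (simp add: rs_def)
  show ?thesis
    unfolding forms_iff
  proof (intro conjI allI impI ballI)
    fix c x "is" js
    assume *: "\<not> (c \<in> atlas M \<and> x \<in> (U \<union> V) \<inter> dom_of c \<and> is \<in> multi_ind M p \<and> js \<in> multi_ind M q)"
    show "\<omega> c x is js = 0"
    proof (cases "x \<in> U \<union> V")
      case True
      then obtain S where S: "x \<in> S" "S \<subseteq> U \<union> V" "rs S \<omega> \<in> forms M S p q" using local by blast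
      have "rs S \<omega> c x is js = 0"
        by (rule form_supp[OF S(3)]) (use * S in auto)
      then show ?thesis using eq[OF S(1)] by simp
    qed (rule out)
  next
    fix c x js
    show "alternating (\<lambda>is. \<omega> c x is js)"
    proof (cases "x \<in> U \<union> V")
      case True
      then obtain S where S: "x \<in> S" "rs S \<omega> \<in> forms M S p q" using local by blast
      show ?thesis unfolding eq[OF S(1)] by (rule form_alt[OF S(2)])
    qed (simp add: out alternating_zero)
  next
    fix c x "is"
    show "alternating (\<omega> c x is)"
    proof (cases "x \<in> U \<union> V")
      case True
      then obtain S where S: "x \<in> S" "rs S \<omega> \<in> forms M S p q" using local by blast
      show ?thesis unfolding eq[OF S(1)] by (rule form_alt[OF S(2)])
    next
      case False
      then have "\<omega> c x is = (\<lambda>js. 0)" by (auto simp: out)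
      then show ?thesis by (simp only: alternating_zero)
    qed
  next
    fix c "is" js assume c: "c \<in> atlas M"
    interpret X: chart_domain M c "(U \<union> V) \<inter> dom_of c"
      by (rule chart_domain_I) (auto intro: openin_Int openin_Un chart_open c U V)
    show "smooth_in (ind M) c ((U \<union> V) \<inter> dom_of c) (\<lambda>x. \<omega> c x is js)"
    proof (rule X.smooth_in_local)
      fix x assume x: "x \<in> (U \<union> V) \<inter> dom_of c"
      then obtain S where S: "openin (top_of M) S" "x \<in> S" "S \<subseteq> U \<union> V" "rs S \<omega> \<in> forms M S p q" using local by blast
      interpret Y: poisson_chart M \<pi> c "S \<inter> dom_of c" by (rule poisson_chart_inter[OF S(1) c])
      have "smooth_in (ind M) c (S \<inter> dom_of c) (\<lambda>x. \<omega> c x is js)"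
        by (rule Y.smooth_in_cong[OF form_smooth[OF S(4) c]]) (simp add: rs_def)
      then show "\<exists>V'. openin (top_of M) V' \<and> x \<in> V' \<and> V' \<subseteq> (U \<union> V) \<inter> dom_of c \<and> smooth_in (ind M) c V' (\<lambda>x. \<omega> c x is js)"
        using S x Y.W by (intro exI[of _ "S \<inter> dom_of c"]) auto
    qed
  next
    fix c c' x "is" js
    assume *: "c \<in> atlas M" "c' \<in> atlas M" "x \<in> (U \<union> V) \<inter> dom_of c \<inter> dom_of c'" "is \<in> multi_ind M p" "js \<in> multi_ind M q"
    then obtain S where S: "x \<in> S" "rs S \<omega> \<in> forms M S p q" using local by blast
    show "\<omega> c x is js = pull (\<lambda>a i. dz c i (coord c' a) x)
        (\<lambda>A. pull (\<lambda>a i. cnj (dz c i (coord c' a) x)) (\<omega> c' x A) js) is"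
      unfolding eq[OF S(1)] by (rule form_transform[OF S(2)]) (use * S in auto)
  qed
qed

text \<open>Components of \<eta> are zero outside the intersection, so the product is already its
  own extension by zero. Smoothness is in question only at points of \<open>U - V\<close>, near
  which \<open>f\<close> is zero.\<close>

lemma forms_extend:
  assumes U: "openin (top_of M) U" and V: "openin (top_of M) V"
    and f: "\<And>c. c \<in> atlas M \<Longrightarrow> smooth_in (ind M) c ((U \<inter> V) \<inter> dom_of c) f"
    and f0: "\<And>x. x \<in> U - V \<Longrightarrow> \<exists>N. openin (top_of M) N \<and> x \<in> N \<and> (\<forall>y\<in>N. f y = 0)"
    and \<eta>: "\<eta> \<in> forms M (U \<inter> V) p q"
  shows "(\<lambda>c x is js. f x * \<eta> c x is js) \<in> forms M U p q"
  unfolding forms_iff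
proof (intro conjI allI impI ballI)
  fix c x "is" js
  assume "\<not> (c \<in> atlas M \<and> x \<in> U \<inter> dom_of c \<and> is \<in> multi_ind M p \<and> js \<in> multi_ind M q)"
  then have "\<eta> c x is js = 0"
    by (intro form_supp[OF \<eta>]) auto
  then show "f x * \<eta> c x is js = 0" by simp
next
  fix c x js
  show "alternating (\<lambda>is. f x * \<eta> c x is js)"
    by (rule alternating_mult[OF form_alt(1)[OF \<eta>]])
next
  fix c x "is"
  show "alternating (\<lambda>js. f x * \<eta> c x is js)"
    by (rule alternating_mult[OF form_alt(2)[OF \<eta>]])
next
  fix c "is" js assume c: "c \<in> atlas M"
  interpret X: poisson_chart M \<pi> c "U \<inter> dom_of c" by (rule poisson_chart_inter[OF U c])
  show "smooth_in (ind M) c (U \<inter> dom_of c) (\<lambda>x. f x * \<eta> c x is js)"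
  proof (rule X.smooth_in_local)
    fix x assume x: "x \<in> U \<inter> dom_of c"
    show "\<exists>V'. openin (top_of M) V' \<and> x \<in> V' \<and> V' \<subseteq> U \<inter> dom_of c \<and> smooth_in (ind M) c V' (\<lambda>x. f x * \<eta> c x is js)"
    proof (cases "x \<in> V")
      case True
      interpret Y: poisson_chart M \<pi> c "U \<inter> V \<inter> dom_of c"
        by (rule poisson_chart_inter[OF openin_Int[OF U V] c])
      show ?thesis
        using x True Y.W Y.smooth_in_mult[OF f[OF c] form_smooth[OF \<eta> c]]
        by (intro exI[of _ "U \<inter> V \<inter> dom_of c"]) auto
    next
      case False
      then obtain N where N: "openin (top_of M) N" "x \<in> N" "\<forall>y\<in>N. f y = 0"
        using f0[of x] x by blast
      interpret Y: poisson_chart M \<pi> c "U \<inter> N \<inter> dom_of c"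
        by (rule poisson_chart_inter[OF openin_Int[OF U N(1)] c])
      have "smooth_in (ind M) c (U \<inter> N \<inter> dom_of c) (\<lambda>x. f x * \<eta> c x is js)"
        by (rule Y.smooth_in_cong[OF Y.smooth_in_const[of 0]]) (use N in simp)
      then show ?thesis
        using x N Y.W by (intro exI[of _ "U \<inter> N \<inter> dom_of c"]) auto
    qed
  qed
next
  fix c c' x "is" js
  assume *: "c \<in> atlas M" "c' \<in> atlas M" "x \<in> U \<inter> dom_of c \<inter> dom_of c'" "is \<in> multi_ind M p" "js \<in> multi_ind M q"
  show "f x * \<eta> c x is js = pull (\<lambda>a i. dz c i (coord c' a) x)
      (\<lambda>A. pull (\<lambda>a i. cnj (dz c i (coord c' a) x)) (\<lambda>B. f x * \<eta> c' x A B) js) is"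
  proof (cases "x \<in> V")
    case True
    then have x: "x \<in> U \<inter> V \<inter> dom_of c \<inter> dom_of c'" using * by auto
    show ?thesis
      using form_transform[OF \<eta> *(1,2) x *(4,5)] by (simp add: pull_mult)
  next
    case False
    then have "\<eta> c'' x A B = 0" for c'' A B
      by (intro form_outside[OF \<eta>]) auto
    then show ?thesis by simp
  qed
qed

end

section \<open>The long exact sequence\<close>

lemma group_homI: "group G \<Longrightarrow> group H \<Longrightarrow> f \<in> hom G H \<Longrightarrow> group_hom G H f"
  by (simp add: group_hom_def group_hom_axioms_def)

text \<open>One map \<open>D\<close> serves all degrees, and its laws are asked only on the groups
  \<open>K j\<close>: on arbitrary families of components the differentials are not
  additive.\<close>

locale cochain_complex =
  fixes K :: "int \<Rightarrow> 'm::ab_group_add set" and D :: "'m \<Rightarrow> 'm"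
  assumes K_zero: "0 \<in> K j"
    and K_diff: "x \<in> K j \<Longrightarrow> y \<in> K j \<Longrightarrow> x - y \<in> K j"
    and D_K: "x \<in> K j \<Longrightarrow> D x \<in> K (j + 1)"
    and D_diff: "x \<in> K j \<Longrightarrow> y \<in> K j \<Longrightarrow> D (x - y) = D x - D y"
    and D_D: "x \<in> K j \<Longrightarrow> D (D x) = 0"
begin

definition Z :: "int \<Rightarrow> 'm monoid" where
  "Z k = \<lparr>carrier = {\<omega> \<in> K k. D \<omega> = 0}, mult = (+), one = 0\<rparr>"

definition B :: "int \<Rightarrow> 'm set" where
  "B k = D ` K (k - 1)"

definition H :: "int \<Rightarrow> 'm set monoid" where
  "H k = Z k Mod B k"

definition cls :: "int \<Rightarrow> 'm \<Rightarrow> 'm set" where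
  "cls k \<omega> = B k #>\<^bsub>Z k\<^esub> \<omega>"

lemma Z_simps [simp]: "x \<in> carrier (Z k) \<longleftrightarrow> x \<in> K k \<and> D x = 0" "x \<otimes>\<^bsub>Z k\<^esub> y = x + y" "\<one>\<^bsub>Z k\<^esub> = 0"
  by (simp_all add: Z_def)

lemma K_minus: "x \<in> K j \<Longrightarrow> - x \<in> K j"
  using K_diff[OF K_zero] by fastforce

lemma K_add: "x \<in> K j \<Longrightarrow> y \<in> K j \<Longrightarrow> x + y \<in> K j"
  using K_diff[OF _ K_minus] by fastforce

lemma D_zero: "D 0 = 0"
  using D_diff[OF K_zero K_zero] by simp

lemma D_minus: "x \<in> K j \<Longrightarrow> D (- x) = - D x"
  using D_diff[OF K_zero, of x j] D_zero by simp

lemma D_add: "x \<in> K j \<Longrightarrow> y \<in> K j \<Longrightarrow> D (x + y) = D x + D y"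
  using D_diff[OF _ K_minus, of x j y] by (simp add: D_minus)

lemma Z_group: "comm_group (Z k)"
proof (rule comm_groupI)
  fix x assume "x \<in> carrier (Z k)"
  then show "\<exists>y\<in>carrier (Z k). y \<otimes>\<^bsub>Z k\<^esub> x = \<one>\<^bsub>Z k\<^esub>"
    by (intro bexI[of _ "- x"]) (auto simp: K_minus D_minus)
qed (auto simp: K_add D_add K_zero D_zero add.assoc add.commute)

lemma Z_inv: "x \<in> carrier (Z k) \<Longrightarrow> inv\<^bsub>Z k\<^esub> x = - x"
proof -
  assume x: "x \<in> carrier (Z k)"
  interpret comm_group "Z k" by (rule Z_group)
  show ?thesis
    by (rule inv_equality) (use x in \<open>auto simp: K_minus D_minus\<close>)
qed

lemma B_Z: "x \<in> B k \<Longrightarrow> x \<in> carrier (Z k)"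
  using D_K[of _ "k - 1"] D_D by (auto simp: B_def)

lemma B_diff: "x \<in> B k \<Longrightarrow> y \<in> B k \<Longrightarrow> x - y \<in> B k"
  unfolding B_def using K_diff[of _ "k - 1"] D_diff[of _ "k - 1", symmetric] by auto

lemma B_zero: "0 \<in> B k"
  using imageI[OF K_zero, of D "k - 1"] by (simp add: B_def D_zero)

lemma B_minus: "x \<in> B k \<Longrightarrow> - x \<in> B k"
  using B_diff[OF B_zero] by fastforce

lemma B_add: "x \<in> B k \<Longrightarrow> y \<in> B k \<Longrightarrow> x + y \<in> B k"
  using B_diff[OF _ B_minus] by fastforce

lemma B_normal: "B k \<lhd> Z k"
proof -
  interpret comm_group "Z k" by (rule Z_group)
  have "subgroup (B k) (Z k)"
  proof (rule subgroupI)
    show "B k \<subseteq> carrier (Z k)" using B_Z by blast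
    show "inv\<^bsub>Z k\<^esub> x \<in> B k" if "x \<in> B k" for x
      using that Z_inv[OF B_Z[OF that]] by (simp add: B_minus)
    show "B k \<noteq> {}" using B_zero[of k] by blast
  qed (simp add: B_add)
  then show ?thesis by (rule subgroup_imp_normal)
qed

lemma H_group: "group (H k)"
  unfolding H_def by (rule normal.factorgroup_is_group[OF B_normal])

lemma cls_eq_set: "cls k x = (\<lambda>b. b + x) ` B k"
  by (auto simp: cls_def r_coset_def)

lemma cls_self: "x \<in> cls k x"
  unfolding cls_eq_set using B_zero by force

lemma mem_cls: "y \<in> cls k x \<longleftrightarrow> y - x \<in> B k"
  unfolding cls_eq_set by (force simp: image_iff)

lemma cls_eq_iff: "cls k x = cls k y \<longleftrightarrow> x - y \<in> B k"
proof
  assume "cls k x = cls k y"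
  then show "x - y \<in> B k"
    using cls_self[of x k] mem_cls by blast
next
  assume *: "x - y \<in> B k"
  show "cls k x = cls k y"
  proof (intro Set.set_eqI)
    fix z
    show "z \<in> cls k x \<longleftrightarrow> z \<in> cls k y"
      using B_add[OF _ *, of "z - x"] B_diff[OF _ *, of "z - y"] by (auto simp: mem_cls)
  qed
qed

lemma carrier_H: "carrier (H k) = cls k ` carrier (Z k)"
  unfolding H_def cls_def by (rule carrier_FactGroup)

lemma cls_H: "x \<in> carrier (Z k) \<Longrightarrow> cls k x \<in> carrier (H k)"
  by (simp add: carrier_H)

lemma H_mult: "x \<in> carrier (Z k) \<Longrightarrow> y \<in> carrier (Z k) \<Longrightarrow> cls k x \<otimes>\<^bsub>H k\<^esub> cls k y = cls k (x + y)"
  using normal.rcos_sum[OF B_normal, of x k y] by (simp add: H_def cls_def)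

lemma H_one: "\<one>\<^bsub>H k\<^esub> = cls k 0"
  by (simp add: H_def cls_eq_set)

lemma H_inv:
  assumes x: "x \<in> carrier (Z k)"
  shows "inv\<^bsub>H k\<^esub> (cls k x) = cls k (- x)"
proof (rule group.inv_equality[OF H_group])
  show "cls k (- x) \<otimes>\<^bsub>H k\<^esub> cls k x = \<one>\<^bsub>H k\<^esub>"
    using x by (subst H_mult) (auto simp: K_minus D_minus H_one)
  show "cls k x \<in> carrier (H k)" "cls k (- x) \<in> carrier (H k)"
    using x by (auto intro!: cls_H simp: K_minus D_minus)
qed

lemma cls_one: "cls k x = \<one>\<^bsub>H k\<^esub> \<longleftrightarrow> x \<in> B k"
  unfolding H_one cls_eq_iff by simp

end

section \<open>Chain maps and the abstract Mayer-Vietoris sequence\<close>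

definition induced :: "('m \<Rightarrow> 'm set) \<Rightarrow> ('m \<Rightarrow> 'm) \<Rightarrow> 'm set \<Rightarrow> 'm set" where
  "induced c r \<xi> = the_elem ((\<lambda>\<omega>. c (r \<omega>)) ` \<xi>)"

locale chain_map = X: cochain_complex K D + Y: cochain_complex K' D'
  for K :: "int \<Rightarrow> 'm::ab_group_add set" and D and K' :: "int \<Rightarrow> 'm set" and D' +
  fixes r :: "'m \<Rightarrow> 'm"
  assumes r_K: "x \<in> K j \<Longrightarrow> r x \<in> K' j"
    and r_diff: "r (x - y) = r x - r y"
    and r_D: "x \<in> K j \<Longrightarrow> r (D x) = D' (r x)"
begin

lemma r_zero: "r 0 = 0"
  using r_diff[of 0 0] by (simp only: diff_self)

lemma r_minus: "r (- x) = - r x"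
  using r_diff[of 0 x] by (simp add: r_zero)

lemma r_add: "r (x + y) = r x + r y"
  using r_diff[of x "- y"] by (simp add: r_minus)

lemma r_Z: "x \<in> carrier (X.Z k) \<Longrightarrow> r x \<in> carrier (Y.Z k)"
  using r_K r_D[of x k] by (simp add: r_zero)

lemma r_B: "x \<in> X.B k \<Longrightarrow> r x \<in> Y.B k"
  unfolding X.B_def Y.B_def using r_K r_D by auto

text \<open>Boundaries go to boundaries, so all elements of a coset have the same image class and
  \<open>the_elem\<close> is applied to a singleton.\<close>

lemma induced_cls:
  shows "induced (Y.cls k) r (X.cls k x) = Y.cls k (r x)"
proof -
  have "Y.cls k (r y) = Y.cls k (r x)" if "y \<in> X.cls k x" for y
    using r_B[of "y - x" k] that by (simp add: X.mem_cls Y.cls_eq_iff r_diff)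
  then have "(\<lambda>y. Y.cls k (r y)) ` X.cls k x = (\<lambda>y. Y.cls k (r x)) ` X.cls k x"
    by (rule image_cong[OF refl])
  also have "\<dots> = {Y.cls k (r x)}"
    by (rule image_constant[OF X.cls_self])
  finally show ?thesis by (simp add: induced_def)
qed

end

text \<open>Elementwise exactness of the short sequence: \<open>separated\<close> is injectivity on
  the left, \<open>compat\<close> and \<open>glue\<close> exactness in the middle,
  \<open>lift\<close> surjectivity on the right.\<close>

locale mayer_vietoris =
  WU: chain_map KW DW KU DU rU + WV: chain_map KW DW KV DV rV +
  UI: chain_map KU DU KI DI rI + VI: chain_map KV DV KI DI rI
  for KW :: "int \<Rightarrow> 'm::ab_group_add set" and DW KU DU KV DV KI DI rU rV rI +
  assumes compat: "w \<in> KW j \<Longrightarrow> rI (rU w) = rI (rV w)"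
    and glue: "a \<in> KU j \<Longrightarrow> b \<in> KV j \<Longrightarrow> rI a = rI b \<Longrightarrow> \<exists>w\<in>KW j. rU w = a \<and> rV w = b"
    and separated: "w \<in> KW j \<Longrightarrow> rU w = 0 \<Longrightarrow> rV w = 0 \<Longrightarrow> w = 0"
    and lift: "x \<in> KI j \<Longrightarrow> \<exists>a\<in>KU j. \<exists>b\<in>KV j. rI a - rI b = x"
begin

abbreviation "CW \<equiv> WU.X.cls" abbreviation "CU \<equiv> WU.Y.cls" abbreviation "CV \<equiv> WV.Y.cls" abbreviation "CI \<equiv> UI.Y.cls"
abbreviation "HW \<equiv> WU.X.H" abbreviation "HU \<equiv> WU.Y.H" abbreviation "HV \<equiv> WV.Y.H" abbreviation "HI \<equiv> UI.Y.H"
abbreviation "ZW \<equiv> WU.X.Z" abbreviation "ZU \<equiv> WU.Y.Z" abbreviation "ZV \<equiv> WV.Y.Z" abbreviation "ZI \<equiv> UI.Y.Z"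
abbreviation "BW \<equiv> WU.X.B" abbreviation "BU \<equiv> WU.Y.B" abbreviation "BV \<equiv> WV.Y.B" abbreviation "BI \<equiv> UI.Y.B"

definition pair :: "int \<Rightarrow> 'm set \<Rightarrow> 'm set \<times> 'm set" where
  "pair k \<xi> = (induced (CU k) rU \<xi>, induced (CV k) rV \<xi>)"

definition difference :: "int \<Rightarrow> 'm set \<times> 'm set \<Rightarrow> 'm set" where
  "difference k = (\<lambda>(\<xi>, \<zeta>). induced (CI k) rI \<xi> \<otimes>\<^bsub>HI k\<^esub> inv\<^bsub>HI k\<^esub> induced (CI k) rI \<zeta>)"

text \<open>The zigzag of the snake lemma, kept as a relation. It is closed under subtraction, so
  independence of choices and additivity of the connecting map come down to the case treated in
  \<open>connects_boundary\<close>.\<close>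

definition connects :: "int \<Rightarrow> 'm \<Rightarrow> 'm \<Rightarrow> bool" where
  "connects k \<eta> \<gamma> \<longleftrightarrow> \<eta> \<in> carrier (ZI k) \<and> \<gamma> \<in> carrier (ZW (k + 1)) \<and>
    (\<exists>\<alpha>\<in>KU k. \<exists>\<beta>\<in>KV k. rI \<alpha> - rI \<beta> = \<eta> \<and> rU \<gamma> = DU \<alpha> \<and> rV \<gamma> = DV \<beta>)"

text \<open>Both the representing cycle and the end of the zigzag are chosen;
  \<open>connecting_eq\<close> makes the class independent of the choices.\<close>

definition connecting :: "int \<Rightarrow> 'm set \<Rightarrow> 'm set" where
  "connecting k \<xi> = CW (k + 1) (SOME \<gamma>. \<exists>\<eta>. \<xi> = CI k \<eta> \<and> connects k \<eta> \<gamma>)"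

lemma pair_cls: "pair k (CW k w) = (CU k (rU w), CV k (rV w))"
  by (simp add: pair_def WU.induced_cls WV.induced_cls)

lemma difference_cls:
  assumes "a \<in> carrier (ZU k)" "b \<in> carrier (ZV k)"
  shows "difference k (CU k a, CV k b) = CI k (rI a - rI b)"
proof -
  have ab: "rI a \<in> carrier (ZI k)" "rI b \<in> carrier (ZI k)"
    using UI.r_Z VI.r_Z assms by blast+
  have "- rI b \<in> carrier (ZI k)"
    using ab UI.Y.K_minus UI.Y.D_minus by auto
  then show ?thesis
    using ab by (simp add: difference_def UI.induced_cls VI.induced_cls UI.Y.H_inv UI.Y.H_mult del: UI.Y.Z_simps)
qed

lemma connects_exists:
  assumes \<eta>: "\<eta> \<in> carrier (ZI k)"
  shows "\<exists>\<gamma>. connects k \<eta> \<gamma>"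
proof -
  obtain \<alpha> \<beta> where ab: "\<alpha> \<in> KU k" "\<beta> \<in> KV k" "rI \<alpha> - rI \<beta> = \<eta>"
    using lift \<eta> by (metis UI.Y.Z_simps(1))
  have "DI (rI \<alpha>) - DI (rI \<beta>) = 0"
    using UI.Y.D_diff[OF UI.r_K[OF ab(1)] VI.r_K[OF ab(2)]] ab(3) \<eta> by simp
  then have "rI (DU \<alpha>) = rI (DV \<beta>)"
    using UI.r_D[OF ab(1)] VI.r_D[OF ab(2)] by simp
  then obtain \<gamma> where \<gamma>: "\<gamma> \<in> KW (k + 1)" "rU \<gamma> = DU \<alpha>" "rV \<gamma> = DV \<beta>"
    using glue[OF WU.Y.D_K[OF ab(1)] WV.Y.D_K[OF ab(2)]] by blast
  \<comment> \<open>Tested on \<open>U\<close> and \<open>V\<close>, where \<gamma> restricts to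
    differentials.\<close>
  have "DW \<gamma> = 0"
  proof (rule separated)
    show "DW \<gamma> \<in> KW (k + 1 + 1)" by (rule WU.X.D_K[OF \<gamma>(1)])
    show "rU (DW \<gamma>) = 0" "rV (DW \<gamma>) = 0"
      using WU.r_D[OF \<gamma>(1)] WV.r_D[OF \<gamma>(1)] \<gamma> WU.Y.D_D[OF ab(1)] WV.Y.D_D[OF ab(2)] by simp_all
  qed
  then show ?thesis
    unfolding connects_def using \<eta> ab \<gamma> by auto
qed

lemma connects_diff:
  assumes "connects k \<eta> \<gamma>" "connects k \<eta>' \<gamma>'"
  shows "connects k (\<eta> - \<eta>') (\<gamma> - \<gamma>')"
proof -
  obtain \<alpha> \<beta> where 1: "\<alpha> \<in> KU k" "\<beta> \<in> KV k" "rI \<alpha> - rI \<beta> = \<eta>" "rU \<gamma> = DU \<alpha>" "rV \<gamma> = DV \<beta>"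
    using assms(1) unfolding connects_def by blast
  obtain \<alpha>' \<beta>' where 2: "\<alpha>' \<in> KU k" "\<beta>' \<in> KV k" "rI \<alpha>' - rI \<beta>' = \<eta>'" "rU \<gamma>' = DU \<alpha>'" "rV \<gamma>' = DV \<beta>'"
    using assms(2) unfolding connects_def by blast
  have "rI (\<alpha> - \<alpha>') - rI (\<beta> - \<beta>') = \<eta> - \<eta>'"
    using 1 2 by (simp add: UI.r_diff algebra_simps)
  moreover have "rU (\<gamma> - \<gamma>') = DU (\<alpha> - \<alpha>')" "rV (\<gamma> - \<gamma>') = DV (\<beta> - \<beta>')"
    using 1 2 WU.Y.D_diff WV.Y.D_diff by (simp_all add: WU.r_diff WV.r_diff)
  moreover have "\<eta> - \<eta>' \<in> carrier (ZI k)" "\<gamma> - \<gamma>' \<in> carrier (ZW (k + 1))"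
    using assms unfolding connects_def
    by (auto simp: UI.Y.K_diff WU.X.K_diff UI.Y.D_diff[of _ k] WU.X.D_diff[of _ "k + 1"])
  ultimately show ?thesis
    unfolding connects_def using 1 2 WU.Y.K_diff WV.Y.K_diff by blast
qed

text \<open>If \<eta> is the boundary of \<theta>, lifting \<theta> and subtracting the
  differentials of the lifts from \<alpha> and \<beta> makes these agree on the overlap. They glue
  to a cochain whose differential is \<gamma>.\<close>

lemma connects_boundary:
  assumes c: "connects k \<eta> \<gamma>" and \<eta>: "\<eta> \<in> BI k"
  shows "\<gamma> \<in> BW (k + 1)"
proof -
  obtain \<alpha> \<beta> where 1: "\<alpha> \<in> KU k" "\<beta> \<in> KV k" "rI \<alpha> - rI \<beta> = \<eta>" "rU \<gamma> = DU \<alpha>" "rV \<gamma> = DV \<beta>"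
    and \<gamma>: "\<gamma> \<in> KW (k + 1)"
    using c unfolding connects_def by auto
  obtain \<theta> where \<theta>: "\<theta> \<in> KI (k - 1)" "\<eta> = DI \<theta>"
    using \<eta> unfolding UI.Y.B_def by blast
  obtain \<alpha>' \<beta>' where 2: "\<alpha>' \<in> KU (k - 1)" "\<beta>' \<in> KV (k - 1)" "rI \<alpha>' - rI \<beta>' = \<theta>"
    using lift[OF \<theta>(1)] by blast
  have DK: "DU \<alpha>' \<in> KU k" "DV \<beta>' \<in> KV k"
    using WU.Y.D_K[OF 2(1)] WV.Y.D_K[OF 2(2)] by simp_all
  have "rI (DU \<alpha>') - rI (DV \<beta>') = \<eta>"
    using UI.Y.D_diff[OF UI.r_K[OF 2(1)] VI.r_K[OF 2(2)]] 2(3) \<theta>(2) UI.r_D[OF 2(1)] VI.r_D[OF 2(2)] by simp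
  then have "rI (\<alpha> - DU \<alpha>') = rI (\<beta> - DV \<beta>')"
    using 1(3) by (simp add: UI.r_diff algebra_simps)
  then obtain \<delta> where \<delta>: "\<delta> \<in> KW k" "rU \<delta> = \<alpha> - DU \<alpha>'" "rV \<delta> = \<beta> - DV \<beta>'"
    using glue[OF WU.Y.K_diff[OF 1(1) DK(1)] WV.Y.K_diff[OF 1(2) DK(2)]] by blast
  have "\<gamma> - DW \<delta> = 0"
  proof (rule separated)
    show "\<gamma> - DW \<delta> \<in> KW (k + 1)"
      by (rule WU.X.K_diff[OF \<gamma> WU.X.D_K[OF \<delta>(1)]])
    show "rU (\<gamma> - DW \<delta>) = 0"
      using WU.Y.D_diff[OF 1(1) DK(1)] WU.Y.D_D[OF 2(1)] by (simp add: WU.r_diff WU.r_D[OF \<delta>(1)] \<delta> 1)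
    show "rV (\<gamma> - DW \<delta>) = 0"
      using WV.Y.D_diff[OF 1(2) DK(2)] WV.Y.D_D[OF 2(2)] by (simp add: WV.r_diff WV.r_D[OF \<delta>(1)] \<delta> 1)
  qed
  then show ?thesis
    unfolding WU.X.B_def using \<delta>(1) by (auto intro!: image_eqI[of _ DW \<delta>])
qed

text \<open>Two choices differ by a zigzag that starts at a boundary.\<close>

lemma connecting_eq:
  assumes c: "connects k \<eta> \<gamma>"
  shows "connecting k (CI k \<eta>) = CW (k + 1) \<gamma>"
proof -
  have "\<exists>\<gamma> \<eta>'. CI k \<eta> = CI k \<eta>' \<and> connects k \<eta>' \<gamma>"
    using c by blast
  then obtain \<eta>' where \<eta>': "CI k \<eta> = CI k \<eta>'"
      "connects k \<eta>' (SOME \<gamma>. \<exists>\<eta>'. CI k \<eta> = CI k \<eta>' \<and> connects k \<eta>' \<gamma>)"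
    using someI_ex[of "\<lambda>\<gamma>. \<exists>\<eta>'. CI k \<eta> = CI k \<eta>' \<and> connects k \<eta>' \<gamma>"] by blast
  from connects_boundary[OF connects_diff[OF \<eta>'(2) c]] show ?thesis
    unfolding connecting_def WU.X.cls_eq_iff using \<eta>'(1)[symmetric] by (simp add: UI.Y.cls_eq_iff)
qed

lemma pair_hom: "group_hom (HW k) (HU k \<times>\<times> HV k) (pair k)"
proof (rule group_homI)
  show "pair k \<in> hom (HW k) (HU k \<times>\<times> HV k)"
  proof (rule homI)
    fix \<xi> assume "\<xi> \<in> carrier (HW k)"
    then obtain x where "x \<in> carrier (ZW k)" "\<xi> = CW k x"
      unfolding WU.X.carrier_H by blast
    then show "pair k \<xi> \<in> carrier (HU k \<times>\<times> HV k)"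
      using WU.Y.cls_H[OF WU.r_Z] WV.Y.cls_H[OF WV.r_Z] by (simp add: pair_cls DirProd_def del: WU.X.Z_simps)
  next
    fix \<xi> \<zeta> assume "\<xi> \<in> carrier (HW k)" "\<zeta> \<in> carrier (HW k)"
    then obtain x y where xy: "x \<in> carrier (ZW k)" "\<xi> = CW k x" "y \<in> carrier (ZW k)" "\<zeta> = CW k y"
      unfolding WU.X.carrier_H by blast
    show "pair k (\<xi> \<otimes>\<^bsub>HW k\<^esub> \<zeta>) = pair k \<xi> \<otimes>\<^bsub>HU k \<times>\<times> HV k\<^esub> pair k \<zeta>"
      using WU.r_Z[OF xy(1)] WU.r_Z[OF xy(3)] WV.r_Z[OF xy(1)] WV.r_Z[OF xy(3)] xy
      by (simp add: WU.X.H_mult pair_cls DirProd_def WU.Y.H_mult WV.Y.H_mult WU.r_add WV.r_add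
          del: WU.X.Z_simps WU.Y.Z_simps WV.Y.Z_simps)
  qed
qed (intro DirProd_group WU.X.H_group WU.Y.H_group WV.Y.H_group)+

lemma difference_hom: "group_hom (HU k \<times>\<times> HV k) (HI k) (difference k)"
proof (rule group_homI)
  show "difference k \<in> hom (HU k \<times>\<times> HV k) (HI k)"
  proof (rule homI)
    fix \<xi> assume "\<xi> \<in> carrier (HU k \<times>\<times> HV k)"
    then obtain a b where ab: "a \<in> carrier (ZU k)" "b \<in> carrier (ZV k)" "\<xi> = (CU k a, CV k b)"
      by (auto simp: DirProd_def WU.Y.carrier_H WV.Y.carrier_H simp del: WU.Y.Z_simps WV.Y.Z_simps)
    have "rI a - rI b \<in> carrier (ZI k)"
      using UI.r_Z[OF ab(1)] VI.r_Z[OF ab(2)] UI.Y.K_diff UI.Y.D_diff by auto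
    then show "difference k \<xi> \<in> carrier (HI k)"
      unfolding ab(3) difference_cls[OF ab(1,2)] by (rule UI.Y.cls_H)
  next
    fix \<xi> \<zeta> assume "\<xi> \<in> carrier (HU k \<times>\<times> HV k)" "\<zeta> \<in> carrier (HU k \<times>\<times> HV k)"
    then obtain a b a' b' where ab: "a \<in> carrier (ZU k)" "b \<in> carrier (ZV k)" "\<xi> = (CU k a, CV k b)"
      and ab': "a' \<in> carrier (ZU k)" "b' \<in> carrier (ZV k)" "\<zeta> = (CU k a', CV k b')"
      by (auto simp: DirProd_def WU.Y.carrier_H WV.Y.carrier_H simp del: WU.Y.Z_simps WV.Y.Z_simps)
    have I: "rI a - rI b \<in> carrier (ZI k)" "rI a' - rI b' \<in> carrier (ZI k)"
      using UI.r_Z[OF ab(1)] VI.r_Z[OF ab(2)] UI.r_Z[OF ab'(1)] VI.r_Z[OF ab'(2)] UI.Y.K_diff UI.Y.D_diff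
      by auto
    have s: "a + a' \<in> carrier (ZU k)" "b + b' \<in> carrier (ZV k)"
      using ab ab' WU.Y.K_add WU.Y.D_add WV.Y.K_add WV.Y.D_add by auto
    have "\<xi> \<otimes>\<^bsub>HU k \<times>\<times> HV k\<^esub> \<zeta> = (CU k (a + a'), CV k (b + b'))"
      unfolding ab(3) ab'(3) mult_DirProd WU.Y.H_mult[OF ab(1) ab'(1)] WV.Y.H_mult[OF ab(2) ab'(2)] ..
    then show "difference k (\<xi> \<otimes>\<^bsub>HU k \<times>\<times> HV k\<^esub> \<zeta>) = difference k \<xi> \<otimes>\<^bsub>HI k\<^esub> difference k \<zeta>"
      unfolding ab(3) ab'(3) by (simp only: difference_cls[OF s] difference_cls[OF ab(1,2)]
          difference_cls[OF ab'(1,2)] UI.Y.H_mult[OF I] UI.r_add) (simp add: algebra_simps)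
  qed
qed (intro DirProd_group WU.Y.H_group WV.Y.H_group UI.Y.H_group)+

lemma connecting_cls:
  assumes "\<eta> \<in> carrier (ZI k)"
  obtains \<gamma> where "connects k \<eta> \<gamma>" "connecting k (CI k \<eta>) = CW (k + 1) \<gamma>" "\<gamma> \<in> carrier (ZW (k + 1))"
  using connects_exists[OF assms] connecting_eq connects_def by blast

lemma connecting_hom: "group_hom (HI k) (HW (k + 1)) (connecting k)"
proof (rule group_homI)
  show "connecting k \<in> hom (HI k) (HW (k + 1))"
  proof (rule homI)
    fix \<xi> assume "\<xi> \<in> carrier (HI k)"
    then obtain \<eta> where \<eta>: "\<eta> \<in> carrier (ZI k)" "\<xi> = CI k \<eta>"
      unfolding UI.Y.carrier_H by blast
    then show "connecting k \<xi> \<in> carrier (HW (k + 1))"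
      using connecting_cls[OF \<eta>(1)] WU.X.cls_H by metis
  next
    fix \<xi> \<zeta> assume "\<xi> \<in> carrier (HI k)" "\<zeta> \<in> carrier (HI k)"
    then obtain x y where x: "x \<in> carrier (ZI k)" "\<xi> = CI k x" and y: "y \<in> carrier (ZI k)" "\<zeta> = CI k y"
      unfolding UI.Y.carrier_H by blast
    obtain \<gamma> where \<gamma>: "connects k x \<gamma>" "connecting k (CI k x) = CW (k + 1) \<gamma>" "\<gamma> \<in> carrier (ZW (k + 1))"
      using connecting_cls[OF x(1)] .
    obtain \<delta> where \<delta>: "connects k y \<delta>" "connecting k (CI k y) = CW (k + 1) \<delta>" "\<delta> \<in> carrier (ZW (k + 1))"
      using connecting_cls[OF y(1)] .
    \<comment> \<open>The sum of two zigzags is formed as \<open>x - (0 - y)\<close>, since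
      \<open>connects_diff\<close> treats differences.\<close>
    have "connects k 0 0"
      using connects_diff[OF \<gamma>(1) \<gamma>(1)] by simp
    from connects_diff[OF this \<delta>(1)] have "connects k (x + y) (\<gamma> + \<delta>)"
      using connects_diff[OF \<gamma>(1), of "0 - y" "0 - \<delta>"] by simp
    then show "connecting k (\<xi> \<otimes>\<^bsub>HI k\<^esub> \<zeta>) = connecting k \<xi> \<otimes>\<^bsub>HW (k + 1)\<^esub> connecting k \<zeta>"
      unfolding x(2) y(2) UI.Y.H_mult[OF x(1) y(1)] \<gamma>(2) \<delta>(2) WU.X.H_mult[OF \<gamma>(3) \<delta>(3)]
      by (rule connecting_eq)
  qed
qed (intro WU.X.H_group UI.Y.H_group)+

lemma exact_UV: "exact_at (HW k) (pair k) (HU k \<times>\<times> HV k) (difference k) (HI k)"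
  unfolding exact_at_def
proof (intro conjI pair_hom difference_hom Set.set_eqI iffI)
  fix \<xi> assume "\<xi> \<in> kernel (HU k \<times>\<times> HV k) (HI k) (difference k)"
  then obtain a b where ab: "a \<in> carrier (ZU k)" "b \<in> carrier (ZV k)" "\<xi> = (CU k a, CV k b)"
    and ker: "difference k \<xi> = \<one>\<^bsub>HI k\<^esub>"
    by (auto simp: kernel_def DirProd_def WU.Y.carrier_H WV.Y.carrier_H simp del: WU.Y.Z_simps WV.Y.Z_simps)
  have K: "a \<in> KU k" "b \<in> KV k" using ab by auto
  have "rI a - rI b \<in> BI k"
    using ker unfolding ab(3) difference_cls[OF ab(1,2)] UI.Y.cls_one .
  then obtain \<theta> where \<theta>: "\<theta> \<in> KI (k - 1)" "rI a - rI b = DI \<theta>"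
    unfolding UI.Y.B_def by blast
  \<comment> \<open>The two cycles agree on the overlap up to a boundary. A lift of its primitive
    corrects \<open>a\<close> and \<open>b\<close> within their classes, so that they agree exactly
    and glue.\<close>
  obtain \<alpha> \<beta> where 2: "\<alpha> \<in> KU (k - 1)" "\<beta> \<in> KV (k - 1)" "rI \<alpha> - rI \<beta> = \<theta>"
    using lift[OF \<theta>(1)] by blast
  have DK: "DU \<alpha> \<in> KU k" "DV \<beta> \<in> KV k"
    using WU.Y.D_K[OF 2(1)] WV.Y.D_K[OF 2(2)] by simp_all
  have "rI (DU \<alpha>) - rI (DV \<beta>) = rI a - rI b"
    using UI.Y.D_diff[OF UI.r_K[OF 2(1)] VI.r_K[OF 2(2)]] 2(3) \<theta>(2) UI.r_D[OF 2(1)] VI.r_D[OF 2(2)] by simp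
  then have "rI (a - DU \<alpha>) = rI (b - DV \<beta>)"
    by (simp add: UI.r_diff algebra_simps)
  then obtain w where w: "w \<in> KW k" "rU w = a - DU \<alpha>" "rV w = b - DV \<beta>"
    using glue[OF WU.Y.K_diff[OF K(1) DK(1)] WV.Y.K_diff[OF K(2) DK(2)]] by blast
  have "DW w = 0"
  proof (rule separated)
    show "DW w \<in> KW (k + 1)" by (rule WU.X.D_K[OF w(1)])
    show "rU (DW w) = 0"
      using WU.Y.D_diff[OF K(1) DK(1)] WU.Y.D_D[OF 2(1)] ab(1) by (simp add: WU.r_D[OF w(1)] w)
    show "rV (DW w) = 0"
      using WV.Y.D_diff[OF K(2) DK(2)] WV.Y.D_D[OF 2(2)] ab(2) by (simp add: WV.r_D[OF w(1)] w)
  qed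
  then have wZ: "w \<in> carrier (ZW k)" using w by simp
  have "DU \<alpha> \<in> BU k" "DV \<beta> \<in> BV k"
    using 2 by (auto simp: WU.Y.B_def WV.Y.B_def)
  then have "CU k (rU w) = CU k a" "CV k (rV w) = CV k b"
    using WU.Y.B_minus WV.Y.B_minus by (simp_all add: WU.Y.cls_eq_iff WV.Y.cls_eq_iff w)
  then have "\<xi> = pair k (CW k w)"
    by (simp add: ab(3) pair_cls)
  then show "\<xi> \<in> pair k ` carrier (HW k)"
    using WU.X.cls_H[OF wZ] by blast
next
  fix \<xi> assume "\<xi> \<in> pair k ` carrier (HW k)"
  then obtain w where w: "w \<in> carrier (ZW k)" "\<xi> = (CU k (rU w), CV k (rV w))"
    unfolding WU.X.carrier_H using pair_cls by auto
  note Z = WU.r_Z[OF w(1)] WV.r_Z[OF w(1)]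
  have "rI (rU w) - rI (rV w) = 0"
    using compat[of w k] w(1) by simp
  then have "difference k \<xi> = \<one>\<^bsub>HI k\<^esub>"
    unfolding w(2) difference_cls[OF Z] by (simp add: UI.Y.H_one)
  then show "\<xi> \<in> kernel (HU k \<times>\<times> HV k) (HI k) (difference k)"
    unfolding kernel_def using WU.Y.cls_H[OF Z(1)] WV.Y.cls_H[OF Z(2)] by (simp add: w(2) DirProd_def)
qed

lemma exact_I: "exact_at (HU k \<times>\<times> HV k) (difference k) (HI k) (connecting k) (HW (k + 1))"
  unfolding exact_at_def
proof (intro conjI connecting_hom difference_hom Set.set_eqI iffI)
  fix \<xi> assume "\<xi> \<in> kernel (HI k) (HW (k + 1)) (connecting k)"
  then obtain \<eta> where \<eta>: "\<eta> \<in> carrier (ZI k)" "\<xi> = CI k \<eta>" "connecting k (CI k \<eta>) = \<one>\<^bsub>HW (k + 1)\<^esub>"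
    unfolding kernel_def UI.Y.carrier_H by blast
  obtain \<gamma> where \<gamma>: "connects k \<eta> \<gamma>" "connecting k (CI k \<eta>) = CW (k + 1) \<gamma>" "\<gamma> \<in> carrier (ZW (k + 1))"
    using connecting_cls[OF \<eta>(1)] .
  have "\<gamma> \<in> BW (k + 1)"
    using \<eta>(3) unfolding \<gamma>(2) WU.X.cls_one .
  then obtain \<delta> where \<delta>: "\<delta> \<in> KW k" "\<gamma> = DW \<delta>"
    unfolding WU.X.B_def by auto
  obtain \<alpha> \<beta> where 1: "\<alpha> \<in> KU k" "\<beta> \<in> KV k" "rI \<alpha> - rI \<beta> = \<eta>" "rU \<gamma> = DU \<alpha>" "rV \<gamma> = DV \<beta>"
    using \<gamma>(1) unfolding connects_def by blast
  \<comment> \<open>As \<gamma> is the differential of \<delta>, subtracting the restrictions of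
    \<delta> turns \<alpha> and \<beta> into cycles without changing their difference on the
    overlap.\<close>
  note rK = WU.r_K[OF \<delta>(1)] WV.r_K[OF \<delta>(1)]
  have Z: "\<alpha> - rU \<delta> \<in> carrier (ZU k)" "\<beta> - rV \<delta> \<in> carrier (ZV k)"
    using 1 \<delta> WU.Y.K_diff[OF 1(1) rK(1)] WV.Y.K_diff[OF 1(2) rK(2)] WU.Y.D_diff[OF 1(1) rK(1)]
      WV.Y.D_diff[OF 1(2) rK(2)] WU.r_D[OF \<delta>(1)] WV.r_D[OF \<delta>(1)] by auto
  have "rI (\<alpha> - rU \<delta>) - rI (\<beta> - rV \<delta>) = \<eta>"
    using 1(3) compat[OF \<delta>(1)] by (simp add: UI.r_diff)
  then have "\<xi> = difference k (CU k (\<alpha> - rU \<delta>), CV k (\<beta> - rV \<delta>))"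
    unfolding \<eta>(2) difference_cls[OF Z] by simp
  then show "\<xi> \<in> difference k ` carrier (HU k \<times>\<times> HV k)"
    using WU.Y.cls_H[OF Z(1)] WV.Y.cls_H[OF Z(2)] by (auto simp: DirProd_def)
next
  fix \<xi> assume "\<xi> \<in> difference k ` carrier (HU k \<times>\<times> HV k)"
  then obtain a b where ab: "a \<in> carrier (ZU k)" "b \<in> carrier (ZV k)" "\<xi> = difference k (CU k a, CV k b)"
    by (auto simp: DirProd_def WU.Y.carrier_H WV.Y.carrier_H simp del: WU.Y.Z_simps WV.Y.Z_simps)
  have I: "rI a - rI b \<in> carrier (ZI k)"
    using UI.r_Z[OF ab(1)] VI.r_Z[OF ab(2)] UI.Y.K_diff UI.Y.D_diff by auto
  \<comment> \<open>The cycles \<open>a\<close> and \<open>b\<close> themselves serve as lifts;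
    their differentials are zero, so the zigzag ends at zero.\<close>
  have "connects k (rI a - rI b) 0"
    unfolding connects_def
  proof (intro conjI)
    show "0 \<in> carrier (ZW (k + 1))" by (simp add: WU.X.K_zero WU.X.D_zero)
    show "\<exists>\<alpha>\<in>KU k. \<exists>\<beta>\<in>KV k. rI \<alpha> - rI \<beta> = rI a - rI b \<and> rU 0 = DU \<alpha> \<and> rV 0 = DV \<beta>"
      by (rule bexI[of _ a], rule bexI[of _ b]) (use ab(1,2) in \<open>simp_all add: WU.r_zero WV.r_zero\<close>)
  qed (rule I)
  from connecting_eq[OF this] have "connecting k \<xi> = \<one>\<^bsub>HW (k + 1)\<^esub>"
    unfolding ab(3) difference_cls[OF ab(1,2)] by (simp add: WU.X.H_one)
  then show "\<xi> \<in> kernel (HI k) (HW (k + 1)) (connecting k)"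
    unfolding kernel_def using UI.Y.cls_H[OF I] by (simp add: ab(3) difference_cls[OF ab(1,2)])
qed

lemma exact_W: "exact_at (HI k) (connecting k) (HW (k + 1)) (pair (k + 1)) (HU (k + 1) \<times>\<times> HV (k + 1))"
  unfolding exact_at_def
proof (intro conjI connecting_hom pair_hom Set.set_eqI iffI)
  fix \<xi> assume "\<xi> \<in> kernel (HW (k + 1)) (HU (k + 1) \<times>\<times> HV (k + 1)) (pair (k + 1))"
  then obtain \<gamma> where \<gamma>: "\<gamma> \<in> carrier (ZW (k + 1))" "\<xi> = CW (k + 1) \<gamma>"
    and ker: "pair (k + 1) (CW (k + 1) \<gamma>) = \<one>\<^bsub>HU (k + 1) \<times>\<times> HV (k + 1)\<^esub>"
    unfolding kernel_def WU.X.carrier_H by blast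
  have "rU \<gamma> \<in> BU (k + 1)" "rV \<gamma> \<in> BV (k + 1)"
    using ker by (simp_all add: pair_cls DirProd_def WU.Y.cls_one WV.Y.cls_one)
  then obtain \<alpha> \<beta> where 1: "\<alpha> \<in> KU k" "\<beta> \<in> KV k" "rU \<gamma> = DU \<alpha>" "rV \<gamma> = DV \<beta>"
    unfolding WU.Y.B_def WV.Y.B_def by auto
  have "DI (rI \<alpha> - rI \<beta>) = rI (rU \<gamma>) - rI (rV \<gamma>)"
    using UI.Y.D_diff[OF UI.r_K[OF 1(1)] VI.r_K[OF 1(2)]] UI.r_D[OF 1(1)] VI.r_D[OF 1(2)] 1 by simp
  \<comment> \<open>Both restrictions of \<gamma> are boundaries; their primitives differ on the
    overlap by a cycle, from which the zigzag leads back to \<gamma>.\<close>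
  then have \<eta>: "rI \<alpha> - rI \<beta> \<in> carrier (ZI k)"
    using compat[of \<gamma> "k + 1"] \<gamma>(1) UI.Y.K_diff[OF UI.r_K[OF 1(1)] VI.r_K[OF 1(2)]] by simp
  then have "connects k (rI \<alpha> - rI \<beta>) \<gamma>"
    unfolding connects_def using 1 \<gamma> by blast
  then have "\<xi> = connecting k (CI k (rI \<alpha> - rI \<beta>))"
    unfolding \<gamma>(2) by (rule connecting_eq[symmetric])
  then show "\<xi> \<in> connecting k ` carrier (HI k)"
    using UI.Y.cls_H[OF \<eta>] by blast
next
  fix \<xi> assume "\<xi> \<in> connecting k ` carrier (HI k)"
  then obtain \<eta> where \<eta>: "\<eta> \<in> carrier (ZI k)" "\<xi> = connecting k (CI k \<eta>)"
    unfolding UI.Y.carrier_H by blast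
  obtain \<gamma> where \<gamma>: "connects k \<eta> \<gamma>" "connecting k (CI k \<eta>) = CW (k + 1) \<gamma>" "\<gamma> \<in> carrier (ZW (k + 1))"
    using connecting_cls[OF \<eta>(1)] .
  have "rU \<gamma> \<in> BU (k + 1)" "rV \<gamma> \<in> BV (k + 1)"
    using \<gamma>(1) unfolding connects_def by (auto simp: WU.Y.B_def WV.Y.B_def)
  then have "pair (k + 1) \<xi> = \<one>\<^bsub>HU (k + 1) \<times>\<times> HV (k + 1)\<^esub>"
    unfolding \<eta>(2) \<gamma>(2) pair_cls by (simp add: DirProd_def WU.Y.cls_one WV.Y.cls_one)
  then show "\<xi> \<in> kernel (HW (k + 1)) (HU (k + 1) \<times>\<times> HV (k + 1)) (pair (k + 1))"
    unfolding kernel_def using WU.X.cls_H[OF \<gamma>(3)] by (simp add: \<eta>(2) \<gamma>(2))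
qed

end

section \<open>The Mayer--Vietoris sequence\<close>

lemma restrict_form_diff: "restrict_form U (\<omega> - \<eta>) = restrict_form U \<omega> - restrict_form U \<eta>"
  by (simp add: restrict_form_def fun_eq_iff)

lemma restrict_form_restrict: "V \<subseteq> U \<Longrightarrow> restrict_form V (restrict_form U \<omega>) = restrict_form V \<omega>"
  by (auto simp: restrict_form_def fun_eq_iff)

section \<open>Koszul-Brylinski cochains as a complex\<close>

context poisson_mfd
begin

text \<open>Zero is a form of every type, so no case distinction on the degree remains.\<close>

lemma KB_form: "\<omega> \<in> KB_cochains M j U \<Longrightarrow> \<omega> p q \<in> forms M U p q"
  using forms_zero unfolding KB_cochains_def by (cases "int q - int p = j") (auto split: if_splits)

lemma KB_zero: "\<omega> \<in> KB_cochains M j U \<Longrightarrow> int q - int p \<noteq> j \<Longrightarrow> \<omega> p q = 0"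
  unfolding KB_cochains_def by auto

lemma KB_I:
  assumes "\<And>p q. int q - int p = j \<Longrightarrow> \<omega> p q \<in> forms M U p q" "\<And>p q. int q - int p \<noteq> j \<Longrightarrow> \<omega> p q = 0"
  shows "\<omega> \<in> KB_cochains M j U"
  using assms unfolding KB_cochains_def by auto

context
  fixes U assumes U: "openin (top_of M) U"
begin

lemma forms_add: "\<omega> \<in> forms M U p q \<Longrightarrow> \<eta> \<in> forms M U p q \<Longrightarrow> \<omega> + \<eta> \<in> forms M U p q"
  using forms_diff[OF U _ forms_diff[OF U forms_zero], of \<omega> p q \<eta>] by simp

lemma differentials_zero: "del_pi M \<pi> U 0 = 0" "delbar M U 0 = 0"
  using del_pi_diff[OF U forms_zero forms_zero] by simp_all

lemma differentials_add:
  assumes "\<omega> \<in> forms M U p q" "\<eta> \<in> forms M U p q"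
  shows "del_pi M \<pi> U (\<omega> + \<eta>) = del_pi M \<pi> U \<omega> + del_pi M \<pi> U \<eta>"
    "delbar M U (\<omega> + \<eta>) = delbar M U \<omega> + delbar M U \<eta>"
  using del_pi_diff[OF U assms(1) forms_diff[OF U forms_zero assms(2)]]
    del_pi_diff[OF U forms_zero assms(2)] by (simp_all add: differentials_zero)

lemma KB_diff_cochains:
  assumes \<omega>: "\<omega> \<in> KB_cochains M j U"
  shows "KB_diff M \<pi> U \<omega> \<in> KB_cochains M (j + 1) U"
proof (rule KB_I)
  fix p q
  show "KB_diff M \<pi> U \<omega> p q \<in> forms M U p q"
    unfolding KB_diff_def
    by (cases q) (auto intro!: forms_add del_pi_forms[OF U] delbar_forms[OF U] KB_form[OF \<omega>] simp: forms_zero)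
  assume "int q - int p \<noteq> j + 1"
  then show "KB_diff M \<pi> U \<omega> p q = 0"
    unfolding KB_diff_def by (cases q) (simp_all add: KB_zero[OF \<omega>] differentials_zero)
qed

lemma KB_complex: "cochain_complex (\<lambda>j. KB_cochains M (j - int (cdim M)) U) (KB_diff M \<pi> U)"
proof
  fix j x y
  assume x: "x \<in> KB_cochains M (j - int (cdim M)) U"
  show "KB_diff M \<pi> U x \<in> KB_cochains M (j + 1 - int (cdim M)) U"
    using KB_diff_cochains[OF x] by (simp add: algebra_simps)
  show "KB_diff M \<pi> U (KB_diff M \<pi> U x) = 0"
  proof (intro ext)
    fix p q c z "is" js
    note f = KB_form[OF x]
    \<comment> \<open>Sorted by type: the squares of the two differentials at the ends, and in
      between the mixed terms, which cancel. The case distinctions account for \<open>q < 2\<close>,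
      where some terms are absent.\<close>
    have expand: "KB_diff M \<pi> U (KB_diff M \<pi> U x) p q
       = del_pi M \<pi> U (del_pi M \<pi> U (x (Suc (Suc p)) q))
       + (case q of 0 \<Rightarrow> 0 | Suc q' \<Rightarrow> (del_pi M \<pi> U (delbar M U (x (Suc p) q')) + delbar M U (del_pi M \<pi> U (x (Suc p) q')))
         + (case q' of 0 \<Rightarrow> 0 | Suc q'' \<Rightarrow> delbar M U (delbar M U (x p q''))))"
    proof (cases q)
      case 0
      then show ?thesis by (simp add: KB_diff_def)
    next
      case (Suc q')
      have "del_pi M \<pi> U (del_pi M \<pi> U (x (Suc (Suc p)) q) + delbar M U (x (Suc p) q'))
        = del_pi M \<pi> U (del_pi M \<pi> U (x (Suc (Suc p)) q)) + del_pi M \<pi> U (delbar M U (x (Suc p) q'))"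
        unfolding Suc by (rule differentials_add(1)[OF del_pi_forms[OF U f] delbar_forms[OF U f]])
      moreover have "delbar M U (del_pi M \<pi> U (x (Suc p) q') + (case q' of 0 \<Rightarrow> 0 | Suc q'' \<Rightarrow> delbar M U (x p q'')))
        = delbar M U (del_pi M \<pi> U (x (Suc p) q')) + (case q' of 0 \<Rightarrow> 0 | Suc q'' \<Rightarrow> delbar M U (delbar M U (x p q'')))"
      proof (cases q')
        case (Suc q'')
        have "delbar M U (del_pi M \<pi> U (x (Suc p) (Suc q'')) + delbar M U (x p q''))
          = delbar M U (del_pi M \<pi> U (x (Suc p) (Suc q''))) + delbar M U (delbar M U (x p q''))"
          by (rule differentials_add(2)[OF del_pi_forms[OF U f] delbar_forms[OF U f]])
        then show ?thesis by (simp add: Suc)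
      qed simp
      ultimately show ?thesis
        by (simp add: KB_diff_def Suc add.assoc)
    qed
    have "KB_diff M \<pi> U (KB_diff M \<pi> U x) p q = 0"
      unfolding expand
      by (auto simp: differentials_square[OF U f] split: nat.split)
    then show "KB_diff M \<pi> U (KB_diff M \<pi> U x) p q c z is js = 0 p q c z is js"
      by simp
  qed
  assume y: "y \<in> KB_cochains M (j - int (cdim M)) U"
  show "x - y \<in> KB_cochains M (j - int (cdim M)) U"
    by (rule KB_I) (auto intro: forms_diff[OF U] KB_form[OF x] KB_form[OF y] simp: KB_zero[OF x] KB_zero[OF y])
  show "KB_diff M \<pi> U (x - y) = KB_diff M \<pi> U x - KB_diff M \<pi> U y"
  proof (intro ext)
    fix p q c z "is" js
    have "KB_diff M \<pi> U (x - y) p q = KB_diff M \<pi> U x p q - KB_diff M \<pi> U y p q"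
      unfolding KB_diff_def
      by (cases q) (simp_all add: del_pi_diff[OF U KB_form[OF x] KB_form[OF y]])
    then show "KB_diff M \<pi> U (x - y) p q c z is js = (KB_diff M \<pi> U x - KB_diff M \<pi> U y) p q c z is js"
      by simp
  qed
qed (auto intro!: KB_I simp: forms_zero)

lemma KB_homology_eq:
  "KB_homology M \<pi> k U = cochain_complex.H (\<lambda>j. KB_cochains M (j - int (cdim M)) U) (KB_diff M \<pi> U) k"
  "KB_class M \<pi> k U = cochain_complex.cls (\<lambda>j. KB_cochains M (j - int (cdim M)) U) (KB_diff M \<pi> U) k"
  "KB_cycle_group M \<pi> k U = cochain_complex.Z (\<lambda>j. KB_cochains M (j - int (cdim M)) U) (KB_diff M \<pi> U) k"
proof -
  interpret cochain_complex "\<lambda>j. KB_cochains M (j - int (cdim M)) U" "KB_diff M \<pi> U"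
    by (rule KB_complex)
  \<comment> \<open>The degree \<open>k - n - 1\<close> of the definition, with \<open>n\<close> the
    dimension, is the degree \<open>(k - 1) - n\<close> of the shifted complex.\<close>
  have B: "KB_boundaries M \<pi> k U = B k"
    by (simp add: KB_boundaries_def B_def algebra_simps)
  show Z: "KB_cycle_group M \<pi> k U = Z k"
    by (simp add: KB_cycle_group_def Z_def)
  show "KB_homology M \<pi> k U = H k"
    by (simp add: KB_homology_def H_def B Z)
  show "KB_class M \<pi> k U = cls k"
    by (simp add: KB_class_def cls_def B Z fun_eq_iff)
qed

lemma KB_restrict_chain:
  assumes V: "openin (top_of M) V" "V \<subseteq> U"
  shows "x \<in> KB_cochains M j U \<Longrightarrow> restrict_form V x \<in> KB_cochains M j V"
    and "restrict_form V (KB_diff M \<pi> U x) = KB_diff M \<pi> V (restrict_form V x)"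
proof -
  have z: "rs V 0 = (0 :: ('a, 'n) form)"
    by (simp add: rs_def fun_eq_iff)
  show "restrict_form V x \<in> KB_cochains M j V" if x: "x \<in> KB_cochains M j U"
  proof (rule KB_I)
    show "restrict_form V x p q \<in> forms M V p q" for p q
      unfolding restrict_form_rs by (rule forms_rs[OF U V KB_form[OF x]])
    show "restrict_form V x p q = 0" if "int q - int p \<noteq> j" for p q
      unfolding restrict_form_rs KB_zero[OF x that] by (rule z)
  qed
  have a: "rs V (\<alpha> + \<beta>) = rs V \<alpha> + rs V \<beta>" for \<alpha> \<beta> :: "('a, 'n) form"
    by (simp add: rs_def fun_eq_iff)
  have "restrict_form V (KB_diff M \<pi> U x) p q = KB_diff M \<pi> V (restrict_form V x) p q" for p q
    unfolding restrict_form_rs KB_diff_def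
    by (cases q) (simp_all add: a z restrict_form_rs del_pi_rs[OF V] del_rs(2)[OF V])
  then show "restrict_form V (KB_diff M \<pi> U x) = KB_diff M \<pi> V (restrict_form V x)"
    by blast
qed

lemma KB_chain_map:
  assumes V: "openin (top_of M) V" "V \<subseteq> U" and CV: "cochain_complex (\<lambda>j. KB_cochains M (j - int (cdim M)) V) (KB_diff M \<pi> V)"
  shows "chain_map (\<lambda>j. KB_cochains M (j - int (cdim M)) U) (KB_diff M \<pi> U)
    (\<lambda>j. KB_cochains M (j - int (cdim M)) V) (KB_diff M \<pi> V) (restrict_form V)"
  unfolding chain_map_def chain_map_axioms_def
  using KB_complex CV KB_restrict_chain[OF V] restrict_form_diff by blast

end

section \<open>Gluing and splitting of cochains\<close>

lemma KB_outside: "\<omega> \<in> KB_cochains M j U \<Longrightarrow> x \<notin> U \<Longrightarrow> \<omega> p q c x is js = 0"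
  by (rule form_outside[OF KB_form])

lemma KB_glue:
  assumes U: "openin (top_of M) U" and V: "openin (top_of M) V"
    and a: "a \<in> KB_cochains M j U" and b: "b \<in> KB_cochains M j V"
    and ab: "restrict_form (U \<inter> V) a = restrict_form (U \<inter> V) b"
  shows "\<exists>w\<in>KB_cochains M j (U \<union> V). restrict_form U w = a \<and> restrict_form V w = b"
proof -
  define w :: "('a, 'n) mixed_form" where "w p q c x is js = (if x \<in> U then a p q c x is js else b p q c x is js)" for p q c x "is" js
  have eq: "a p q c x is js = b p q c x is js" if "x \<in> U" "x \<in> V" for p q c x "is" js
    using fun_cong[OF fun_cong[OF fun_cong[OF fun_cong[OF fun_cong[OF fun_cong[OF ab, of p], of q], of c], of x], of "is"], of js] that
    by (simp add: restrict_form_def)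
  have wU: "restrict_form U w = a"
    using KB_outside[OF a] by (auto simp: restrict_form_def w_def fun_eq_iff)
  have wV: "restrict_form V w = b"
    using KB_outside[OF b] eq by (auto simp: restrict_form_def w_def fun_eq_iff)
  have "w \<in> KB_cochains M j (U \<union> V)"
  proof (rule KB_I)
    fix p q
    show "w p q \<in> forms M (U \<union> V) p q"
    proof (rule forms_glue[OF U V])
      show "w p q c x is js = 0" if "x \<notin> U \<union> V" for c x "is" js
        using that KB_outside[OF b] by (simp add: w_def)
      show "rs U (w p q) \<in> forms M U p q" "rs V (w p q) \<in> forms M V p q"
        unfolding restrict_form_rs[symmetric] wU wV by (rule KB_form[OF a] KB_form[OF b])+
    qed
    assume "int q - int p \<noteq> j"
    then show "w p q = 0"
      using KB_zero[OF a] KB_zero[OF b] by (auto simp: w_def fun_eq_iff)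
  qed
  with wU wV show ?thesis by blast
qed

lemma KB_lift:
  assumes U: "openin (top_of M) U" and V: "openin (top_of M) V" and \<eta>: "\<eta> \<in> KB_cochains M j (U \<inter> V)"
  shows "\<exists>a\<in>KB_cochains M j U. \<exists>b\<in>KB_cochains M j V.
    restrict_form (U \<inter> V) a - restrict_form (U \<inter> V) b = \<eta>"
proof -
  obtain \<rho> :: "'a \<Rightarrow> complex" where \<rho>: "\<And>c. c \<in> atlas M \<Longrightarrow> smooth_in (ind M) c ((U \<union> V) \<inter> dom_of c) \<rho>"
    "\<And>x. x \<in> U - V \<Longrightarrow> \<exists>N. openin (top_of M) N \<and> x \<in> N \<and> (\<forall>y\<in>N. 1 - \<rho> y = 0)"
    "\<And>x. x \<in> V - U \<Longrightarrow> \<exists>N. openin (top_of M) N \<and> x \<in> N \<and> (\<forall>y\<in>N. \<rho> y = 0)"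
    using partition_of_unity[OF U V] by blast
  have s: "smooth_in (ind M) c ((U \<inter> V) \<inter> dom_of c) \<rho>"
    "smooth_in (ind M) c ((U \<inter> V) \<inter> dom_of c) (\<lambda>x. 1 - \<rho> x)"
    "smooth_in (ind M) c ((V \<inter> U) \<inter> dom_of c) (\<lambda>x. - \<rho> x)" if c: "c \<in> atlas M" for c
  proof -
    interpret X: poisson_chart M \<pi> c "(U \<union> V) \<inter> dom_of c"
      by (rule poisson_chart_inter[OF openin_Un[OF U V] c])
    interpret Y: poisson_chart M \<pi> c "(U \<inter> V) \<inter> dom_of c"
      by (rule poisson_chart_inter[OF openin_Int[OF U V] c])
    show 1: "smooth_in (ind M) c ((U \<inter> V) \<inter> dom_of c) \<rho>"
      by (rule X.smooth_in_subset[OF Y.W _ \<rho>(1)[OF c]]) auto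
    then show "smooth_in (ind M) c ((U \<inter> V) \<inter> dom_of c) (\<lambda>x. 1 - \<rho> x)"
      by (rule Y.smooth_in_one_minus)
    show "smooth_in (ind M) c ((V \<inter> U) \<inter> dom_of c) (\<lambda>x. - \<rho> x)"
      unfolding Int_commute[of V U]
      by (rule Y.smooth_in_linear[OF bounded_linear_minus[OF bounded_linear_ident] 1])
  qed
  define a :: "('a, 'n) mixed_form" where "a p q = (\<lambda>c x is js. (1 - \<rho> x) * \<eta> p q c x is js)" for p q
  \<comment> \<open>The minus sign is due to the difference map: on the overlap \<open>a - b\<close>
    is \<open>(1 - \<rho>) + \<rho>\<close> times \<eta>. The factor in \<open>a\<close> has to
    vanish near \<open>U - V\<close> and the one in \<open>b\<close> near \<open>V - U\<close>,
    which decides where \<rho> goes.\<close>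
  define b :: "('a, 'n) mixed_form" where "b p q = (\<lambda>c x is js. - \<rho> x * \<eta> p q c x is js)" for p q
  have \<eta>': "\<eta> p q \<in> forms M (V \<inter> U) p q" for p q
    using KB_form[OF \<eta>] by (simp add: Int_commute)
  have "a \<in> KB_cochains M j U"
  proof (rule KB_I)
    show "a p q \<in> forms M U p q" for p q
      unfolding a_def by (rule forms_extend[OF U V s(2) \<rho>(2) KB_form[OF \<eta>]])
    show "a p q = 0" if "int q - int p \<noteq> j" for p q
      using KB_zero[OF \<eta> that] by (simp add: a_def fun_eq_iff)
  qed
  moreover have "b \<in> KB_cochains M j V"
  proof (rule KB_I)
    show "b p q \<in> forms M V p q" for p q
      unfolding b_def
    proof (rule forms_extend[OF V U s(3) _ \<eta>'])
      show "\<exists>N. openin (top_of M) N \<and> x \<in> N \<and> (\<forall>y\<in>N. - \<rho> y = 0)" if "x \<in> V - U" for x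
        using \<rho>(3)[OF that] by simp
    qed
    show "b p q = 0" if "int q - int p \<noteq> j" for p q
      using KB_zero[OF \<eta> that] by (simp add: b_def fun_eq_iff)
  qed
  moreover have "restrict_form (U \<inter> V) a - restrict_form (U \<inter> V) b = \<eta>"
    using KB_outside[OF \<eta>] by (auto simp: restrict_form_def a_def b_def fun_eq_iff algebra_simps)
  ultimately show ?thesis by blast
qed

end

theorem proposition4p1:
  fixes M :: "('a, 'n::finite) cmanifold" and \<pi> :: "('a, 'n) bivector" and U V :: "'a set"
  assumes "holomorphic_poisson_manifold M \<pi>"
    and "openin (top_of M) U" and "openin (top_of M) V"
  shows "\<exists>g :: int \<Rightarrow> ('a, 'n) mixed_form set \<Rightarrow> ('a, 'n) mixed_form set. \<forall>k.
    is_connecting_hom M \<pi> k U V (g k) \<and>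
    exact_at (KB_homology M \<pi> k (U \<union> V)) (MV_pair M \<pi> k U V)
             (KB_homology M \<pi> k U \<times>\<times> KB_homology M \<pi> k V) (MV_diff M \<pi> k U V)
             (KB_homology M \<pi> k (U \<inter> V)) \<and>
    exact_at (KB_homology M \<pi> k U \<times>\<times> KB_homology M \<pi> k V) (MV_diff M \<pi> k U V)
             (KB_homology M \<pi> k (U \<inter> V)) (g k)
             (KB_homology M \<pi> (k + 1) (U \<union> V)) \<and>
    exact_at (KB_homology M \<pi> k (U \<inter> V)) (g k)
             (KB_homology M \<pi> (k + 1) (U \<union> V)) (MV_pair M \<pi> (k + 1) U V)
             (KB_homology M \<pi> (k + 1) U \<times>\<times> KB_homology M \<pi> (k + 1) V)"
proof -
  interpret poisson_mfd M \<pi>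
    by unfold_locales (rule assms(1))
  note U = assms(2) and V = assms(3)
  note W = openin_Un[OF U V] and I = openin_Int[OF U V]
  let ?K = "\<lambda>U j. KB_cochains M (j - int (cdim M)) U" and ?D = "KB_diff M \<pi>"
  have mv: "mayer_vietoris (?K (U \<union> V)) (?D (U \<union> V)) (?K U) (?D U) (?K V) (?D V) (?K (U \<inter> V)) (?D (U \<inter> V))
    (restrict_form U) (restrict_form V) (restrict_form (U \<inter> V))"
    unfolding mayer_vietoris_def mayer_vietoris_axioms_def
  proof (intro conjI allI impI)
    show "chain_map (?K (U \<union> V)) (?D (U \<union> V)) (?K U) (?D U) (restrict_form U)"
      by (rule KB_chain_map[OF W U _ KB_complex[OF U]]) auto
    show "chain_map (?K (U \<union> V)) (?D (U \<union> V)) (?K V) (?D V) (restrict_form V)"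
      by (rule KB_chain_map[OF W V _ KB_complex[OF V]]) auto
    show "chain_map (?K U) (?D U) (?K (U \<inter> V)) (?D (U \<inter> V)) (restrict_form (U \<inter> V))"
      by (rule KB_chain_map[OF U I _ KB_complex[OF I]]) auto
    show "chain_map (?K V) (?D V) (?K (U \<inter> V)) (?D (U \<inter> V)) (restrict_form (U \<inter> V))"
      by (rule KB_chain_map[OF V I _ KB_complex[OF I]]) auto
    show "restrict_form (U \<inter> V) (restrict_form U w) = restrict_form (U \<inter> V) (restrict_form V w)" for w :: "('a, 'n) mixed_form"
      by (simp add: restrict_form_restrict)
    show "\<exists>w\<in>?K (U \<union> V) j. restrict_form U w = a \<and> restrict_form V w = b"
      if "a \<in> ?K U j" "b \<in> ?K V j" "restrict_form (U \<inter> V) a = restrict_form (U \<inter> V) b" for a b j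
      by (rule KB_glue[OF U V that])
    \<comment> \<open>Components are zero outside \<open>U \<union> V\<close> by definition, so the
      two restrictions determine the form.\<close>
    show "w = 0" if w: "w \<in> ?K (U \<union> V) j" and U0: "restrict_form U w = 0" and V0: "restrict_form V w = 0" for w j
    proof (intro ext)
      fix p q c x "is" js
      have "restrict_form U w p q c x is js = 0" "restrict_form V w p q c x is js = 0"
        unfolding U0 V0 by simp_all
      then show "w p q c x is js = 0 p q c x is js"
        using KB_outside[OF w, of x p q c "is" js] by (auto simp: restrict_form_def split: if_splits)
    qed
    show "\<exists>a\<in>?K U j. \<exists>b\<in>?K V j. restrict_form (U \<inter> V) a - restrict_form (U \<inter> V) b = x"
      if "x \<in> ?K (U \<inter> V) j" for x j
      by (rule KB_lift[OF U V that])
  qed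
  interpret mv: mayer_vietoris "?K (U \<union> V)" "?D (U \<union> V)" "?K U" "?D U" "?K V" "?D V" "?K (U \<inter> V)" "?D (U \<inter> V)"
    "restrict_form U" "restrict_form V" "restrict_form (U \<inter> V)"
    by (rule mv)
  note eqs = KB_homology_eq[OF U] KB_homology_eq[OF V] KB_homology_eq[OF W] KB_homology_eq[OF I]
  have restrict: "KB_restrict M \<pi> k S = induced (KB_class M \<pi> k S) (restrict_form S)" for k S
    by (simp add: KB_restrict_def induced_def fun_eq_iff)
  have pair: "MV_pair M \<pi> k U V = mv.pair k" for k
    by (simp add: MV_pair_def mv.pair_def restrict eqs fun_eq_iff)
  have diff: "MV_diff M \<pi> k U V = mv.difference k" for k
    by (simp add: MV_diff_def mv.difference_def restrict eqs fun_eq_iff)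
  \<comment> \<open>Any data as in \<open>is_connecting_hom\<close> form a zigzag, on which
    \<open>connecting_eq\<close> evaluates the chosen map.\<close>
  have conn: "is_connecting_hom M \<pi> k U V (mv.connecting k)" for k
    unfolding is_connecting_hom_def eqs
  proof (intro conjI ballI impI)
    show "mv.connecting k \<in> hom (mv.HI k) (mv.HW (k + 1))"
      by (rule group_hom.homh[OF mv.connecting_hom])
    fix \<eta> \<alpha> \<beta> \<gamma>
    assume "\<eta> \<in> carrier (mv.ZI k)" "\<alpha> \<in> ?K U k" "\<beta> \<in> ?K V k" "\<gamma> \<in> carrier (mv.ZW (k + 1))"
      "restrict_form (U \<inter> V) \<alpha> - restrict_form (U \<inter> V) \<beta> = \<eta> \<and>
        restrict_form U \<gamma> = ?D U \<alpha> \<and> restrict_form V \<gamma> = ?D V \<beta>"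
    then have "mv.connects k \<eta> \<gamma>"
      unfolding mv.connects_def by blast
    then show "mv.connecting k (mv.CI k \<eta>) = mv.CW (k + 1) \<gamma>"
      by (rule mv.connecting_eq)
  qed
  show ?thesis
    unfolding pair diff using conn mv.exact_UV mv.exact_I mv.exact_W
    by (intro exI[of _ mv.connecting]) (simp add: eqs)
qed

end
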